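(* For every $x\in E$, $$\inf_{V\in\mathbb V}J^d(x,V)=\inf_{V\in\mathbb V}J(x,V),$$ where $$J^d(x,V):=\limsup_{T\to\infty}\frac{\mathbb E^V_x\bigl[\int_0^T\beta(s)g(Y_s)ds+\sum_{i=1}^\infty1_{\{\tau_i\le T\}}\beta(\tau_i)c(X^i_{\tau_i},X^{i+1}_{\tau_i})\bigr]}{\int_0^T\beta(s)ds},$$ $$J(x,V):=\limsup_{T\to\infty}\frac{\mathbb E^V_x\bigl[\int_0^Tg(Y_s)ds+\sum_{i=1}^\infty1_{\{\tau_i\le T\}}c(X^i_{\tau_i},X^{i+1}_{\tau_i})\bigr]}{T}.$$
   Context: Process. $X=(X_t)_{t\ge0}$ is a continuous-time standard Feller–Markov process on a filtered space $(\Omega,\mathcal F,(\mathcal F_t))$ (standard in the usual sense of Markov process theory) with values in a compact metric space $(E,\rho)$ with Borel $\sigma$-field $\mathcal E$; $\mathbb P_x,\mathbb E_x$ are the law and expectation for the process started at $x\in E$, and $P_t(x,A):=\mathbb P_x[X_t\in A]$. The set of admissible after-impulse states is $U=E$. $\mathcal C_b(E)$ is the space of bounded continuous real functions on $E$. Standing assumptions. (1) $\beta:[0,\infty)\to(0,1]$ is weakly decreasing and continuous, $\beta(0)=1$, $\beta(t+s)\ge\beta(t)\beta(s)$ for all $t,s\ge0$, and $\int_0^\infty\beta(s)ds=\infty$. (2) $g:E\to\mathbb R$ is continuous and bounded; $c:E\times U\to\mathbb R_+$ is continuous and bounded, and for some $c_0>0$ we have $0<c_0\le c(x,\xi)\le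 c(x,\eta)+c(\eta,\xi)$ for $x,\xi,\eta\in E$. (3) For every $f\in\mathcal C_b(E)$ and $t>0$, the map $x\mapsto\mathbb E_x[f(X_t)]$ is in $\mathcal C_b(E)$. (4) For every $t>0$ there is $\Lambda_t\in(0,1)$ with $\sup_{x,y\in E}\sup_{A\in\mathcal E}|P_t(x,A)-P_t(y,A)|\le\Lambda_t$. Impulse control. A strategy is a sequence $V=(\tau_i,\xi_i)_{i=1}^\infty$ with $(\tau_i)$ an increasing (weakly, values in $[0,\infty]$) sequence of stopping times and $\xi_i$ $\mathcal F_{\tau_i}$-measurable $U$-valued random variables; $\mathbb V$ is the family of all strategies. On a countable product of copies of $(\Omega,\mathcal F,(\mathcal F_t))$ with coordinate process $(X^1_t,X^2_t,\dots)$, to each $x\in E$ and $V\in\mathbb V$ one associates a probability $\mathbb P^V_x$ (expectation $\mathbb E^V_x$) under which $X^1$ follows the uncontrolled dynamics from $x$ and, for each $i\ge1$, on $\{\tau_i<\infty\}$, $X^{i+1}_{\tau_i}=\xi_i$ and from time $\tau_i$ on $X^{i+1}$ follows the uncontrolled dynamics started afresh from $\xi_i$ (conditionally on the past). The controlled process is $Y_t:=X^i_t$ for $t\in[\tau_{i-1},\tau_i)$, $\tau_0\equiv0$. *)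

theory Defs
  imports "HOL-Probability.Probability"
begin

text \<open>
  Time runs through \<open>[0,\<infinity>)\<close>. Filtrations are indexed by \<^typ>\<open>ennreal\<close>, so that the library's
  \<^const>\<open>stopping_time\<close> and \<open>pre_sigma\<close> give stopping times with values in \<open>[0,\<infinity>]\<close>; the member at
  index \<open>\<top>\<close> is the full \<open>\<sigma>\<close>-field of the filtered space. The state space is the type \<open>'e\<close>; its
  compactness is the assumption \<open>compact UNIV\<close> below (a compact metric space is Polish, so
  the sort \<open>polish_space\<close> is no further restriction).
\<close>

definition transition :: "(real \<Rightarrow> 'w \<Rightarrow> 'e::topological_space) \<Rightarrow> ('e \<Rightarrow> 'w measure)
    \<Rightarrow> real \<Rightarrow> 'e \<Rightarrow> 'e set \<Rightarrow> real" where
  "transition X P t x A = measure (P x) {\<omega> \<in> space (P x). X t \<omega> \<in> A}"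

text \<open>
  Strong Markov property from time \<open>\<sigma>\<^sub>0\<close> on: for every stopping time \<open>\<sigma> \<ge> \<sigma>\<^sub>0\<close>,
  \<open>M[\<sigma> < \<infinity>, Z\<^bsub>\<sigma>+s\<^esub> \<in> A | F\<^sub>\<sigma>] = 1\<^bsub>{\<sigma> < \<infinity>}\<^esub> p\<^sub>s(Z\<^sub>\<sigma>, A)\<close> almost surely.
\<close>

definition strong_markov_from :: "'a measure \<Rightarrow> (ennreal \<Rightarrow> 'a measure)
    \<Rightarrow> (real \<Rightarrow> 'e::topological_space \<Rightarrow> 'e set \<Rightarrow> real) \<Rightarrow> ('a \<Rightarrow> ennreal) \<Rightarrow> (real \<Rightarrow> 'a \<Rightarrow> 'e) \<Rightarrow> bool" where
  "strong_markov_from M F p \<sigma>\<^sub>0 Z \<longleftrightarrow>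
    (\<forall>\<sigma>. stopping_time F \<sigma> \<longrightarrow> (\<forall>\<omega>\<in>space M. \<sigma>\<^sub>0 \<omega> \<le> \<sigma> \<omega>) \<longrightarrow>
      (\<forall>s\<ge>0. \<forall>A\<in>sets borel. AE \<omega> in M.
        real_cond_exp M (filtration.pre_sigma (space M) F \<sigma>)
          (\<lambda>\<omega>. if \<sigma> \<omega> < \<top> \<and> Z (enn2real (\<sigma> \<omega>) + s) \<omega> \<in> A then 1 else 0) \<omega>
        = (if \<sigma> \<omega> < \<top> then p s (Z (enn2real (\<sigma> \<omega>)) \<omega>) A else 0)))"

text \<open>
  Conservative standard Markov process (in the sense of Blumenthal and Getoor) on a compact metric
  space. Completeness of the filtration is not demanded: the measures \<open>P\<^sup>V\<^sub>x\<close> below, being singular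
  to the laws \<open>P\<^sub>x\<close> on single coordinates, do not in general extend to the \<open>P\<^sub>x\<close>-completed
  \<open>\<sigma>\<close>-fields.
\<close>

locale standard_process = filtration \<Omega> F
  for \<Omega> :: "'w set" and F :: "ennreal \<Rightarrow> 'w measure" +
  fixes X :: "real \<Rightarrow> 'w \<Rightarrow> 'e::polish_space"
    and P :: "'e \<Rightarrow> 'w measure"
  assumes compact_E: "compact (UNIV :: 'e set)"
    and filtration_right_continuous:
      "\<And>t. t < \<top> \<Longrightarrow> sets (F t) = (\<Inter>s\<in>{t<..}. sets (F s))"
    and adapted: "\<And>t. 0 \<le> t \<Longrightarrow> X t \<in> F (ennreal t) \<rightarrow>\<^sub>M borel"
    and prob_P: "\<And>x. prob_space (P x)"
    and sets_P: "\<And>x. sets (P x) = sets (F \<top>)"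
    and transition_measurable:
      "\<And>t A. 0 \<le> t \<Longrightarrow> A \<in> sets borel \<Longrightarrow> (\<lambda>x. transition X P t x A) \<in> borel_measurable borel"
    and normal: "\<And>x. AE \<omega> in P x. X 0 \<omega> = x"
    and paths_right_continuous:
      "\<And>\<omega> t. \<omega> \<in> \<Omega> \<Longrightarrow> 0 \<le> t \<Longrightarrow> ((\<lambda>s. X s \<omega>) \<longlongrightarrow> X t \<omega>) (at_right t)"
    and paths_left_limits:
      "\<And>\<omega> t. \<omega> \<in> \<Omega> \<Longrightarrow> 0 < t \<Longrightarrow> \<exists>l. ((\<lambda>s. X s \<omega>) \<longlongrightarrow> l) (at_left t)"
    and strong_markov: "\<And>x. strong_markov_from (P x) F (transition X P) (\<lambda>_. 0) X"
    and quasi_left_continuous: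
      "\<And>x S. (\<And>n. stopping_time F (S n)) \<Longrightarrow> (\<And>\<omega>. \<omega> \<in> \<Omega> \<Longrightarrow> incseq (\<lambda>n. S n \<omega>)) \<Longrightarrow>
        AE \<omega> in P x. (SUP n. S n \<omega>) < \<top> \<longrightarrow>
          (\<lambda>n. X (enn2real (S n \<omega>)) \<omega>) \<longlonglongrightarrow> X (enn2real (SUP n. S n \<omega>)) \<omega>"

text \<open>
  The countable product of copies of the filtered space has coordinates \<open>1, 2, \<dots>\<close>, and
  \<open>X\<^sup>i\<^sub>t(\<omega>) = X\<^sub>t(\<omega>\<^sub>i)\<close>. At stage \<open>i\<close> of the construction only \<open>X\<^sup>1, \<dots>, X\<^sup>i\<close> exist, so \<open>\<tau>\<^sub>i\<close> and \<open>\<xi>\<^sub>i\<close>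
  refer to the filtration \<open>F\<^sub>t \<otimes> \<dots> \<otimes> F\<^sub>t\<close> (\<open>i\<close> factors), regarded on the whole product.
\<close>

definition product_space :: "(ennreal \<Rightarrow> 'w measure) \<Rightarrow> (nat \<Rightarrow> 'w) measure" where
  "product_space F = (\<Pi>\<^sub>M j\<in>{1..}. F \<top>)"

definition product_filtration :: "(ennreal \<Rightarrow> 'w measure) \<Rightarrow> nat \<Rightarrow> ennreal \<Rightarrow> (nat \<Rightarrow> 'w) measure" where
  "product_filtration F i t =
    vimage_algebra (space (product_space F)) (\<lambda>\<omega>. restrict \<omega> {1..i}) (\<Pi>\<^sub>M j\<in>{1..i}. F t)"

lemma filtration_product_filtration:
  assumes "filtration \<Omega> F"
  shows "filtration (space (product_space F)) (product_filtration F i)"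
proof -
  interpret filtration \<Omega> F by fact
  have mono: "sets (product_filtration F i s) \<subseteq> sets (product_filtration F i t)" if "s \<le> t" for s t
  proof -
    let ?r = "\<lambda>\<omega>. restrict \<omega> {1..i}"
    let ?S = "space (product_space F)"
    have into: "?r \<in> ?S \<rightarrow> space (\<Pi>\<^sub>M j\<in>{1..i}. F u)" for u
      by (auto simp: product_space_def space_PiM space_F PiE_iff)
    have "(\<lambda>x. x) \<in> (\<Pi>\<^sub>M j\<in>{1..i}. F t) \<rightarrow>\<^sub>M (\<Pi>\<^sub>M j\<in>{1..i}. F s)"
    proof (rule measurable_PiM_single')
      fix j assume j: "j \<in> {1..i}"
      have "(\<lambda>x. x j) \<in> (\<Pi>\<^sub>M j\<in>{1..i}. F t) \<rightarrow>\<^sub>M F t"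
        using j by (rule measurable_component_singleton)
      then show "(\<lambda>x. x j) \<in> (\<Pi>\<^sub>M j\<in>{1..i}. F t) \<rightarrow>\<^sub>M F s"
        using measurable_mono[of "F s" "F t" "\<Pi>\<^sub>M j\<in>{1..i}. F t" "\<Pi>\<^sub>M j\<in>{1..i}. F t"] sets_F_mono[OF \<open>s \<le> t\<close>]
        by (auto simp: space_F)
    next
      show "(\<lambda>x. x) \<in> space (\<Pi>\<^sub>M j\<in>{1..i}. F t) \<rightarrow> (\<Pi>\<^sub>E j\<in>{1..i}. space (F s))"
        by (auto simp: space_PiM space_F)
    qed
    then have sub: "sets (\<Pi>\<^sub>M j\<in>{1..i}. F s) \<subseteq> sets (\<Pi>\<^sub>M j\<in>{1..i}. F t)"
      unfolding measurable_def
      using sets.sets_into_space[of _ "\<Pi>\<^sub>M j\<in>{1..i}. F s"]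
      by (auto simp: space_PiM space_F Int_absorb2)
    then show ?thesis
      unfolding product_filtration_def sets_vimage_algebra2[OF into] by auto
  qed
  show ?thesis
    by standard (use mono in \<open>auto simp: product_filtration_def\<close>)
qed

type_synonym ('w, 'e) strategy =
  "(nat \<Rightarrow> (nat \<Rightarrow> 'w) \<Rightarrow> ennreal) \<times> (nat \<Rightarrow> (nat \<Rightarrow> 'w) \<Rightarrow> 'e)"

definition strategies :: "(ennreal \<Rightarrow> 'w measure) \<Rightarrow> ('w, 'e::topological_space) strategy set" where
  "strategies F = {(\<tau>, \<xi>). \<forall>i\<ge>1.
     stopping_time (product_filtration F i) (\<tau> i) \<and>
     \<xi> i \<in> filtration.pre_sigma (space (product_space F)) (product_filtration F i) (\<tau> i) \<rightarrow>\<^sub>M borel \<and>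
     (\<forall>\<omega>\<in>space (product_space F). \<tau> i \<omega> \<le> \<tau> (Suc i) \<omega>)}"

text \<open>Index \<open>0\<close> of a strategy is not used: by convention \<open>\<tau>\<^sub>0 = 0\<close>, and the start \<open>x\<close> plays the role
  of \<open>\<xi>\<^sub>0\<close>.\<close>

definition impulse_time :: "('w, 'e) strategy \<Rightarrow> nat \<Rightarrow> (nat \<Rightarrow> 'w) \<Rightarrow> ennreal" where
  "impulse_time V i \<omega> = (if i = 0 then 0 else fst V i \<omega>)"

definition restart_state :: "'e \<Rightarrow> ('w, 'e) strategy \<Rightarrow> nat \<Rightarrow> (nat \<Rightarrow> 'w) \<Rightarrow> 'e" where
  "restart_state x V i \<omega> = (if i = 0 then x else snd V i \<omega>)"

text \<open>
  \<open>Q\<close> has the properties required of \<open>P\<^sup>V\<^sub>x\<close>: for every \<open>i \<ge> 0\<close>, on \<open>{\<tau>\<^sub>i < \<infinity>}\<close>, \<open>X\<^bsup>i+1\<^esup>\<close> is at \<open>\<xi>\<^sub>i\<close> at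
  time \<open>\<tau>\<^sub>i\<close> and from then on evolves with the uncontrolled transition function, conditionally on
  the past of \<open>X\<^sup>1, \<dots>, X\<^bsup>i+1\<^esup>\<close>. The case \<open>i = 0\<close> says that \<open>X\<^sup>1\<close> is the uncontrolled process from \<open>x\<close>.
  What \<open>X\<^bsup>i+1\<^esup>\<close> does before \<open>\<tau>\<^sub>i\<close> is left open.
\<close>

definition controlled_law :: "(ennreal \<Rightarrow> 'w measure) \<Rightarrow> (real \<Rightarrow> 'w \<Rightarrow> 'e::topological_space)
    \<Rightarrow> ('e \<Rightarrow> 'w measure) \<Rightarrow> 'e \<Rightarrow> ('w, 'e) strategy \<Rightarrow> (nat \<Rightarrow> 'w) measure \<Rightarrow> bool" where
  "controlled_law F X P x V Q \<longleftrightarrow>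
    prob_space Q \<and> sets Q = sets (product_space F) \<and>
    (\<forall>i. (AE \<omega> in Q. impulse_time V i \<omega> < \<top> \<longrightarrow>
            X (enn2real (impulse_time V i \<omega>)) (\<omega> (Suc i)) = restart_state x V i \<omega>) \<and>
         strong_markov_from Q (product_filtration F (Suc i)) (transition X P)
           (impulse_time V i) (\<lambda>t \<omega>. X t (\<omega> (Suc i))))"

text \<open>
  \<open>Y\<^sub>t = X\<^sup>i\<^sub>t\<close> for \<open>t \<in> [\<tau>\<^bsub>i-1\<^esub>, \<tau>\<^sub>i)\<close>. If \<open>t \<ge> sup\<^sub>i \<tau>\<^sub>i\<close> there is no such \<open>i\<close>; the value chosen then is
  immaterial, as infinitely many impulses, each of cost bounded away from \<open>0\<close>, have occurred.
\<close>

definition controlled_process :: "(real \<Rightarrow> 'w \<Rightarrow> 'e) \<Rightarrow> ('w, 'e) strategy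
    \<Rightarrow> real \<Rightarrow> (nat \<Rightarrow> 'w) \<Rightarrow> 'e" where
  "controlled_process X V t \<omega> =
    (let active = (\<lambda>i. 1 \<le> i \<and> impulse_time V (i - 1) \<omega> \<le> ennreal t \<and> ennreal t < impulse_time V i \<omega>)
     in if \<exists>i. active i then X t (\<omega> (THE i. active i)) else X t (\<omega> 1))"

text \<open>Expectation of an extended real random variable (meaningful when the positive or the negative
  part has finite expectation; here the negative part is bounded).\<close>

definition expectation_ereal :: "'a measure \<Rightarrow> ('a \<Rightarrow> ereal) \<Rightarrow> ereal" where
  "expectation_ereal M Z =
    enn2ereal (\<integral>\<^sup>+\<omega>. e2ennreal (Z \<omega>) \<partial>M) - enn2ereal (\<integral>\<^sup>+\<omega>. e2ennreal (- Z \<omega>) \<partial>M)"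

text \<open>The cost up to time \<open>T\<close> with discount function \<open>b\<close>; the summand with index \<open>n\<close> belongs to the
  impulse number \<open>i = n + 1\<close>.\<close>

definition cost_upto :: "(real \<Rightarrow> 'w \<Rightarrow> 'e) \<Rightarrow> ('e \<Rightarrow> real) \<Rightarrow> ('e \<Rightarrow> 'e \<Rightarrow> real) \<Rightarrow> (real \<Rightarrow> real)
    \<Rightarrow> ('w, 'e) strategy \<Rightarrow> real \<Rightarrow> (nat \<Rightarrow> 'w) \<Rightarrow> ereal" where
  "cost_upto X g c b V T \<omega> =
    ereal (LBINT s:{0..T}. b s * g (controlled_process X V s \<omega>)) +
    enn2ereal (\<Sum>n. let i = Suc n; \<tau> = impulse_time V i \<omega>; t = enn2real \<tau> in
      if \<tau> \<le> ennreal T then ennreal (b t * c (X t (\<omega> i)) (X t (\<omega> (Suc i)))) else 0)"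

definition J_discounted :: "('e \<Rightarrow> ('w, 'e) strategy \<Rightarrow> (nat \<Rightarrow> 'w) measure) \<Rightarrow> (real \<Rightarrow> 'w \<Rightarrow> 'e)
    \<Rightarrow> ('e \<Rightarrow> real) \<Rightarrow> ('e \<Rightarrow> 'e \<Rightarrow> real) \<Rightarrow> (real \<Rightarrow> real) \<Rightarrow> 'e \<Rightarrow> ('w, 'e) strategy \<Rightarrow> ereal" where
  "J_discounted PV X g c \<beta> x V =
    Limsup at_top (\<lambda>T. expectation_ereal (PV x V) (cost_upto X g c \<beta> V T) / ereal (LBINT s:{0..T}. \<beta> s))"

definition J_average :: "('e \<Rightarrow> ('w, 'e) strategy \<Rightarrow> (nat \<Rightarrow> 'w) measure) \<Rightarrow> (real \<Rightarrow> 'w \<Rightarrow> 'e)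
    \<Rightarrow> ('e \<Rightarrow> real) \<Rightarrow> ('e \<Rightarrow> 'e \<Rightarrow> real) \<Rightarrow> 'e \<Rightarrow> ('w, 'e) strategy \<Rightarrow> ereal" where
  "J_average PV X g c x V =
    Limsup at_top (\<lambda>T. expectation_ereal (PV x V) (cost_upto X g c (\<lambda>_. 1) V T) / ereal T)"

end

theory Submission
  imports Defs
begin

text \<open>
  Fix \<open>\<alpha> > 0\<close> and let \<open>v\<close> be the value function of the impulse problem with exponential discounting at rate
  \<open>\<alpha>\<close>; put \<open>\<lambda> = \<alpha> * inf v\<close>. Both long-run criteria are compared with \<open>\<lambda>\<close>, through the
  undiscounted expected cost \<open>C(T)\<close> up to a fixed time \<open>T\<close>.

  For every strategy \<open>C(T) \<ge> \<lambda> T - const\<close> (\<open>total_cost_lower\<close>). Indeed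
  \<open>v y \<le> c y \<xi> + v \<xi>\<close>, so an impulse lowers \<open>v\<close> by at most its cost, and between impulses
  \<open>v(X\<^sub>t) + \<integral>(g - \<lambda>)\<close> is a submartingale: discounting lowers \<open>v\<close> over a time \<open>dt\<close> by \<open>\<alpha> v dt \<ge> \<lambda> dt\<close>.
  Adding up over the segments between impulses gives the bound, as \<open>v\<close> is bounded.

  Conversely, some strategy has \<open>C(T) \<le> (\<lambda> + O(\<alpha>)) T + const\<close> (\<open>total_cost_upper\<close>,
  \<open>near_optimal_strategy\<close>): wait on a fine time grid until the value of jumping is below that of waiting,
  then jump to the best target. Since one may jump anywhere at a cost of at most \<open>sup c\<close>, the
  oscillation of \<open>v\<close> is bounded independently of \<open>\<alpha>\<close>; hence discounting lowers \<open>v\<close> by at most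
  \<open>(\<lambda> + O(\<alpha>)) dt\<close>. This strategy is a feedback of the current state. That matters: the probability space
  carries no shift operators, and only for feedback strategies does the transition function alone determine the cost.

  Bounds that are linear in \<open>T\<close> survive discounting by \<open>\<beta>\<close> (\<open>discounted_lower\<close>, \<open>discounted_upper\<close>).
  As \<open>\<beta>\<close> is continuous, decreasing and \<open>\<beta> 0 = 1\<close>, each \<open>{s \<in> [0, T]. u \<le> \<beta> s}\<close> with \<open>0 < u \<le> 1\<close> is an interval
  \<open>[0, b\<^sub>u]\<close>, so \<open>\<beta> = \<integral> 1{u \<le> \<beta>} du\<close> turns the discounted cost into \<open>\<integral> C(b\<^sub>u) du\<close> and the
  normalisation \<open>\<integral>\<^sub>0\<^sup>T \<beta>\<close> into \<open>\<integral> b\<^sub>u du\<close>. Dividing by \<open>T\<close> and by \<open>\<integral>\<^sub>0\<^sup>T \<beta>\<close>, which both tend to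
  infinity, shows that both infima lie in \<open>[\<lambda>, \<lambda> + O(\<alpha>)]\<close>; let \<open>\<alpha> \<rightarrow> 0\<close>.

  The function \<open>v\<close> is built as the decreasing limit of value functions \<open>v\<^sub>n\<close> for impulses at the times
  \<open>k / 2\<^sup>n\<close> into finitely many targets; these are fixed points of contractions of the space of continuous
  functions, by the Feller property. The limit is only upper semicontinuous. That is enough for the
  submartingale property at stopping times, because a stopping time is approached by grid times from the right
  and paths are right-continuous (\<open>segment_lower\<close>). Adding a constant to \<open>g\<close> makes all costs nonnegative, so
  that expectations can be taken in \<open>[0, \<infinity>]\<close> without integrability conditions.
\<close>

section \<open>The transition semigroup and the strong Markov property\<close>

text \<open>
  Right-continuity makes the process a pointwise limit of its values at the next
  larger multiple of \<open>1 / (n + 1)\<close>, and these depend on time through countably many values only.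
\<close>

lemma right_continuous_jointly_measurable:
  fixes \<phi> :: "real \<Rightarrow> 'a \<Rightarrow> 'b::metric_space"
  assumes meas: "\<And>t. 0 \<le> t \<Longrightarrow> \<phi> t \<in> borel_measurable M"
    and rc: "\<And>\<omega> t. \<omega> \<in> space M \<Longrightarrow> 0 \<le> t \<Longrightarrow> ((\<lambda>s. \<phi> s \<omega>) \<longlongrightarrow> \<phi> t \<omega>) (at_right t)"
  shows "(\<lambda>(s, \<omega>). \<phi> (max 0 s) \<omega>) \<in> borel_measurable (borel \<Otimes>\<^sub>M M)"
proof -
  \<comment> \<open>Adding 1 to the floor keeps the approximation strictly to the right of \<open>s\<close>, where the limit is known.\<close>
  let ?r = "\<lambda>(n::nat) (s::real). real_of_int (\<lfloor>max 0 s * real (Suc n)\<rfloor> + 1) / real (Suc n)"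
  have m: "(\<lambda>x. \<phi> (max 0 (?r n (fst x))) (snd x)) \<in> borel_measurable (borel \<Otimes>\<^sub>M M)" for n
  proof (rule measurable_compose_countable[where f="\<lambda>i x. \<phi> (max 0 (real_of_int (i + 1) / real (Suc n))) (snd x)" and g="\<lambda>x. \<lfloor>max 0 (fst x) * real (Suc n)\<rfloor>"])
    show "(\<lambda>x. \<phi> (max 0 (real_of_int (i + 1) / real (Suc n))) (snd x)) \<in> borel_measurable (borel \<Otimes>\<^sub>M M)" for i
      by (rule measurable_compose[OF measurable_snd meas]) simp
    show "(\<lambda>x. \<lfloor>max 0 (fst x) * real (Suc n)\<rfloor>) \<in> borel \<Otimes>\<^sub>M M \<rightarrow>\<^sub>M count_space UNIV"
      by measurable
  qed
  have "(\<lambda>x. \<phi> (max 0 (fst x)) (snd x)) \<in> borel_measurable (borel \<Otimes>\<^sub>M M)"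
  proof (rule borel_measurable_LIMSEQ_metric[OF m])
    fix x :: "real \<times> 'a" assume "x \<in> space (borel \<Otimes>\<^sub>M M)"
    then have w: "snd x \<in> space M" by (auto simp: space_pair_measure)
    let ?t = "max 0 (fst x)"
    have gt: "?t < ?r n (fst x)" for n
      using real_of_int_floor_add_one_gt[of "?t * real (Suc n)"] by (subst pos_less_divide_eq) auto
    have le: "?r n (fst x) \<le> ?t + 1 / real (Suc n)" for n
      using of_int_floor_le[of "?t * real (Suc n)"]
      by (subst pos_divide_le_eq) (auto simp: distrib_right simp del: of_int_floor_le of_nat_Suc)
    have "(\<lambda>n. ?t + 1 / real (Suc n)) \<longlonglongrightarrow> ?t + 0"
      by (rule tendsto_add[OF tendsto_const LIMSEQ_Suc[OF lim_1_over_n]])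
    then have lim: "(\<lambda>n. ?t + 1 / real (Suc n)) \<longlonglongrightarrow> ?t" by (simp only: add_0_right)
    have "(\<lambda>n. ?r n (fst x)) \<longlonglongrightarrow> ?t"
      by (rule tendsto_sandwich[OF _ _ tendsto_const lim])
        (rule always_eventually, rule allI, rule less_imp_le[OF gt], rule always_eventually, rule allI, rule le)
    moreover have "?r n (fst x) \<noteq> ?t" for n
      using gt[of n] by (rule less_imp_neq[THEN not_sym])
    ultimately have "filterlim (\<lambda>n. ?r n (fst x)) (at_right ?t) sequentially"
      unfolding filterlim_at
      by (intro conjI always_eventually allI) (simp_all only: greaterThan_iff gt not_False_eq_True)
    from filterlim_compose[OF rc[OF w] this]
    have "(\<lambda>n. \<phi> (?r n (fst x)) (snd x)) \<longlonglongrightarrow> \<phi> ?t (snd x)" by simp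
    moreover have "max 0 (?r n (fst x)) = ?r n (fst x)" for n
      using gt[of n] by (intro max_absorb2) (smt (verit) max.cobounded1)
    ultimately show "(\<lambda>n. \<phi> (max 0 (?r n (fst x))) (snd x)) \<longlonglongrightarrow> \<phi> ?t (snd x)" by simp
  qed
  then show ?thesis by (simp add: case_prod_beta')
qed

context standard_process
begin

text \<open>
  Functions with values in \<open>[0, \<infinity>]\<close>: Tonelli's theorem and the Markov property then hold without
  integrability side conditions.
\<close>

definition semigroup :: "real \<Rightarrow> ('e \<Rightarrow> ennreal) \<Rightarrow> 'e \<Rightarrow> ennreal" where
  "semigroup t f y = (\<integral>\<^sup>+\<omega>. f (X t \<omega>) \<partial>P y)"

lemma space_P: "space (P y) = \<Omega>"
  using sets_eq_imp_space_eq[OF sets_P[of y]] by (simp add: space_F)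

lemma measurable_X_top: "0 \<le> t \<Longrightarrow> X t \<in> F \<top> \<rightarrow>\<^sub>M borel"
  using adapted[of t] sets_F_mono[of "ennreal t" \<top>]
  by (auto simp: measurable_def space_F)

lemma measurable_X: "0 \<le> t \<Longrightarrow> X t \<in> P y \<rightarrow>\<^sub>M borel"
  using measurable_X_top measurable_cong_sets[OF sets_P refl] by blast

lemma semigroup_indicator:
  assumes "0 \<le> t" "A \<in> sets borel"
  shows "semigroup t (indicator A) y = ennreal (transition X P t y A)"
proof -
  interpret prob_space "P y" by (rule prob_P)
  note [measurable] = measurable_X[OF assms(1)] assms(2)
  have "semigroup t (indicator A) y = (\<integral>\<^sup>+\<omega>. indicator {\<omega>\<in>space (P y). X t \<omega> \<in> A} \<omega> \<partial>P y)"
    unfolding semigroup_def by (intro nn_integral_cong) (auto split: split_indicator)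
  then show ?thesis unfolding transition_def by (simp add: emeasure_eq_measure)
qed

lemma semigroup_mono: "(\<And>y. f y \<le> h y) \<Longrightarrow> semigroup t f y \<le> semigroup t h y"
  unfolding semigroup_def by (rule nn_integral_mono) auto

lemma semigroup_cmult:
  assumes "0 \<le> t" "f \<in> borel_measurable borel"
  shows "semigroup t (\<lambda>y. a * f y) y = a * semigroup t f y"
  unfolding semigroup_def
  by (intro nn_integral_cmult measurable_compose[OF measurable_X[OF assms(1)]] assms)

lemma semigroup_plus:
  assumes "0 \<le> t" "f \<in> borel_measurable borel" "h \<in> borel_measurable borel"
  shows "semigroup t (\<lambda>y. f y + h y) y = semigroup t f y + semigroup t h y"
  unfolding semigroup_def
  by (intro nn_integral_add measurable_compose[OF measurable_X[OF assms(1)]] assms)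

lemma semigroup_SUP:
  assumes t: "0 \<le> t" and U: "\<And>i. U i \<in> borel_measurable borel" "incseq U"
  shows "semigroup t (SUP i. U i) y = (SUP i. semigroup t (U i) y)"
proof -
  have "(\<integral>\<^sup>+\<omega>. (SUP i. U i (X t \<omega>)) \<partial>P y) = (SUP i. \<integral>\<^sup>+\<omega>. U i (X t \<omega>) \<partial>P y)"
    using U measurable_X[OF t] by (intro nn_integral_monotone_convergence_SUP) (auto simp: mono_def le_fun_def)
  then show ?thesis by (simp add: semigroup_def image_comp)
qed

lemma semigroup_measurable:
  assumes "0 \<le> t" and f: "f \<in> borel_measurable borel"
  shows "semigroup t f \<in> borel_measurable borel"
  using f
proof (induction rule: borel_measurable_induct)
  case (cong f g)
  then have "f = g" by auto
  then show ?case using cong by simp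
next
  case (set A)
  then show ?case
    using transition_measurable[OF assms(1)] semigroup_indicator[OF assms(1)]
    by (subst measurable_cong[where g="\<lambda>y. ennreal (transition X P t y A)"]) auto
next
  case (mult u c)
  then show ?case using measurable_cong[of borel "semigroup t (\<lambda>x. c * u x)" "\<lambda>y. c * semigroup t u y"]
    semigroup_cmult[OF assms(1) mult(2)] by simp
next
  case (add u v)
  then show ?case using measurable_cong[of borel "semigroup t (\<lambda>x. v x + u x)" "\<lambda>y. semigroup t v y + semigroup t u y"]
    semigroup_plus[OF assms(1) add(3,1)] by simp
next
  case (seq U)
  have "semigroup t (SUP i. U i) = (\<lambda>y. SUP i. semigroup t (U i) y)"
    using semigroup_SUP[OF assms(1) seq(1,3)] by auto
  then show ?case
    using seq.IH by (simp only:) (intro borel_measurable_SUP, auto)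
qed

end

text \<open>
  The common setting of the uncontrolled process under \<open>P y\<close> and of a coordinate of the
  controlled process after its restart at \<open>\<sigma>\<^sub>0\<close>: a right-continuous process on some filtered probability space
  whose evolution from \<open>\<sigma>\<^sub>0\<close> on is governed by the transition function of \<open>X\<close>.
\<close>

locale restarted_process = standard_process \<Omega> F X P + prob_space M + flt: filtration "space M" G
  for \<Omega> :: "'w set" and F :: "ennreal \<Rightarrow> 'w measure"
    and X :: "real \<Rightarrow> 'w \<Rightarrow> 'e::polish_space" and P :: "'e \<Rightarrow> 'w measure"
    and M :: "'a measure" and G :: "ennreal \<Rightarrow> 'a measure" +
  fixes \<sigma>\<^sub>0 :: "'a \<Rightarrow> ennreal" and Z :: "real \<Rightarrow> 'a \<Rightarrow> 'e"
  assumes sets_G: "\<And>t. sets (G t) \<subseteq> sets M"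
    and Z_measurable: "\<And>t. 0 \<le> t \<Longrightarrow> Z t \<in> borel_measurable M"
    and Z_right_continuous:
      "\<And>\<omega> t. \<omega> \<in> space M \<Longrightarrow> 0 \<le> t \<Longrightarrow> ((\<lambda>s. Z s \<omega>) \<longlongrightarrow> Z t \<omega>) (at_right t)"
    and markov: "strong_markov_from M G (transition X P) \<sigma>\<^sub>0 Z"
begin

lemma Z_jointly_measurable: "(\<lambda>(s, \<omega>). Z (max 0 s) \<omega>) \<in> borel_measurable (borel \<Otimes>\<^sub>M M)"
  by (rule right_continuous_jointly_measurable[OF Z_measurable Z_right_continuous])

text \<open>
  With a projection for \<open>W\<close> this covers integrands that depend on time variables besides the sample point.
\<close>

lemma Z_compose:
  assumes [measurable]: "T \<in> borel_measurable N" "W \<in> N \<rightarrow>\<^sub>M M" and T0: "\<And>x. x \<in> space N \<Longrightarrow> 0 \<le> T x"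
  shows "(\<lambda>x. Z (T x) (W x)) \<in> borel_measurable N"
proof -
  have "(\<lambda>x. (T x, W x)) \<in> N \<rightarrow>\<^sub>M borel \<Otimes>\<^sub>M M" by measurable
  from measurable_compose[OF this Z_jointly_measurable]
  show ?thesis by (rule subst[OF measurable_cong, rotated]) (use T0 in auto)
qed

lemma stopping_time_measurable: "stopping_time G \<sigma> \<Longrightarrow> \<sigma> \<in> borel_measurable M"
  by (rule measurable_stopping_time[OF _ sets_G]) (auto simp: flt.space_F)

lemma pre_sigma_subset:
  assumes "stopping_time G \<sigma>" shows "sets (flt.pre_sigma \<sigma>) \<subseteq> sets M"
proof
  fix A assume "A \<in> sets (flt.pre_sigma \<sigma>)"
  from flt.sets_pre_sigmaD[OF assms this, of \<top>] sets_G[of \<top>] show "A \<in> sets M" by auto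
qed

text \<open>
  For indicators this is the defining property of the conditional expectation, integrated over \<open>B\<close>;
  it extends to nonnegative functions by linearity and monotone convergence.
\<close>

lemma markov_nn_integral:
  assumes st: "stopping_time G \<sigma>" and ge: "\<And>\<omega>. \<omega> \<in> space M \<Longrightarrow> \<sigma>\<^sub>0 \<omega> \<le> \<sigma> \<omega>"
    and B: "B \<in> sets (flt.pre_sigma \<sigma>)" and fin: "\<And>\<omega>. \<omega> \<in> B \<Longrightarrow> \<sigma> \<omega> < \<top>"
    and s: "0 \<le> s" and f: "f \<in> borel_measurable borel"
  shows "(\<integral>\<^sup>+\<omega>\<in>B. f (Z (enn2real (\<sigma> \<omega>) + s) \<omega>) \<partial>M) = (\<integral>\<^sup>+\<omega>\<in>B. semigroup s f (Z (enn2real (\<sigma> \<omega>)) \<omega>) \<partial>M)"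
proof -
  note [measurable] = stopping_time_measurable[OF st]
  have BM[measurable]: "B \<in> sets M" using B pre_sigma_subset[OF st] by auto
  have Zs[measurable]: "(\<lambda>\<omega>. Z (enn2real (\<sigma> \<omega>) + s) \<omega>) \<in> borel_measurable M"
    by (rule Z_compose) (use s in auto)
  have Z0[measurable]: "(\<lambda>\<omega>. Z (enn2real (\<sigma> \<omega>)) \<omega>) \<in> borel_measurable M"
    by (rule Z_compose) auto
  have sub: "subalgebra M (flt.pre_sigma \<sigma>)"
    using pre_sigma_subset[OF st] by (simp add: subalgebra_def flt.space_pre_sigma)
  interpret fsub: finite_measure_subalgebra M "flt.pre_sigma \<sigma>"
    by unfold_locales (rule sub)
  show ?thesis using f
  proof (induction rule: borel_measurable_induct)
    case (cong f g)
    then have "f = g" by auto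
    then show ?case using cong by simp
  next
    case (set A)
    note [measurable] = set
    have tm[measurable]: "(\<lambda>y. transition X P s y A) \<in> borel_measurable borel"
      by (rule transition_measurable[OF s set])
    define \<phi> where "\<phi> = (\<lambda>\<omega>. if \<sigma> \<omega> < \<top> \<and> Z (enn2real (\<sigma> \<omega>) + s) \<omega> \<in> A then 1 else (0::real))"
    define \<psi> where "\<psi> = (\<lambda>\<omega>. if \<sigma> \<omega> < \<top> then transition X P s (Z (enn2real (\<sigma> \<omega>)) \<omega>) A else 0)"
    have p1: "0 \<le> transition X P s y A \<and> transition X P s y A \<le> 1" for y
    proof -
      interpret py: prob_space "P y" by (rule prob_P)
      show ?thesis unfolding transition_def by simp
    qed
    have \<phi>m[measurable]: "\<phi> \<in> borel_measurable M" unfolding \<phi>_def by measurable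
    have \<psi>m[measurable]: "\<psi> \<in> borel_measurable M" unfolding \<psi>_def by measurable
    have i\<phi>: "integrable M \<phi>" by (rule integrable_const_bound[of _ 1]) (auto simp: \<phi>_def)
    have i\<psi>: "integrable M \<psi>" by (rule integrable_const_bound[of _ 1]) (auto simp: \<psi>_def p1)
    have ae: "AE \<omega> in M. real_cond_exp M (flt.pre_sigma \<sigma>) \<phi> \<omega> = \<psi> \<omega>"
      using markov st ge s set unfolding strong_markov_from_def \<phi>_def \<psi>_def by blast
    have "(\<integral>\<omega>\<in>B. \<phi> \<omega> \<partial>M) = (\<integral>\<omega>\<in>B. real_cond_exp M (flt.pre_sigma \<sigma>) \<phi> \<omega> \<partial>M)"
      by (rule fsub.real_cond_exp_intA[OF i\<phi> B])
    also have "\<dots> = (\<integral>\<omega>\<in>B. \<psi> \<omega> \<partial>M)"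
      unfolding set_lebesgue_integral_def
      by (intro integral_cong_AE) (use ae in auto)
    finally have eq: "(\<integral>\<omega>. indicator B \<omega> * \<phi> \<omega> \<partial>M) = (\<integral>\<omega>. indicator B \<omega> * \<psi> \<omega> \<partial>M)"
      unfolding set_lebesgue_integral_def by simp
    have "(\<integral>\<^sup>+\<omega>\<in>B. indicator A (Z (enn2real (\<sigma> \<omega>) + s) \<omega>) \<partial>M) = (\<integral>\<^sup>+\<omega>. ennreal (indicator B \<omega> * \<phi> \<omega>) \<partial>M)"
      by (intro nn_integral_cong) (auto simp: \<phi>_def fin split: split_indicator)
    also have "\<dots> = ennreal (\<integral>\<omega>. indicator B \<omega> * \<phi> \<omega> \<partial>M)"
      by (intro nn_integral_eq_integral integrable_const_bound[of _ 1]) (auto simp: \<phi>_def split: split_indicator)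
    also have "\<dots> = (\<integral>\<^sup>+\<omega>. ennreal (indicator B \<omega> * \<psi> \<omega>) \<partial>M)"
      unfolding eq
      by (intro nn_integral_eq_integral[symmetric] integrable_const_bound[of _ 1])
         (auto simp: \<psi>_def p1 split: split_indicator)
    also have "\<dots> = (\<integral>\<^sup>+\<omega>\<in>B. semigroup s (indicator A) (Z (enn2real (\<sigma> \<omega>)) \<omega>) \<partial>M)"
      by (intro nn_integral_cong)
         (auto simp: \<psi>_def fin semigroup_indicator[OF s set] split: split_indicator)
    finally show ?case .
  next
    case (mult u c)
    note [measurable] = mult(2) semigroup_measurable[OF s mult(2)]
    show ?case using mult.IH
      by (simp add: semigroup_cmult[OF s mult(2)] mult.assoc nn_integral_cmult)
  next
    case (add u v)
    note [measurable] = add(1,3) semigroup_measurable[OF s add(1)] semigroup_measurable[OF s add(3)]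
    show ?case using add.IH
      by (simp add: semigroup_plus[OF s add(3,1)] distrib_right nn_integral_add)
  next
    case (seq U)
    note [measurable] = seq(1) semigroup_measurable[OF s seq(1)]
    have inc: "U i x \<le> U j x" if "i \<le> j" for i j x using seq(3) that by (auto simp: mono_def le_fun_def)
    have inc2: "semigroup s (U i) y \<le> semigroup s (U j) y" if "i \<le> j" for i j y
      by (intro semigroup_mono inc that)
    have "(\<integral>\<^sup>+\<omega>\<in>B. (SUP i. U i) (Z (enn2real (\<sigma> \<omega>) + s) \<omega>) \<partial>M)
        = (\<integral>\<^sup>+\<omega>. (SUP i. U i (Z (enn2real (\<sigma> \<omega>) + s) \<omega>) * indicator B \<omega>) \<partial>M)"
      by (simp add: SUP_mult_right_ennreal image_comp)
    also have "\<dots> = (SUP i. \<integral>\<^sup>+\<omega>\<in>B. U i (Z (enn2real (\<sigma> \<omega>) + s) \<omega>) \<partial>M)"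
      by (intro nn_integral_monotone_convergence_SUP) (auto simp: mono_def le_fun_def intro!: mult_right_mono inc)
    also have "\<dots> = (SUP i. \<integral>\<^sup>+\<omega>\<in>B. semigroup s (U i) (Z (enn2real (\<sigma> \<omega>)) \<omega>) \<partial>M)"
      using seq.IH by simp
    also have "\<dots> = (\<integral>\<^sup>+\<omega>. (SUP i. semigroup s (U i) (Z (enn2real (\<sigma> \<omega>)) \<omega>) * indicator B \<omega>) \<partial>M)"
      by (intro nn_integral_monotone_convergence_SUP[symmetric]) (auto simp: mono_def le_fun_def intro!: mult_right_mono inc2)
    also have "\<dots> = (\<integral>\<^sup>+\<omega>\<in>B. semigroup s (SUP i. U i) (Z (enn2real (\<sigma> \<omega>)) \<omega>) \<partial>M)"
      by (simp add: SUP_mult_right_ennreal image_comp semigroup_SUP[OF s seq(1,3)])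
    finally show ?case .
  qed
qed

end

context standard_process
begin

lemma uncontrolled_restarted: "restarted_process \<Omega> F X P (P y) F (\<lambda>_. 0) X"
proof (intro restarted_process.intro restarted_process_axioms.intro)
  show "standard_process \<Omega> F X P" by unfold_locales
  show "prob_space (P y)" by (rule prob_P)
  show "filtration (space (P y)) F" unfolding space_P by unfold_locales
  show "sets (F t) \<subseteq> sets (P y)" for t using sets_F_mono[of t \<top>] sets_P by auto
qed (use measurable_X paths_right_continuous strong_markov in \<open>auto simp: space_P\<close>)

text \<open>
  The Chapman-Kolmogorov equation is the Markov property at a constant time.
\<close>

lemma semigroup_add:
  assumes s: "0 \<le> s" and t: "0 \<le> t" and f: "f \<in> borel_measurable borel"
  shows "semigroup s (semigroup t f) y = semigroup (s + t) f y"
proof -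
  interpret r: restarted_process \<Omega> F X P "P y" F "\<lambda>_. 0" X by (rule uncontrolled_restarted)
  have "(\<integral>\<^sup>+\<omega>\<in>space (P y). f (X (enn2real (ennreal s) + t) \<omega>) \<partial>P y)
      = (\<integral>\<^sup>+\<omega>\<in>space (P y). semigroup t f (X (enn2real (ennreal s)) \<omega>) \<partial>P y)"
  proof (rule r.markov_nn_integral[OF stopping_time_const _ _ _ t f])
    show "space (P y) \<in> sets (filtration.pre_sigma (space (P y)) F (\<lambda>_. ennreal s))"
      using sets.top[of "filtration.pre_sigma (space (P y)) F (\<lambda>_. ennreal s)"] by (simp add: r.flt.space_pre_sigma)
  qed (auto simp: ennreal_less_top)
  moreover have "(\<integral>\<^sup>+\<omega>\<in>space (P y). h \<omega> \<partial>P y) = (\<integral>\<^sup>+\<omega>. h \<omega> \<partial>P y)" for h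
    by (intro nn_integral_cong) auto
  ultimately show ?thesis using s by (simp add: semigroup_def)
qed

text \<open>
  The same operator on real functions, for which contraction and continuity arguments are made.
\<close>

definition mean :: "real \<Rightarrow> ('e \<Rightarrow> real) \<Rightarrow> 'e \<Rightarrow> real" where
  "mean t f y = (\<integral>\<omega>. f (X t \<omega>) \<partial>P y)"

lemma integrable_bounded:
  fixes f :: "'e \<Rightarrow> real"
  assumes t: "0 \<le> t" and f: "f \<in> borel_measurable borel" and b: "\<And>y. \<bar>f y\<bar> \<le> b"
  shows "integrable (P y) (\<lambda>\<omega>. f (X t \<omega>))"
proof -
  interpret prob_space "P y" by (rule prob_P)
  show ?thesis
    by (rule integrable_const_bound[of _ b])
      (auto simp: b intro: measurable_compose[OF measurable_X[OF t] f])
qed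

lemma mean_0:
  fixes f :: "'e \<Rightarrow> real" assumes "f \<in> borel_measurable borel" shows "mean 0 f y = f y"
proof -
  interpret prob_space "P y" by (rule prob_P)
  have "mean 0 f y = (\<integral>\<omega>. f y \<partial>P y)"
    unfolding mean_def
    by (rule integral_cong_AE) (use normal[of y] assms in \<open>auto intro: measurable_compose[OF measurable_X]\<close>)
  then show ?thesis by (simp add: prob_space)
qed

lemma mean_mono:
  assumes "0 \<le> t" "f \<in> borel_measurable borel" "\<And>y. \<bar>f y\<bar> \<le> b"
    "h \<in> borel_measurable borel" "\<And>y. \<bar>h y\<bar> \<le> b'" "\<And>y. f y \<le> h y + a"
  shows "mean t f y \<le> mean t h y + a"
proof -
  interpret prob_space "P y" by (rule prob_P)
  have "mean t f y \<le> (\<integral>\<omega>. h (X t \<omega>) + a \<partial>P y)"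
    unfolding mean_def
    by (intro integral_mono integrable_bounded[of _ _ b] Bochner_Integration.integrable_add
        integrable_bounded[of _ _ b'] integrable_const assms)
  also have "\<dots> = mean t h y + a"
    unfolding mean_def
    by (subst Bochner_Integration.integral_add)
      (auto intro!: integrable_bounded[of _ _ b'] assms simp: prob_space)
  finally show ?thesis .
qed

lemma mean_const: "mean t (\<lambda>_. a) y = a"
proof -
  interpret prob_space "P y" by (rule prob_P)
  show ?thesis by (simp add: mean_def prob_space)
qed

lemma mean_abs_le:
  assumes "0 \<le> t" "f \<in> borel_measurable borel" "\<And>y. \<bar>f y\<bar> \<le> b"
  shows "\<bar>mean t f y\<bar> \<le> b"
  using mean_mono[OF assms, of "\<lambda>_. 0" 0 b y] mean_mono[OF assms(1), of "\<lambda>_. 0" 0 f b b y] assms(2,3)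
  by (auto simp: mean_const abs_le_iff) (smt (verit, best))+

lemma semigroup_ennreal:
  assumes "0 \<le> t" "f \<in> borel_measurable borel" "\<And>y. 0 \<le> f y" "\<And>y. f y \<le> b"
  shows "semigroup t (\<lambda>y. ennreal (f y)) y = ennreal (mean t f y)"
  unfolding semigroup_def mean_def
  by (rule nn_integral_eq_integral[OF integrable_bounded[of _ _ b]]) (use assms in auto)

lemma mean_right_continuous:
  fixes f :: "'e \<Rightarrow> real"
  assumes f: "continuous_on UNIV f" and b: "\<And>y. \<bar>f y\<bar> \<le> b" and t: "0 \<le> t"
  shows "((\<lambda>s. mean s f y) \<longlongrightarrow> mean t f y) (at_right t)"
proof (subst tendsto_at_iff_sequentially, intro allI impI)
  interpret prob_space "P y" by (rule prob_P)
  have fm: "f \<in> borel_measurable borel" using f by (rule borel_measurable_continuous_onI)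
  fix S assume S: "\<forall>i. S i \<in> {t<..} - {t}" and lim: "S \<longlonglongrightarrow> t"
  then have S0: "0 \<le> S i" for i using t by (auto intro: less_imp_le order_le_less_trans)
  have flim: "filterlim S (at_right t) sequentially"
    using S lim by (auto simp: filterlim_at intro!: always_eventually)
  show "((\<lambda>s. mean s f y) \<circ> S) \<longlonglongrightarrow> mean t f y"
    unfolding mean_def comp_def
  proof (rule integral_dominated_convergence[where w="\<lambda>_. b"])
    show "AE \<omega> in P y. (\<lambda>i. f (X (S i) \<omega>)) \<longlonglongrightarrow> f (X t \<omega>)"
    proof (rule AE_I2)
      fix \<omega> assume "\<omega> \<in> space (P y)"
      then have "(\<lambda>i. X (S i) \<omega>) \<longlonglongrightarrow> X t \<omega>"
        using filterlim_compose[OF paths_right_continuous[OF _ t] flim] by (simp add: space_P)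
      then show "(\<lambda>i. f (X (S i) \<omega>)) \<longlonglongrightarrow> f (X t \<omega>)"
        using f by (intro continuous_on_tendsto_compose[OF f]) auto
    qed
  qed (use S0 t b in \<open>auto intro: measurable_compose[OF measurable_X fm]\<close>)
qed

text \<open>
  Shifting \<open>f\<close> by its bound reduces the claim to nonnegative functions.
\<close>

lemma mean_measurable:
  assumes "0 \<le> t" "f \<in> borel_measurable borel" "\<And>y. \<bar>f y\<bar> \<le> b"
  shows "mean t f \<in> borel_measurable borel"
proof -
  note [measurable] = assms(2)
  have [measurable]: "semigroup t (\<lambda>y. ennreal (f y + b)) \<in> borel_measurable borel"
    by (intro semigroup_measurable assms(1)) measurable
  have b: "0 \<le> f y + b" "f y + b \<le> 2 * b" for y using assms(3)[of y] by auto
  have "mean t f y = enn2real (semigroup t (\<lambda>y. ennreal (f y + b)) y) - b" for y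
  proof -
    interpret prob_space "P y" by (rule prob_P)
    have "semigroup t (\<lambda>y. ennreal (f y + b)) y = ennreal (mean t (\<lambda>y. f y + b) y)"
      by (rule semigroup_ennreal[where b="2*b"]) (use assms b in auto)
    also have "mean t (\<lambda>y. f y + b) y = mean t f y + b"
      unfolding mean_def
      by (subst Bochner_Integration.integral_add)
        (auto intro!: integrable_bounded[of _ _ b] assms simp: prob_space)
    finally show ?thesis using mean_abs_le[OF assms, of y] by simp
  qed
  then have "mean t f = (\<lambda>y. enn2real (semigroup t (\<lambda>y. ennreal (f y + b)) y) - b)" by auto
  then show ?thesis by simp
qed

end

section \<open>Dynamic programming on a time grid\<close>

locale impulse_problem = standard_process \<Omega> F X P
  for \<Omega> :: "'w set" and F :: "ennreal \<Rightarrow> 'w measure"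
    and X :: "real \<Rightarrow> 'w \<Rightarrow> 'e::polish_space" and P :: "'e \<Rightarrow> 'w measure" +
  fixes g :: "'e \<Rightarrow> real" and c :: "'e \<Rightarrow> 'e \<Rightarrow> real" and K c\<^sub>0 c\<^sub>1 :: real
  assumes g_continuous: "continuous_on UNIV g"
    and g_nonneg: "\<And>y. 0 \<le> g y" and g_le: "\<And>y. g y \<le> K"
    and c_continuous: "continuous_on UNIV (\<lambda>(y, \<xi>). c y \<xi>)"
    and c0_pos: "0 < c\<^sub>0" and c_lower: "\<And>y \<xi>. c\<^sub>0 \<le> c y \<xi>" and c_upper: "\<And>y \<xi>. c y \<xi> \<le> c\<^sub>1"
    and c_triangle: "\<And>y \<xi> \<eta>. c y \<xi> \<le> c y \<eta> + c \<eta> \<xi>"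
    and feller: "\<And>f t. continuous_on UNIV (f :: 'e \<Rightarrow> real) \<Longrightarrow> bounded (range f) \<Longrightarrow> 0 < t \<Longrightarrow>
      continuous_on UNIV (\<lambda>y. \<integral>\<omega>. f (X t \<omega>) \<partial>P y)"
begin

lemma g_measurable [measurable]: "g \<in> borel_measurable borel"
  using g_continuous by (rule borel_measurable_continuous_onI)

lemma K_nonneg: "0 \<le> K" using g_nonneg g_le order_trans by blast

lemma g_abs: "\<bar>g y\<bar> \<le> K" using g_nonneg[of y] g_le[of y] by simp

lemma c_continuous1: "continuous_on UNIV (\<lambda>y. c y \<xi>)"
  using continuous_on_compose2[OF c_continuous, of UNIV "\<lambda>y. (y, \<xi>)"] by (simp add: continuous_on_Pair)

lemma c_continuous2: "continuous_on UNIV (\<lambda>\<xi>. c y \<xi>)"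
  using continuous_on_compose2[OF c_continuous, of UNIV "\<lambda>\<xi>. (y, \<xi>)"] by (simp add: continuous_on_Pair)

lemma c_measurable [measurable]: "(\<lambda>(y, \<xi>). c y \<xi>) \<in> borel_measurable (borel \<Otimes>\<^sub>M borel)"
  using borel_measurable_continuous_onI[OF c_continuous] by (simp add: borel_prod)

abbreviation gn :: "'e \<Rightarrow> ennreal" where "gn \<equiv> \<lambda>y. ennreal (g y)"

lemma continuous_mean:
  assumes f: "continuous_on UNIV f" and b: "\<And>y. \<bar>f y\<bar> \<le> b" and t: "0 \<le> t"
  shows "continuous_on UNIV (mean t f)"
proof (cases "t = 0")
  case True
  then have "mean t f = f" using mean_0[OF borel_measurable_continuous_onI[OF f]] by auto
  then show ?thesis using f by simp
next
  case False
  have "bounded (range f)" using b by (auto simp: bounded_iff)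
  then show ?thesis using feller[OF f, of t] False t unfolding mean_def by auto
qed

lemma gn_semigroup: "0 \<le> t \<Longrightarrow> semigroup t gn y = ennreal (mean t g y)"
  by (rule semigroup_ennreal[OF _ g_measurable g_nonneg g_le])

lemma mean_g_bounds: "0 \<le> t \<Longrightarrow> 0 \<le> mean t g y \<and> mean t g y \<le> K"
  using mean_mono[of t "\<lambda>_. 0" 0 g K 0 y] mean_abs_le[of t g K y] g_abs g_nonneg by (auto simp: mean_const)

lemma mean_g_jointly_measurable: "(\<lambda>(s, y). mean (max 0 s) g y) \<in> borel_measurable (borel \<Otimes>\<^sub>M borel)"
  by (rule right_continuous_jointly_measurable)
    (use mean_measurable[OF _ g_measurable g_abs] mean_right_continuous[OF g_continuous g_abs] in auto)

lemma gn_semigroup_jointly_measurable [measurable]: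
  "(\<lambda>(s, y). semigroup (max 0 s) gn y) \<in> borel_measurable (borel \<Otimes>\<^sub>M borel)"
  using measurable_compose[OF mean_g_jointly_measurable measurable_ennreal]
  by (rule subst[OF measurable_cong, rotated]) (auto simp: gn_semigroup)

text \<open>
  The expected running cost up to \<open>t\<close>, discounted at rate \<open>\<alpha>\<close>. The truncation of time at 0 makes the
  integrand measurable on the whole line, processes being specified for nonnegative times only.
\<close>

definition running :: "real \<Rightarrow> real \<Rightarrow> 'e \<Rightarrow> ennreal" where
  "running \<alpha> t y = (\<integral>\<^sup>+s\<in>{0..<t}. ennreal (exp (- \<alpha> * s)) * semigroup (max 0 s) gn y \<partial>lborel)"

text \<open>
  The expected cost of waiting until time \<open>t\<close> and then paying \<open>f\<close>.
\<close>

definition continue :: "real \<Rightarrow> real \<Rightarrow> ('e \<Rightarrow> ennreal) \<Rightarrow> 'e \<Rightarrow> ennreal" where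
  "continue \<alpha> t f y = running \<alpha> t y + ennreal (exp (- \<alpha> * t)) * semigroup t f y"

lemma running_measurable [measurable]: "running \<alpha> t \<in> borel_measurable borel"
  unfolding running_def by measurable

lemma continue_mono:
  "(\<And>y. f y \<le> h y) \<Longrightarrow> continue \<alpha> t f y \<le> continue \<alpha> t h y"
  unfolding continue_def by (intro add_left_mono mult_left_mono semigroup_mono) auto

lemma semigroup_running:
  assumes s: "0 \<le> s" and t: "0 \<le> t"
  shows "semigroup s (running \<alpha> t) y = (\<integral>\<^sup>+r\<in>{0..<t}. ennreal (exp (- \<alpha> * r)) * semigroup (s + max 0 r) gn y \<partial>lborel)"
proof -
  interpret prob_space "P y" by (rule prob_P)
  interpret ps: pair_sigma_finite "P y" lborel by unfold_locales
  note [measurable] = measurable_X[OF s]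
  have "semigroup s (running \<alpha> t) y
      = (\<integral>\<^sup>+r. (\<integral>\<^sup>+\<omega>. ennreal (exp (- \<alpha> * r)) * semigroup (max 0 r) gn (X s \<omega>) * indicator {0..<t} r \<partial>P y) \<partial>lborel)"
    unfolding semigroup_def[of s] running_def
    by (rule ps.Fubini'[symmetric]) measurable
  also have "\<dots> = (\<integral>\<^sup>+r\<in>{0..<t}. ennreal (exp (- \<alpha> * r)) * semigroup (s + max 0 r) gn y \<partial>lborel)"
  proof (intro nn_integral_cong)
    fix r :: real
    have [measurable]: "semigroup (max 0 r) gn \<in> borel_measurable borel"
      by (rule semigroup_measurable) auto
    show "(\<integral>\<^sup>+\<omega>. ennreal (exp (- \<alpha> * r)) * semigroup (max 0 r) gn (X s \<omega>) * indicator {0..<t} r \<partial>P y)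
        = ennreal (exp (- \<alpha> * r)) * semigroup (s + max 0 r) gn y * indicator {0..<t} r"
      by (subst nn_integral_multc, measurable, subst nn_integral_cmult, measurable)
        (simp add: semigroup_def[symmetric] semigroup_add s)
  qed
  finally show ?thesis .
qed

lemma exp_mult_exp: "ennreal (exp (- \<alpha> * s)) * ennreal (exp (- \<alpha> * t)) = ennreal (exp (- \<alpha> * (s + t)))" for \<alpha> :: real
  by (simp add: ennreal_mult'[symmetric] exp_add[symmetric] distrib_left)

text \<open>
  Waiting for \<open>s\<close> and then for \<open>t\<close> is waiting for \<open>s + t\<close>. This relates the problems on different grids.
\<close>

lemma continue_add:
  assumes s: "0 \<le> s" and t: "0 \<le> t" and [measurable]: "f \<in> borel_measurable borel"
  shows "continue \<alpha> s (continue \<alpha> t f) y = continue \<alpha> (s + t) f y"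
proof -
  let ?p = "\<lambda>r. ennreal (exp (- \<alpha> * r)) * semigroup (max 0 r) gn y"
  have [measurable]: "semigroup t f \<in> borel_measurable borel" by (rule semigroup_measurable[OF t]) simp
  have pm: "?p \<in> borel_measurable borel" by measurable
  have "ennreal (exp (- \<alpha> * s)) * semigroup s (running \<alpha> t) y
      = (\<integral>\<^sup>+r. ennreal (exp (- \<alpha> * s)) * (ennreal (exp (- \<alpha> * r)) * semigroup (s + max 0 r) gn y * indicator {0..<t} r) \<partial>lborel)"
    unfolding semigroup_running[OF s t]
  proof (rule nn_integral_cmult[symmetric])
    have "(\<lambda>r. semigroup (max 0 (s + max 0 r)) gn y) \<in> borel_measurable borel" by measurable
    then have [measurable]: "(\<lambda>r. semigroup (s + max 0 r) gn y) \<in> borel_measurable borel" using s by (simp add: max_def)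
    show "(\<lambda>r. ennreal (exp (- \<alpha> * r)) * semigroup (s + max 0 r) gn y * indicator {0..<t} r) \<in> borel_measurable lborel"
      by measurable
  qed
  also have "\<dots> = (\<integral>\<^sup>+r. ?p (s + 1 * r) * indicator {s..<s+t} (s + 1 * r) \<partial>lborel)"
  proof (intro nn_integral_cong)
    fix r :: real
    have m: "max 0 (s + r) = s + max 0 r" if "0 \<le> r" using that s by auto
    have e: "ennreal (exp (- \<alpha> * s)) * (ennreal (exp (- \<alpha> * r)) * z) = ennreal (exp (- \<alpha> * (s + r))) * z" for z
      by (simp only: mult.assoc[symmetric] exp_mult_exp)
    show "ennreal (exp (- \<alpha> * s)) * (ennreal (exp (- \<alpha> * r)) * semigroup (s + max 0 r) gn y * indicator {0..<t} r)
      = ?p (s + 1 * r) * indicator {s..<s+t} (s + 1 * r)"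
      using e[of "semigroup (s + r) gn y"] by (cases "0 \<le> r") (auto simp: m split: split_indicator)
  qed
  also have "\<dots> = (\<integral>\<^sup>+r\<in>{s..<s+t}. ?p r \<partial>lborel)"
    using nn_integral_real_affine[of "\<lambda>r. ?p r * indicator {s..<s+t} r" 1 s] by simp
  finally have 1: "ennreal (exp (- \<alpha> * s)) * semigroup s (running \<alpha> t) y = (\<integral>\<^sup>+r\<in>{s..<s+t}. ?p r \<partial>lborel)" .
  have 2: "running \<alpha> (s + t) y = running \<alpha> s y + (\<integral>\<^sup>+r\<in>{s..<s+t}. ?p r \<partial>lborel)"
    unfolding running_def
    by (subst nn_integral_add[symmetric], measurable, intro nn_integral_cong)
      (use s t in \<open>auto split: split_indicator\<close>)
  have "continue \<alpha> s (continue \<alpha> t f) y = running \<alpha> s y + ennreal (exp (- \<alpha> * s)) * semigroup s (running \<alpha> t) y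
      + ennreal (exp (- \<alpha> * s)) * (ennreal (exp (- \<alpha> * t)) * semigroup (s + t) f y)"
  proof -
    have "semigroup s (continue \<alpha> t f) y = semigroup s (running \<alpha> t) y + ennreal (exp (- \<alpha> * t)) * semigroup (s + t) f y"
      unfolding continue_def
      by (subst semigroup_plus) (auto simp: s t semigroup_cmult semigroup_add)
    then show ?thesis by (simp add: continue_def[of \<alpha> s] distrib_left add.assoc)
  qed
  also have "\<dots> = continue \<alpha> (s + t) f y"
    unfolding 1 2[symmetric] continue_def
    by (simp only: mult.assoc[symmetric] exp_mult_exp)
  finally show ?thesis .
qed

end

lemma continuous_on_Min_image:
  fixes f :: "'a \<Rightarrow> 'b::topological_space \<Rightarrow> real"
  assumes "finite D" "D \<noteq> {}" "\<And>d. d \<in> D \<Longrightarrow> continuous_on S (f d)"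
  shows "continuous_on S (\<lambda>y. Min ((\<lambda>d. f d y) ` D))"
  using assms
proof (induction D rule: finite_ne_induct)
  case (insert d D)
  then have "Min ((\<lambda>d. f d y) ` insert d D) = min (f d y) (Min ((\<lambda>d. f d y) ` D))" for y
    by (simp add: Min_insert)
  then show ?case using insert by (auto intro!: continuous_on_min)
qed simp

context impulse_problem
begin

definition running_real :: "real \<Rightarrow> real \<Rightarrow> 'e \<Rightarrow> real" where
  "running_real \<alpha> t y = (\<integral>s. indicator {0..<t} s * (exp (- \<alpha> * s) * mean (max 0 s) g y) \<partial>lborel)"

definition continue_real :: "real \<Rightarrow> real \<Rightarrow> ('e \<Rightarrow> real) \<Rightarrow> 'e \<Rightarrow> real" where
  "continue_real \<alpha> t f y = running_real \<alpha> t y + exp (- \<alpha> * t) * mean t f y"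

lemma mean_g_time_measurable [measurable]: "(\<lambda>s. mean (max 0 s) g y) \<in> borel_measurable borel"
  using measurable_compose[OF _ mean_g_jointly_measurable, of "\<lambda>s. (s, y)" borel] by simp

lemma integrable_ivl: "integrable lborel (\<lambda>s::real. indicator {0..<t} s * K)"
  by (cases "0 \<le> t") (auto intro!: integrable_mult_left integrable_real_indicator simp: emeasure_lborel_Ico)

lemma running_integrand_bound:
  assumes \<alpha>: "0 < \<alpha>"
  shows "norm (indicator {0..<t} s * (exp (- \<alpha> * s) * mean (max 0 s) g y)) \<le> indicator {0..<t} s * K"
proof (cases "s \<in> {0..<t}")
  case True
  then have "exp (- \<alpha> * s) \<le> 1" using \<alpha> by auto
  then have "exp (- \<alpha> * s) * mean (max 0 s) g y \<le> 1 * K"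
    using mean_g_bounds[of "max 0 s" y] by (intro mult_mono) auto
  then show ?thesis using True mean_g_bounds[of "max 0 s" y] by (simp add: abs_mult)
qed simp

lemma running_integrable:
  assumes \<alpha>: "0 < \<alpha>"
  shows "integrable lborel (\<lambda>s. indicator {0..<t} s * (exp (- \<alpha> * s) * mean (max 0 s) g y))"
proof (rule Bochner_Integration.integrable_bound[OF integrable_ivl[of t]])
  show "(\<lambda>s. indicator {0..<t} s * (exp (- \<alpha> * s) * mean (max 0 s) g y)) \<in> borel_measurable lborel" by measurable
  show "AE s in lborel. norm (indicator {0..<t} s * (exp (- \<alpha> * s) * mean (max 0 s) g y))
      \<le> norm (indicator {0..<t} s * K)"
  proof (rule AE_I2)
    fix s show "norm (indicator {0..<t} s * (exp (- \<alpha> * s) * mean (max 0 s) g y)) \<le> norm (indicator {0..<t} s * K)"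
      using running_integrand_bound[OF \<alpha>, of t s y] K_nonneg by (simp split: split_indicator)
  qed
qed

text \<open>
  Dominated convergence transfers the Feller property from each time to the integral over time.
\<close>

lemma running_real_continuous:
  assumes \<alpha>: "0 < \<alpha>"
  shows "continuous_on UNIV (running_real \<alpha> t)"
  unfolding continuous_on_sequentially
proof (intro allI ballI impI)
  fix S :: "nat \<Rightarrow> 'e" and y assume "(\<forall>n. S n \<in> UNIV) \<and> S \<longlonglongrightarrow> y"
  then have lim: "S \<longlonglongrightarrow> y" by auto
  show "(running_real \<alpha> t \<circ> S) \<longlonglongrightarrow> running_real \<alpha> t y"
    unfolding comp_def running_real_def
  proof (rule integral_dominated_convergence[where w="\<lambda>s. indicator {0..<t} s * K"])
    show "AE s in lborel. (\<lambda>i. indicator {0..<t} s * (exp (- \<alpha> * s) * mean (max 0 s) g (S i)))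
        \<longlonglongrightarrow> indicator {0..<t} s * (exp (- \<alpha> * s) * mean (max 0 s) g y)"
      by (intro AE_I2 tendsto_mult tendsto_const continuous_on_tendsto_compose[OF continuous_mean[OF g_continuous g_abs] lim]) auto
    show "AE s in lborel. norm (indicator {0..<t} s * (exp (- \<alpha> * s) * mean (max 0 s) g (S i))) \<le> indicator {0..<t} s * K" for i
      by (intro AE_I2 running_integrand_bound[OF \<alpha>])
    show "(\<lambda>s. indicator {0..<t} s * (exp (- \<alpha> * s) * mean (max 0 s) g z)) \<in> borel_measurable lborel" for z by measurable
    from this show "(\<lambda>s. indicator {0..<t} s * (exp (- \<alpha> * s) * mean (max 0 s) g (S i))) \<in> borel_measurable lborel" for i .
  qed (rule integrable_ivl)
qed

lemma running_ennreal:
  assumes \<alpha>: "0 < \<alpha>"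
  shows "running \<alpha> t y = ennreal (running_real \<alpha> t y)"
proof -
  have "running \<alpha> t y = (\<integral>\<^sup>+s. ennreal (indicator {0..<t} s * (exp (- \<alpha> * s) * mean (max 0 s) g y)) \<partial>lborel)"
    unfolding running_def
    by (intro nn_integral_cong) (auto simp: gn_semigroup ennreal_mult' split: split_indicator)
  also have "\<dots> = ennreal (running_real \<alpha> t y)"
    unfolding running_real_def
    by (intro nn_integral_eq_integral running_integrable[OF \<alpha>]) (auto simp: mean_g_bounds split: split_indicator)
  finally show ?thesis .
qed

lemma running_real_nonneg: "0 \<le> running_real \<alpha> t y"
  unfolding running_real_def by (intro integral_nonneg_AE AE_I2) (auto simp: mean_g_bounds split: split_indicator)

lemma continue_ennreal:
  assumes \<alpha>: "0 < \<alpha>" and t: "0 \<le> t" and f: "f \<in> borel_measurable borel" and b: "\<And>y. 0 \<le> f y" "\<And>y. f y \<le> b"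
  shows "continue \<alpha> t (\<lambda>y. ennreal (f y)) y = ennreal (continue_real \<alpha> t f y)"
proof -
  have "0 \<le> mean t f y" unfolding mean_def by (intro integral_nonneg_AE AE_I2 b)
  then show ?thesis
    unfolding continue_def continue_real_def running_ennreal[OF \<alpha>] semigroup_ennreal[OF t f b]
    by (simp add: ennreal_mult' running_real_nonneg)
qed

lemma continue_real_continuous:
  assumes "0 < \<alpha>" "0 \<le> t" "continuous_on UNIV f" "\<And>y. \<bar>f y\<bar> \<le> b"
  shows "continuous_on UNIV (continue_real \<alpha> t f)"
  unfolding continue_real_def
  by (intro continuous_intros running_real_continuous continuous_mean[of f b] assms)

text \<open>
  Monotonicity together with the contraction factor: raising the terminal cost by \<open>a\<close> raises the cost
  by at most the discounted \<open>a\<close>.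
\<close>

lemma continue_real_shift:
  assumes "0 < \<alpha>" "0 \<le> t" "f \<in> borel_measurable borel" "\<And>y. \<bar>f y\<bar> \<le> b"
    "h \<in> borel_measurable borel" "\<And>y. \<bar>h y\<bar> \<le> b'" "\<And>y. f y \<le> h y + a"
  shows "continue_real \<alpha> t f y \<le> continue_real \<alpha> t h y + exp (- \<alpha> * t) * a"
proof -
  have "exp (- \<alpha> * t) * mean t f y \<le> exp (- \<alpha> * t) * (mean t h y + a)"
    by (intro mult_left_mono mean_mono[of t f b h b'] assms) auto
  then show ?thesis unfolding continue_real_def by (simp add: distrib_left)
qed

text \<open>
  The choice between staying at \<open>y\<close> and one impulse into \<open>D\<close>, when \<open>u\<close> is to be paid afterwards.
\<close>

definition jump :: "'e set \<Rightarrow> ('e \<Rightarrow> real) \<Rightarrow> 'e \<Rightarrow> real" where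
  "jump D u y = min (u y) (Min ((\<lambda>d. c y d + u d) ` D))"

lemma jump_continuous:
  assumes "finite D" "D \<noteq> {}" "continuous_on UNIV u"
  shows "continuous_on UNIV (jump D u)"
  unfolding jump_def
  by (intro continuous_on_min assms continuous_on_Min_image continuous_on_add c_continuous1 continuous_on_const)

lemma jump_le: "jump D u y \<le> u y" by (simp add: jump_def)

lemma jump_le_cost: "finite D \<Longrightarrow> d \<in> D \<Longrightarrow> jump D u y \<le> c y d + u d"
  unfolding jump_def by (intro min.coboundedI2 Min_le) auto

lemma jump_cases:
  assumes "finite D" "D \<noteq> {}"
  obtains "jump D u y = u y" | d where "d \<in> D" "jump D u y = c y d + u d"
proof -
  have M: "Min ((\<lambda>d. c y d + u d) ` D) \<in> (\<lambda>d. c y d + u d) ` D" using assms by (intro Min_in) auto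
  show ?thesis
  proof (cases "u y \<le> Min ((\<lambda>d. c y d + u d) ` D)")
    case True
    then show ?thesis using that(1) unfolding jump_def by (simp only: min_absorb1)
  next
    case False
    then have "jump D u y = Min ((\<lambda>d. c y d + u d) ` D)" unfolding jump_def by (intro min_absorb2) simp
    then show ?thesis using that(2) M by auto
  qed
qed

lemma jump_shift:
  assumes "finite D" "D \<noteq> {}" "\<And>y. u y \<le> v y + a"
  shows "jump D u y \<le> jump D v y + a"
  using assms(1,2)
proof (cases rule: jump_cases[of D v y])
  case 1 then show ?thesis using jump_le[of D u y] assms(3)[of y] by simp
next
  case (2 d) then show ?thesis using jump_le_cost[OF assms(1) 2(1), of u y] assms(3)[of d] by simp
qed

text \<open>
  By the triangle inequality two impulses in a row are never cheaper than the direct one.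
\<close>

lemma jump_jump:
  assumes "finite D" "D \<noteq> {}" "d \<in> D"
  shows "jump D u y \<le> c y d + jump D u d"
  using assms(1,2)
proof (cases rule: jump_cases[of D u d])
  case 1 then show ?thesis using jump_le_cost[OF assms(1,3), of u y] by simp
next
  case (2 e) then show ?thesis using jump_le_cost[OF assms(1) 2(1), of u y] c_triangle[of y e d] by simp
qed

lemma jump_lower: "finite D \<Longrightarrow> D \<noteq> {} \<Longrightarrow> (\<And>y. b \<le> u y) \<Longrightarrow> b \<le> jump D u y"
  by (rule jump_cases[of D u y]) (auto intro: order_trans[OF _ add_increasing] less_imp_le[OF less_le_trans[OF c0_pos c_lower]])

definition bellman :: "real \<Rightarrow> real \<Rightarrow> 'e set \<Rightarrow> ('e \<Rightarrow> real) \<Rightarrow> 'e \<Rightarrow> real" where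
  "bellman \<alpha> \<delta> D f = jump D (continue_real \<alpha> \<delta> f)"

lemma bounded_continuous_obtain:
  assumes "continuous_on UNIV (f :: 'e \<Rightarrow> real)"
  obtains b where "\<And>y. \<bar>f y\<bar> \<le> b"
proof -
  obtain b where "\<And>y. norm (f y) \<le> b"
    using compact_imp_bounded[OF compact_continuous_image[OF assms compact_E]] unfolding bounded_iff by blast
  then show ?thesis using that by auto
qed

lemma bellman_continuous:
  assumes "0 < \<alpha>" "0 \<le> \<delta>" "finite D" "D \<noteq> {}" "continuous_on UNIV f"
  shows "continuous_on UNIV (bellman \<alpha> \<delta> D f)"
proof -
  obtain b where "\<And>y. \<bar>f y\<bar> \<le> b" using bounded_continuous_obtain[OF assms(5)] by blast
  then show ?thesis unfolding bellman_def
    by (intro jump_continuous continue_real_continuous[of _ _ _ b] assms)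
qed

lemma bellman_shift:
  assumes "0 < \<alpha>" "0 \<le> \<delta>" "finite D" "D \<noteq> {}" "continuous_on UNIV f" "continuous_on UNIV h" "\<And>y. f y \<le> h y + a"
  shows "bellman \<alpha> \<delta> D f y \<le> bellman \<alpha> \<delta> D h y + exp (- \<alpha> * \<delta>) * a"
proof -
  obtain b where b: "\<And>y. \<bar>f y\<bar> \<le> b" using bounded_continuous_obtain[OF assms(5)] by blast
  obtain b' where b': "\<And>y. \<bar>h y\<bar> \<le> b'" using bounded_continuous_obtain[OF assms(6)] by blast
  show ?thesis unfolding bellman_def
    by (intro jump_shift continue_real_shift[of _ _ _ b _ b'] assms b b' borel_measurable_continuous_onI)
qed

text \<open>
  Over a time step \<open>\<delta>\<close> discounting contracts by \<open>exp (- \<alpha> \<delta>)\<close> in the supremum norm, so Banach's theorem applies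
  in the space of bounded continuous functions.
\<close>

lemma bellman_fixpoint_exists:
  assumes \<alpha>: "0 < \<alpha>" and \<delta>: "0 < \<delta>" and D: "finite D" "D \<noteq> {}"
  shows "\<exists>v. continuous_on UNIV v \<and> bellman \<alpha> \<delta> D v = v"
proof -
  define T :: "('e \<Rightarrow>\<^sub>C real) \<Rightarrow> ('e \<Rightarrow>\<^sub>C real)" where "T = (\<lambda>f. Bcontfun (bellman \<alpha> \<delta> D (apply_bcontfun f)))"
  have cont: "continuous_on UNIV (apply_bcontfun f)" for f :: "'e \<Rightarrow>\<^sub>C real" by (rule continuous_on_apply_bcontfun)
  have in_bc: "h \<in> bcontfun" if "continuous_on UNIV h" for h :: "'e \<Rightarrow> real"
    using that compact_imp_bounded[OF compact_continuous_image[OF that compact_E]] by (simp add: bcontfun_def)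
  have T: "apply_bcontfun (T f) = bellman \<alpha> \<delta> D (apply_bcontfun f)" for f
    unfolding T_def
    by (intro Bcontfun_inverse in_bc bellman_continuous less_imp_le[OF \<delta>] \<alpha> D cont)
  have le: "bellman \<alpha> \<delta> D (apply_bcontfun f) y \<le> bellman \<alpha> \<delta> D (apply_bcontfun h) y + exp (- \<alpha> * \<delta>) * dist f h" for f h y
  proof (rule bellman_shift[OF \<alpha> less_imp_le[OF \<delta>] D cont cont])
    fix z show "apply_bcontfun f z \<le> apply_bcontfun h z + dist f h"
      using dist_bounded[of f z h] by (simp add: dist_real_def abs_le_iff)
  qed
  have "\<exists>!f. T f = f"
  proof (rule banach_fix_type[of "exp (- \<alpha> * \<delta>)"], safe)
    fix f h :: "'e \<Rightarrow>\<^sub>C real"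
    show "dist (T f) (T h) \<le> exp (- \<alpha> * \<delta>) * dist f h"
    proof (rule dist_bound)
      fix y show "dist (apply_bcontfun (T f) y) (apply_bcontfun (T h) y) \<le> exp (- \<alpha> * \<delta>) * dist f h"
        using le[of f y h] le[of h y f] unfolding T dist_real_def by (simp add: dist_commute abs_le_iff)
    qed
  qed (use \<alpha> \<delta> in auto)
  then obtain f where "T f = f" by auto
  then show ?thesis using T[of f] cont[of f] by (intro exI[of _ "apply_bcontfun f"]) auto
qed

text \<open>
  At a maximum point of \<open>f - v\<close>, which exists by compactness, the contraction inequality
  \<open>max (f - v) \<le> exp (- \<alpha> \<delta>) * max (f - v)\<close> forces the maximum to be nonpositive.
\<close>

lemma bellman_comparison:
  assumes \<alpha>: "0 < \<alpha>" and \<delta>: "0 < \<delta>" and D: "finite D" "D \<noteq> {}"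
    and f: "continuous_on UNIV f" "\<And>y. f y \<le> bellman \<alpha> \<delta> D f y"
    and v: "continuous_on UNIV v" "bellman \<alpha> \<delta> D v = v"
  shows "f y \<le> v y"
proof -
  have "continuous_on UNIV (\<lambda>y. f y - v y)" by (intro continuous_intros f v)
  from continuous_attains_sup[OF compact_E _ this]
  obtain z where z: "\<And>y. f y - v y \<le> f z - v z" by auto
  have "f z \<le> bellman \<alpha> \<delta> D v z + exp (- \<alpha> * \<delta>) * (f z - v z)"
    by (rule order_trans[OF f(2) bellman_shift[OF \<alpha> less_imp_le[OF \<delta>] D f(1) v(1)]]) (use z in \<open>simp add: algebra_simps\<close>)
  then have "(1 - exp (- \<alpha> * \<delta>)) * (f z - v z) \<le> 0" using v(2) by (simp add: algebra_simps)
  moreover have "0 < 1 - exp (- \<alpha> * \<delta>)" using \<alpha> \<delta> by simp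
  ultimately have "f z - v z \<le> 0"
    using mult_pos_pos[of "1 - exp (- \<alpha> * \<delta>)" "f z - v z"] by linarith
  then show ?thesis using z[of y] by simp
qed

end

section \<open>The limit of fine grids\<close>

context impulse_problem
begin

definition dense_sequence :: "nat \<Rightarrow> 'e" where
  "dense_sequence = (SOME q. \<forall>U. open U \<longrightarrow> U \<noteq> {} \<longrightarrow> (\<exists>k. q k \<in> U))"

lemma dense_sequence: "open U \<Longrightarrow> \<xi> \<in> U \<Longrightarrow> \<exists>k. dense_sequence k \<in> U"
proof -
  obtain D :: "'e set" where D: "countable D" "\<And>U. open U \<Longrightarrow> U \<noteq> {} \<Longrightarrow> \<exists>d\<in>D. d \<in> U"
    using countable_dense_setE by auto
  have "D \<noteq> {}" using D(2)[of UNIV] by auto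
  then have "range (from_nat_into D) = D" using D(1) by (rule range_from_nat_into)
  then have "\<forall>U. open U \<longrightarrow> U \<noteq> {} \<longrightarrow> (\<exists>k. from_nat_into D k \<in> U)" using D(2) by (metis imageE)
  then have "\<forall>U. open U \<longrightarrow> U \<noteq> {} \<longrightarrow> (\<exists>k. dense_sequence k \<in> U)"
    unfolding dense_sequence_def by (rule someI[of "\<lambda>q. \<forall>U. open U \<longrightarrow> U \<noteq> {} \<longrightarrow> (\<exists>k. q k \<in> U)"])
  then show "open U \<Longrightarrow> \<xi> \<in> U \<Longrightarrow> \<exists>k. dense_sequence k \<in> U" by blast
qed

definition targets :: "nat \<Rightarrow> 'e set" where "targets n = dense_sequence ` {..n}"

lemma targets: "finite (targets n)" "targets n \<noteq> {}" by (auto simp: targets_def)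

definition mesh :: "nat \<Rightarrow> real" where "mesh n = (1/2) ^ n"

lemma mesh: "0 < mesh n" "mesh n \<le> 1" "0 \<le> mesh n" "mesh n = mesh (Suc n) + mesh (Suc n)"
  by (auto simp: mesh_def power_le_one)

text \<open>
  The value function when impulses are allowed at the multiples of \<open>mesh n\<close> only, into the finite set
  \<open>targets n\<close>. Halving the mesh and enlarging the target set give the controller more freedom.
\<close>

definition grid_value :: "real \<Rightarrow> nat \<Rightarrow> 'e \<Rightarrow> real" where
  "grid_value \<alpha> n = (SOME v. continuous_on UNIV v \<and> bellman \<alpha> (mesh n) (targets n) v = v)"

context
  fixes \<alpha> :: real assumes \<alpha>: "0 < \<alpha>"
begin

lemma grid_value: "continuous_on UNIV (grid_value \<alpha> n)" "bellman \<alpha> (mesh n) (targets n) (grid_value \<alpha> n) = grid_value \<alpha> n"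
  using someI_ex[OF bellman_fixpoint_exists[OF \<alpha> mesh(1) targets], of n n]
  unfolding grid_value_def[symmetric] by auto

lemma grid_value_measurable [measurable]: "grid_value \<alpha> n \<in> borel_measurable borel"
  by (rule borel_measurable_continuous_onI[OF grid_value(1)])

lemma grid_value_nonneg: "0 \<le> grid_value \<alpha> n y"
proof (rule bellman_comparison[OF \<alpha> mesh(1) targets continuous_on_const _ grid_value])
  fix y show "0 \<le> bellman \<alpha> (mesh n) (targets n) (\<lambda>_. 0) y"
    unfolding bellman_def
    by (intro jump_lower targets) (simp add: continue_real_def mean_const running_real_nonneg)
qed

lemma grid_value_bounded: obtains b where "\<forall>y. grid_value \<alpha> n y \<le> b" "\<forall>y. \<bar>grid_value \<alpha> n y\<bar> \<le> b" "0 \<le> b"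
proof -
  obtain b where b: "\<And>y. \<bar>grid_value \<alpha> n y\<bar> \<le> b" using bounded_continuous_obtain[OF grid_value(1)] by blast
  then have "\<forall>y. grid_value \<alpha> n y \<le> b" "0 \<le> b" using abs_ge_self order_trans abs_ge_zero by blast+
  then show ?thesis using that b by blast
qed

lemma grid_value_jump: "grid_value \<alpha> n = jump (targets n) (continue_real \<alpha> (mesh n) (grid_value \<alpha> n))"
  using grid_value(2)[of n] unfolding bellman_def by simp

lemma grid_value_le_cost: "d \<in> targets n \<Longrightarrow> grid_value \<alpha> n y \<le> c y d + grid_value \<alpha> n d"
  by (subst (1 2) grid_value_jump) (rule jump_jump[OF targets])

lemma continue_grid_value:
  "0 \<le> t \<Longrightarrow> continue \<alpha> t (\<lambda>y. ennreal (grid_value \<alpha> n y)) y = ennreal (continue_real \<alpha> t (grid_value \<alpha> n) y)"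
proof -
  assume t: "0 \<le> t"
  obtain b where b: "\<forall>y. grid_value \<alpha> n y \<le> b" by (rule grid_value_bounded)
  show ?thesis
    using b by (intro continue_ennreal[OF \<alpha> t, of _ b] grid_value_nonneg) auto
qed

lemma continue_real_grid_value_nonneg: "0 \<le> continue_real \<alpha> t (grid_value \<alpha> n) y"
  unfolding continue_real_def mean_def
  by (intro add_nonneg_nonneg mult_nonneg_nonneg running_real_nonneg integral_nonneg_AE AE_I2 grid_value_nonneg) auto

text \<open>
  Waiting for one step of a coarser grid is a possible choice on the finer grid; the wait is composed
  of two waits of half the length (downward induction on \<open>m\<close>).
\<close>

lemma grid_value_le_continue:
  assumes "m \<le> n"
  shows "grid_value \<alpha> n y \<le> continue_real \<alpha> (mesh m) (grid_value \<alpha> n) y"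
  using assms
proof (induction m arbitrary: y rule: inc_induct)
  case base
  show ?case by (subst grid_value_jump) (rule jump_le)
next
  case (step m)
  let ?v = "\<lambda>y. ennreal (grid_value \<alpha> n y)"
  have le: "?v y \<le> continue \<alpha> (mesh (Suc m)) ?v y" for y
    unfolding continue_grid_value[OF mesh(3)] by (intro ennreal_leI step.IH)
  have "?v y \<le> continue \<alpha> (mesh (Suc m)) (continue \<alpha> (mesh (Suc m)) ?v) y"
    by (rule order_trans[OF le continue_mono[OF le]])
  also have "\<dots> = continue \<alpha> (mesh m) ?v y"
    by (subst continue_add) (auto simp: mesh(4)[of m] mesh(3))
  finally show ?case
    unfolding continue_grid_value[OF mesh(3)]
    using continue_real_grid_value_nonneg by simp
qed

text \<open>
  The value function of the finer grid is a subsolution of the Bellman equation of the coarser grid, hence lies below its solution.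
\<close>

lemma grid_value_antimono_Suc: "grid_value \<alpha> (Suc n) y \<le> grid_value \<alpha> n y"
proof (rule bellman_comparison[OF \<alpha> mesh(1) targets grid_value(1) _ grid_value])
  fix y
  let ?f = "grid_value \<alpha> (Suc n)" and ?u = "continue_real \<alpha> (mesh n) (grid_value \<alpha> (Suc n))"
  have fu: "?f y \<le> ?u y" for y by (rule grid_value_le_continue) simp
  show "?f y \<le> bellman \<alpha> (mesh n) (targets n) ?f y"
    unfolding bellman_def
  proof (rule jump_cases[OF targets, of n ?u y])
    assume "jump (targets n) ?u y = ?u y" then show "?f y \<le> jump (targets n) ?u y" using fu by simp
  next
    fix d assume d: "d \<in> targets n" "jump (targets n) ?u y = c y d + ?u d"
    have "?f y \<le> c y d + ?f d" using d(1) by (intro grid_value_le_cost) (auto simp: targets_def)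
    then show "?f y \<le> jump (targets n) ?u y" using fu[of d] d(2) by simp
  qed
qed

lemma grid_value_decseq: "decseq (\<lambda>n. grid_value \<alpha> n y)"
  by (rule decseq_SucI) (rule grid_value_antimono_Suc)

end

text \<open>
  The mesh tends to 0 and the targets become dense. As an infimum of continuous functions the limit is upper
  semicontinuous.
\<close>

definition limit_value :: "real \<Rightarrow> 'e \<Rightarrow> real" where
  "limit_value \<alpha> y = (INF n. grid_value \<alpha> n y)"

definition least_value :: "real \<Rightarrow> real" where
  "least_value \<alpha> = (INF y. limit_value \<alpha> y)"

context
  fixes \<alpha> :: real assumes \<alpha>: "0 < \<alpha>"
begin

lemma limit_value_bdd: "bdd_below (range (\<lambda>n. grid_value \<alpha> n y))"
  by (rule bdd_belowI[of _ 0]) (auto simp: grid_value_nonneg[OF \<alpha>])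

lemma limit_value_le: "limit_value \<alpha> y \<le> grid_value \<alpha> n y"
  unfolding limit_value_def by (rule cINF_lower[OF limit_value_bdd]) simp

lemma limit_value_nonneg: "0 \<le> limit_value \<alpha> y"
  unfolding limit_value_def by (rule cINF_greatest) (auto simp: grid_value_nonneg[OF \<alpha>])

lemma limit_value_LIMSEQ: "(\<lambda>n. grid_value \<alpha> n y) \<longlonglongrightarrow> limit_value \<alpha> y"
  unfolding limit_value_def by (rule LIMSEQ_decseq_INF[OF limit_value_bdd grid_value_decseq[OF \<alpha>]])

lemma limit_value_measurable [measurable]: "limit_value \<alpha> \<in> borel_measurable borel"
  by (rule borel_measurable_LIMSEQ_real[OF limit_value_LIMSEQ]) (auto intro: grid_value_measurable[OF \<alpha>])

lemma limit_value_usc: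
  assumes "limit_value \<alpha> \<xi> < a"
  shows "\<forall>\<^sub>F z in nhds \<xi>. limit_value \<alpha> z < a"
proof -
  obtain n where n: "grid_value \<alpha> n \<xi> < a"
    using assms cINF_less_iff[OF _ limit_value_bdd, of \<xi> a] unfolding limit_value_def by auto
  have "(grid_value \<alpha> n \<longlongrightarrow> grid_value \<alpha> n \<xi>) (nhds \<xi>)"
    using grid_value(1)[OF \<alpha>, of n] by (simp add: continuous_on_eq_continuous_at isCont_def tendsto_at_iff_tendsto_nhds)
  from order_tendstoD(2)[OF this n] show ?thesis
    by (rule eventually_mono) (rule le_less_trans[OF limit_value_le])
qed

text \<open>
  For targets in the dense sequence the inequality holds on all sufficiently fine grids. It extends to
  all \<open>\<xi>\<close> since values near \<open>\<xi>\<close> are not much larger than the value at \<open>\<xi>\<close>.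
\<close>

lemma limit_value_le_cost: "limit_value \<alpha> y \<le> c y \<xi> + limit_value \<alpha> \<xi>"
proof (rule ccontr)
  assume neg: "\<not> ?thesis"
  define e where "e = (limit_value \<alpha> y - c y \<xi> - limit_value \<alpha> \<xi>) / 2"
  have e: "0 < e" using neg unfolding e_def by simp
  have dense: "limit_value \<alpha> y \<le> c y (dense_sequence k) + limit_value \<alpha> (dense_sequence k)" for k
  proof (rule LIMSEQ_le[OF limit_value_LIMSEQ tendsto_add[OF tendsto_const limit_value_LIMSEQ]])
    show "\<exists>N. \<forall>n\<ge>N. grid_value \<alpha> n y \<le> c y (dense_sequence k) + grid_value \<alpha> n (dense_sequence k)"
      by (intro exI[of _ k] allI impI grid_value_le_cost[OF \<alpha>]) (auto simp: targets_def)
  qed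
  have 1: "\<forall>\<^sub>F z in nhds \<xi>. limit_value \<alpha> z < limit_value \<alpha> \<xi> + e"
    by (rule limit_value_usc) (use e in simp)
  have "(c y \<longlongrightarrow> c y \<xi>) (nhds \<xi>)"
    using c_continuous2[of y] by (simp add: continuous_on_eq_continuous_at isCont_def tendsto_at_iff_tendsto_nhds)
  then have 2: "\<forall>\<^sub>F z in nhds \<xi>. c y z < c y \<xi> + e" by (rule order_tendstoD(2)) (use e in simp)
  obtain U where "open U" "\<xi> \<in> U" and U: "\<And>z. z \<in> U \<Longrightarrow> limit_value \<alpha> z < limit_value \<alpha> \<xi> + e \<and> c y z < c y \<xi> + e"
    using eventually_conj[OF 1 2] unfolding eventually_nhds by blast
  then obtain k where "dense_sequence k \<in> U" using dense_sequence by blast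
  then have "limit_value \<alpha> y < c y \<xi> + limit_value \<alpha> \<xi> + 2 * e" using U dense[of k] by force
  moreover have "2 * e = limit_value \<alpha> y - c y \<xi> - limit_value \<alpha> \<xi>" unfolding e_def by simp
  ultimately show False by linarith
qed

lemma limit_value_bounded: obtains b where "\<And>y. limit_value \<alpha> y \<le> b" "0 \<le> b"
proof -
  obtain b where "\<forall>y. grid_value \<alpha> 0 y \<le> b" "0 \<le> b" using grid_value_bounded[OF \<alpha>] by blast
  then show ?thesis using that limit_value_le order_trans by blast
qed

lemma limit_value_le_continue: "limit_value \<alpha> y \<le> continue_real \<alpha> (mesh m) (limit_value \<alpha>) y"
proof (rule LIMSEQ_le_const)
  interpret prob_space "P y" by (rule prob_P)
  obtain b where b: "\<forall>y. grid_value \<alpha> 0 y \<le> b" "0 \<le> b" using grid_value_bounded[OF \<alpha>] by blast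
  have le_b: "grid_value \<alpha> n y \<le> b" for n y
    using b(1) decseqD[OF grid_value_decseq[OF \<alpha>], of 0 n y] order_trans by blast
  have "(\<lambda>n. mean (mesh m) (grid_value \<alpha> n) y) \<longlonglongrightarrow> mean (mesh m) (limit_value \<alpha>) y"
    unfolding mean_def
    by (rule integral_dominated_convergence[where w="\<lambda>_. b"])
      (auto intro: measurable_compose[OF measurable_X[OF mesh(3)]] grid_value_measurable[OF \<alpha>]
        limit_value_LIMSEQ simp: le_b grid_value_nonneg[OF \<alpha>])
  then show "(\<lambda>n. continue_real \<alpha> (mesh m) (grid_value \<alpha> n) y) \<longlonglongrightarrow> continue_real \<alpha> (mesh m) (limit_value \<alpha>) y"
    unfolding continue_real_def by (intro tendsto_intros)
  show "\<exists>N. \<forall>n\<ge>N. limit_value \<alpha> y \<le> continue_real \<alpha> (mesh m) (grid_value \<alpha> n) y"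
    by (intro exI[of _ m] allI impI order_trans[OF limit_value_le grid_value_le_continue[OF \<alpha>]])
qed

lemma least_value_bdd: "bdd_below (range (limit_value \<alpha>))"
  by (rule bdd_belowI[of _ 0]) (auto simp: limit_value_nonneg)

lemma least_value_le: "least_value \<alpha> \<le> limit_value \<alpha> y"
  unfolding least_value_def by (rule cINF_lower[OF least_value_bdd]) simp

lemma least_value_nonneg: "0 \<le> least_value \<alpha>"
  unfolding least_value_def by (rule cINF_greatest) (auto simp: limit_value_nonneg)

lemma running_le_undiscounted: "running \<alpha> t y \<le> running 0 t y"
  unfolding running_def
proof (intro nn_integral_mono)
  fix s :: real
  have "ennreal (exp (- \<alpha> * s)) * z \<le> 1 * z" if "0 \<le> s" for z
    by (rule mult_right_mono) (use \<alpha> that in \<open>auto simp: ennreal_le_1\<close>)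
  then show "ennreal (exp (- \<alpha> * s)) * semigroup (max 0 s) gn y * indicator {0..<t} s
      \<le> ennreal (exp (- 0 * s)) * semigroup (max 0 s) gn y * indicator {0..<t} s"
    by (auto split: split_indicator)
qed

text \<open>
  Over a time \<open>t\<close> discounting reduces the cost rate by at most the fraction \<open>\<alpha> t\<close>, so the total error is of
  second order in \<open>t\<close>.
\<close>

lemma undiscounted_le_running:
  assumes t: "0 \<le> t"
  shows "running 0 t y \<le> running \<alpha> t y + ennreal (\<alpha> * t * t * K)"
proof -
  have "running 0 t y \<le> (\<integral>\<^sup>+s. ennreal (exp (- \<alpha> * s)) * semigroup (max 0 s) gn y * indicator {0..<t} s
      + ennreal (\<alpha> * t * K) * indicator {0..<t} s \<partial>lborel)"
    unfolding running_def
  proof (intro nn_integral_mono)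
    fix s :: real
    have "mean s g y \<le> exp (- (\<alpha> * s)) * mean s g y + \<alpha> * t * K" if s: "0 \<le> s" "s < t"
    proof -
      have "1 - exp (- (\<alpha> * s)) \<le> \<alpha> * s" using exp_ge_add_one_self[of "- (\<alpha> * s)"] by simp
      also have "\<dots> \<le> \<alpha> * t" using s \<alpha> by simp
      finally have "(1 - exp (- (\<alpha> * s))) * mean s g y \<le> \<alpha> * t * K"
        using mean_g_bounds[OF s(1), of y] t \<alpha> by (intro mult_mono) auto
      then show ?thesis by (simp add: algebra_simps)
    qed
    then show "ennreal (exp (- 0 * s)) * semigroup (max 0 s) gn y * indicator {0..<t} s
        \<le> ennreal (exp (- \<alpha> * s)) * semigroup (max 0 s) gn y * indicator {0..<t} s + ennreal (\<alpha> * t * K) * indicator {0..<t} s"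
      using mean_g_bounds[of s y] \<alpha> t K_nonneg
      by (auto simp: gn_semigroup ennreal_mult'[symmetric] ennreal_plus[symmetric] simp del: ennreal_plus split: split_indicator intro!: ennreal_leI)
  qed
  also have "\<dots> = running \<alpha> t y + ennreal (\<alpha> * t * K) * t"
    unfolding running_def
    by (subst nn_integral_add, measurable) (use t in \<open>auto simp: nn_integral_cmult_indicator\<close>)
  also have "ennreal (\<alpha> * t * K) * t = ennreal (\<alpha> * t * t * K)"
    using t \<alpha> K_nonneg by (simp add: ennreal_mult'[symmetric] algebra_simps)
  finally show ?thesis .
qed

text \<open>
  The discounted inequality \<open>v \<le> continue \<alpha> \<delta> v\<close>, freed of its discount factors: they reduce the terminal value by
  at least \<open>(1 - exp (- \<alpha> \<delta>)) * inf v\<close>, which is \<open>\<alpha> * inf v * \<delta>\<close> up to an error of order \<open>\<delta>\<^sup>2\<close>.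
  Summed over about \<open>T / \<delta>\<close> steps the error vanishes as \<open>\<delta> \<rightarrow> 0\<close>.
\<close>

lemma limit_value_submartingale:
  fixes m defines "\<delta> \<equiv> mesh m"
  shows "ennreal (limit_value \<alpha> y + \<alpha> * least_value \<alpha> * \<delta>)
    \<le> running 0 \<delta> y + semigroup \<delta> (\<lambda>y. ennreal (limit_value \<alpha> y)) y + ennreal ((\<alpha> * \<delta>)\<^sup>2 * least_value \<alpha>)"
proof -
  define M where "M = mean \<delta> (limit_value \<alpha>) y"
  define x where "x = \<alpha> * \<delta>"
  have \<delta>: "0 < \<delta>" unfolding \<delta>_def by (rule mesh)
  have x: "0 < x" using \<alpha> \<delta> by (simp add: x_def)
  obtain b where b: "\<And>y. limit_value \<alpha> y \<le> b" "0 \<le> b" using limit_value_bounded by blast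
  have sg: "semigroup \<delta> (\<lambda>y. ennreal (limit_value \<alpha> y)) y = ennreal M"
    unfolding M_def by (rule semigroup_ennreal[OF less_imp_le[OF \<delta>] limit_value_measurable limit_value_nonneg b(1)])
  have ab: "\<bar>limit_value \<alpha> y\<bar> \<le> b" for y using limit_value_nonneg[of y] b(1)[of y] by simp
  have "\<bar>least_value \<alpha>\<bar> \<le> b"
    using least_value_nonneg order_trans[OF least_value_le b(1)] by simp
  then have M: "least_value \<alpha> \<le> M"
    using mean_mono[of \<delta> "\<lambda>_. least_value \<alpha>" b "limit_value \<alpha>" b 0 y] least_value_le \<delta> ab
    unfolding M_def by (auto simp: mean_const)
  have "exp (- x) \<le> 1 - x + x\<^sup>2"
  proof -
    have "exp (- x) = 1 / exp x" by (simp add: exp_minus inverse_eq_divide)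
    also have "\<dots> \<le> 1 / (1 + x)" using exp_ge_add_one_self[of x] x by (intro divide_left_mono) auto
    also have "\<dots> \<le> 1 - x + x\<^sup>2"
      using x by (simp add: divide_simps) (simp add: algebra_simps power2_eq_square)
    finally show ?thesis .
  qed
  then have "x - x\<^sup>2 \<le> 1 - exp (- x)" by simp
  then have "(x - x\<^sup>2) * least_value \<alpha> \<le> (1 - exp (- x)) * least_value \<alpha>"
    by (rule mult_right_mono[OF _ least_value_nonneg])
  also have "\<dots> \<le> (1 - exp (- x)) * M" using x M by (intro mult_left_mono) auto
  finally have key: "exp (- x) * M + x * least_value \<alpha> \<le> M + x\<^sup>2 * least_value \<alpha>" by (simp add: algebra_simps)
  have "limit_value \<alpha> y + \<alpha> * least_value \<alpha> * \<delta> \<le> running_real \<alpha> \<delta> y + (exp (- x) * M + x * least_value \<alpha>)"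
    using limit_value_le_continue[of y m] unfolding continue_real_def \<delta>_def[symmetric] M_def x_def by (simp add: algebra_simps)
  also have "\<dots> \<le> running_real \<alpha> \<delta> y + (M + x\<^sup>2 * least_value \<alpha>)" using key by simp
  finally have "ennreal (limit_value \<alpha> y + \<alpha> * least_value \<alpha> * \<delta>)
      \<le> ennreal (running_real \<alpha> \<delta> y + (M + x\<^sup>2 * least_value \<alpha>))" by (rule ennreal_leI)
  also have "\<dots> = running \<alpha> \<delta> y + (ennreal M + ennreal (x\<^sup>2 * least_value \<alpha>))"
    unfolding running_ennreal[OF \<alpha>] using M least_value_nonneg running_real_nonneg by (simp add: add_nonneg_nonneg)
  also have "\<dots> \<le> running 0 \<delta> y + (ennreal M + ennreal (x\<^sup>2 * least_value \<alpha>))"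
    by (intro add_right_mono running_le_undiscounted)
  finally show ?thesis unfolding sg x_def by (simp add: add.assoc)
qed

text \<open>
  The converse estimate for a fixed grid: removing the discount factors costs at most \<open>\<alpha> (b + K)\<close> per unit
  of time, \<open>b\<close> being an upper bound of the value function.
\<close>

lemma grid_value_supermartingale:
  fixes n defines "\<delta> \<equiv> mesh n" and "u \<equiv> continue_real \<alpha> (mesh n) (grid_value \<alpha> n)"
  assumes b: "\<And>y. grid_value \<alpha> n y \<le> b" "0 \<le> b"
  shows "running 0 \<delta> y + semigroup \<delta> (\<lambda>y. ennreal (grid_value \<alpha> n y)) y \<le> ennreal (u y + \<delta> * (\<alpha> * (b + K)))"
proof -
  define M where "M = mean \<delta> (grid_value \<alpha> n) y"
  have \<delta>: "0 < \<delta>" "\<delta> \<le> 1" unfolding \<delta>_def by (rule mesh)+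
  have sg: "semigroup \<delta> (\<lambda>y. ennreal (grid_value \<alpha> n y)) y = ennreal M"
    unfolding M_def by (rule semigroup_ennreal[OF less_imp_le[OF \<delta>(1)] grid_value_measurable[OF \<alpha>] grid_value_nonneg[OF \<alpha>] b(1)])
  have ab: "\<bar>grid_value \<alpha> n y\<bar> \<le> b" for y using grid_value_nonneg[OF \<alpha>, of n y] b(1)[of y] by simp
  have M: "0 \<le> M" "M \<le> b"
    using mean_abs_le[OF less_imp_le[OF \<delta>(1)] grid_value_measurable[OF \<alpha>] ab, of y]
    unfolding M_def by (auto simp: mean_def intro!: integral_nonneg_AE AE_I2 grid_value_nonneg[OF \<alpha>])
  have "(1 - exp (- \<alpha> * \<delta>)) * M \<le> (\<alpha> * \<delta>) * b"
    using exp_ge_add_one_self[of "- \<alpha> * \<delta>"] M \<alpha> \<delta> by (intro mult_mono) auto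
  then have key: "M \<le> exp (- \<alpha> * \<delta>) * M + \<delta> * \<alpha> * b" by (simp add: algebra_simps)
  have "\<alpha> * \<delta> * \<delta> * K \<le> \<delta> * \<alpha> * K" using \<alpha> \<delta> K_nonneg by (simp add: mult_left_le_one_le mult.commute mult.left_commute mult_left_mono)
  then have "running_real \<alpha> \<delta> y + \<alpha> * \<delta> * \<delta> * K + M \<le> u y + \<delta> * (\<alpha> * (b + K))"
    using key unfolding u_def continue_real_def \<delta>_def[symmetric] M_def[symmetric] by (simp add: algebra_simps)
  then have "ennreal (running_real \<alpha> \<delta> y + \<alpha> * \<delta> * \<delta> * K + M) \<le> ennreal (u y + \<delta> * (\<alpha> * (b + K)))"
    by (rule ennreal_leI)
  moreover have "running 0 \<delta> y + ennreal M \<le> ennreal (running_real \<alpha> \<delta> y + \<alpha> * \<delta> * \<delta> * K + M)"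
    using undiscounted_le_running[OF less_imp_le[OF \<delta>(1)], of y] M running_real_nonneg[of \<alpha> \<delta> y] \<alpha> \<delta> K_nonneg
    unfolding running_ennreal[OF \<alpha>] by (simp add: add_right_mono)
  ultimately show ?thesis unfolding sg by (rule order_trans[rotated])
qed

text \<open>
  A jump to a target whose value is nearly minimal costs at most \<open>c\<^sub>1\<close>, which bounds the value function from
  above. The additional 1 leaves room for the approximations of \<open>inf v\<close> by a target and by a grid; it will be
  multiplied by \<open>\<alpha>\<close>.
\<close>

lemma grid_value_near_least: obtains n where "\<And>y. grid_value \<alpha> n y \<le> least_value \<alpha> + c\<^sub>1 + 1"
proof -
  obtain \<xi> where "limit_value \<alpha> \<xi> < least_value \<alpha> + 1"
    using cINF_less_iff[OF _ least_value_bdd, of "least_value \<alpha> + 1"] unfolding least_value_def by auto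
  from limit_value_usc[OF this] obtain U where "open U" "\<xi> \<in> U" "\<And>z. z \<in> U \<Longrightarrow> limit_value \<alpha> z < least_value \<alpha> + 1"
    unfolding eventually_nhds by blast
  then obtain k where "limit_value \<alpha> (dense_sequence k) < least_value \<alpha> + 1" using dense_sequence by blast
  from order_tendstoD(2)[OF limit_value_LIMSEQ this] obtain N where
    N: "\<And>n. n \<ge> N \<Longrightarrow> grid_value \<alpha> n (dense_sequence k) < least_value \<alpha> + 1"
    unfolding eventually_sequentially by blast
  let ?n = "max N k"
  have "grid_value \<alpha> ?n y \<le> least_value \<alpha> + c\<^sub>1 + 1" for y
    using grid_value_le_cost[OF \<alpha>, of "dense_sequence k" ?n y] N[of ?n] c_upper[of y "dense_sequence k"]
    by (auto simp: targets_def)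
  then show ?thesis by (rule that)
qed

end

end

section \<open>Optional sampling along one segment\<close>

lemma stopping_time_plus:
  fixes G :: "ennreal \<Rightarrow> 'a measure"
  assumes G: "filtration \<Omega> G" and \<sigma>: "stopping_time G \<sigma>" and d: "0 \<le> d"
  shows "stopping_time G (\<lambda>\<omega>. \<sigma> \<omega> + ennreal d)"
proof
  fix t
  interpret filtration \<Omega> G by (rule G)
  show "Measurable.pred (G t) (\<lambda>\<omega>. \<sigma> \<omega> + ennreal d \<le> t)"
  proof (cases "ennreal d \<le> t")
    case True
    have "\<sigma> \<omega> + ennreal d \<le> t \<longleftrightarrow> \<sigma> \<omega> \<le> t - ennreal d" for \<omega>
      using True by (cases t; cases "\<sigma> \<omega>")
        (auto simp: ennreal_minus ennreal_plus[symmetric] ennreal_le_iff2 top_add top_unique d simp del: ennreal_plus)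
    then show ?thesis by (simp, intro stopping_time_le_const[OF \<sigma>]) (rule diff_le_self_ennreal)
  next
    case False
    then have "\<not> \<sigma> \<omega> + ennreal d \<le> t" for \<omega> by (metis add.commute le_iff_add order_trans)
    then show ?thesis by simp
  qed
qed

locale impulse_restarted = impulse_problem \<Omega> F X P g c K c\<^sub>0 c\<^sub>1 + restarted_process \<Omega> F X P M G \<sigma>\<^sub>0 Z
  for \<Omega> :: "'w set" and F :: "ennreal \<Rightarrow> 'w measure"
    and X :: "real \<Rightarrow> 'w \<Rightarrow> 'e::polish_space" and P :: "'e \<Rightarrow> 'w measure"
    and g :: "'e \<Rightarrow> real" and c :: "'e \<Rightarrow> 'e \<Rightarrow> real" and K c\<^sub>0 c\<^sub>1 :: real
    and M :: "'a measure" and G :: "ennreal \<Rightarrow> 'a measure"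
    and \<sigma>\<^sub>0 :: "'a \<Rightarrow> ennreal" and Z :: "real \<Rightarrow> 'a \<Rightarrow> 'e"
begin

abbreviation run_cost :: "real \<Rightarrow> real \<Rightarrow> 'a \<Rightarrow> ennreal" where
  "run_cost a b \<omega> \<equiv> \<integral>\<^sup>+s\<in>{a..<b}. gn (Z (max 0 s) \<omega>) \<partial>lborel"

lemmas Z_joint [measurable] = Z_jointly_measurable

lemma running_cost_measurable [measurable (raw)]:
  assumes [measurable]: "a \<in> borel_measurable M" "b \<in> borel_measurable M"
  shows "(\<lambda>\<omega>. run_cost (a \<omega>) (b \<omega>) \<omega>) \<in> borel_measurable M"
proof -
  have "indicator {a \<omega>..<b \<omega>} s = (if a \<omega> \<le> s \<and> s < b \<omega> then 1 else 0 :: ennreal)" for \<omega> s by auto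
  then show ?thesis by simp
qed

text \<open>
  The Markov property at \<open>\<sigma>\<close>, for the running cost over the next \<open>\<delta>\<close> units of time and a terminal cost.
\<close>

lemma one_step:
  assumes st: "stopping_time G \<sigma>" and ge: "\<And>\<omega>. \<omega> \<in> space M \<Longrightarrow> \<sigma>\<^sub>0 \<omega> \<le> \<sigma> \<omega>"
    and B: "B \<in> sets (flt.pre_sigma \<sigma>)" and fin: "\<And>\<omega>. \<omega> \<in> B \<Longrightarrow> \<sigma> \<omega> < \<top>"
    and \<delta>: "0 \<le> \<delta>" and w[measurable]: "w \<in> borel_measurable borel"
  defines "a \<equiv> \<lambda>\<omega>. enn2real (\<sigma> \<omega>)"
  shows "(\<integral>\<^sup>+\<omega>\<in>B. (running 0 \<delta> (Z (a \<omega>) \<omega>) + semigroup \<delta> w (Z (a \<omega>) \<omega>)) \<partial>M)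
    = (\<integral>\<^sup>+\<omega>\<in>B. (run_cost (a \<omega>) (a \<omega> + \<delta>) \<omega> + w (Z (a \<omega> + \<delta>) \<omega>)) \<partial>M)"
proof -
  note [measurable] = stopping_time_measurable[OF st]
  have [measurable]: "B \<in> sets M" using B pre_sigma_subset[OF st] by auto
  have am[measurable]: "a \<in> borel_measurable M" unfolding a_def by measurable
  have a0: "0 \<le> a \<omega>" for \<omega> by (simp add: a_def)
  have [measurable]: "(\<lambda>\<omega>. Z (a \<omega>) \<omega>) \<in> borel_measurable M" by (rule Z_compose) (auto simp: a0)
  have [measurable]: "(\<lambda>\<omega>. Z (a \<omega> + \<delta>) \<omega>) \<in> borel_measurable M" by (rule Z_compose) (auto simp: a0 \<delta>)
  have [measurable]: "semigroup \<delta> w \<in> borel_measurable borel" by (rule semigroup_measurable[OF \<delta> w])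
  interpret ps: pair_sigma_finite M lborel by unfold_locales
  have Zas[measurable]: "(\<lambda>(\<omega>, s). Z (a \<omega> + max 0 s) \<omega>) \<in> borel_measurable (M \<Otimes>\<^sub>M borel)"
  proof -
    have "(\<lambda>x. Z (a (fst x) + max 0 (snd x)) (fst x)) \<in> borel_measurable (M \<Otimes>\<^sub>M borel)"
      by (rule Z_compose) (auto simp: a0 add_nonneg_nonneg)
    then show ?thesis by (simp add: case_prod_beta')
  qed
  have "(\<integral>\<^sup>+\<omega>\<in>B. running 0 \<delta> (Z (a \<omega>) \<omega>) \<partial>M)
      = (\<integral>\<^sup>+\<omega>. (\<integral>\<^sup>+s. semigroup (max 0 s) gn (Z (a \<omega>) \<omega>) * indicator {0..<\<delta>} s * indicator B \<omega> \<partial>lborel) \<partial>M)"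
    unfolding running_def by (subst nn_integral_multc[symmetric]) (auto intro!: nn_integral_cong)
  also have "\<dots> = (\<integral>\<^sup>+s. (\<integral>\<^sup>+\<omega>. semigroup (max 0 s) gn (Z (a \<omega>) \<omega>) * indicator {0..<\<delta>} s * indicator B \<omega> \<partial>M) \<partial>lborel)"
    by (rule ps.Fubini'[symmetric]) measurable
  also have "\<dots> = (\<integral>\<^sup>+s. (\<integral>\<^sup>+\<omega>. gn (Z (a \<omega> + max 0 s) \<omega>) * indicator {0..<\<delta>} s * indicator B \<omega> \<partial>M) \<partial>lborel)"
  proof (rule nn_integral_cong)
    fix s :: real
    have "(\<integral>\<^sup>+\<omega>\<in>B. semigroup (max 0 s) gn (Z (a \<omega>) \<omega>) \<partial>M) = (\<integral>\<^sup>+\<omega>\<in>B. gn (Z (a \<omega> + max 0 s) \<omega>) \<partial>M)"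
      unfolding a_def by (rule markov_nn_integral[OF st ge B fin, symmetric]) auto
    then show "(\<integral>\<^sup>+\<omega>. semigroup (max 0 s) gn (Z (a \<omega>) \<omega>) * indicator {0..<\<delta>} s * indicator B \<omega> \<partial>M)
        = (\<integral>\<^sup>+\<omega>. gn (Z (a \<omega> + max 0 s) \<omega>) * indicator {0..<\<delta>} s * indicator B \<omega> \<partial>M)"
      by (cases "s \<in> {0..<\<delta>}") auto
  qed
  also have "\<dots> = (\<integral>\<^sup>+\<omega>. (\<integral>\<^sup>+s. gn (Z (a \<omega> + max 0 s) \<omega>) * indicator {0..<\<delta>} s * indicator B \<omega> \<partial>lborel) \<partial>M)"
  proof (rule ps.Fubini')
    show "(\<lambda>(\<omega>, s). gn (Z (a \<omega> + max 0 s) \<omega>) * indicator {0..<\<delta>} s * indicator B \<omega>) \<in> borel_measurable (M \<Otimes>\<^sub>M lborel)"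
      by measurable
  qed
  also have "\<dots> = (\<integral>\<^sup>+\<omega>\<in>B. run_cost (a \<omega>) (a \<omega> + \<delta>) \<omega> \<partial>M)"
  proof (intro nn_integral_cong)
    fix \<omega> assume \<omega>: "\<omega> \<in> space M"
    have [measurable]: "(\<lambda>s. Z (max 0 s) \<omega>) \<in> borel_measurable borel" using \<omega> by measurable
    have "run_cost (a \<omega>) (a \<omega> + \<delta>) \<omega>
      = (\<integral>\<^sup>+s. gn (Z (max 0 (a \<omega> + 1 * s)) \<omega>) * indicator {a \<omega>..<a \<omega> + \<delta>} (a \<omega> + 1 * s) \<partial>lborel)"
      using nn_integral_real_affine[of "\<lambda>s. gn (Z (max 0 s) \<omega>) * indicator {a \<omega>..<a \<omega> + \<delta>} s" 1 "a \<omega>"] by simp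
    also have "\<dots> = (\<integral>\<^sup>+s\<in>{0..<\<delta>}. gn (Z (a \<omega> + max 0 s) \<omega>) \<partial>lborel)"
      by (intro nn_integral_cong) (use a0[of \<omega>] in \<open>auto split: split_indicator\<close>)
    finally show "(\<integral>\<^sup>+s. gn (Z (a \<omega> + max 0 s) \<omega>) * indicator {0..<\<delta>} s * indicator B \<omega> \<partial>lborel)
        = run_cost (a \<omega>) (a \<omega> + \<delta>) \<omega> * indicator B \<omega>"
      by (auto split: split_indicator)
  qed
  finally have 1: "(\<integral>\<^sup>+\<omega>\<in>B. running 0 \<delta> (Z (a \<omega>) \<omega>) \<partial>M)
      = (\<integral>\<^sup>+\<omega>\<in>B. run_cost (a \<omega>) (a \<omega> + \<delta>) \<omega> \<partial>M)" .
  have 2: "(\<integral>\<^sup>+\<omega>\<in>B. semigroup \<delta> w (Z (a \<omega>) \<omega>) \<partial>M) = (\<integral>\<^sup>+\<omega>\<in>B. w (Z (a \<omega> + \<delta>) \<omega>) \<partial>M)"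
    unfolding a_def by (rule markov_nn_integral[OF st ge B fin \<delta> w, symmetric])
  show ?thesis
    unfolding distrib_right by (subst (1 2) nn_integral_add) (auto simp: 1 2)
qed

end

lemma nn_integral_split_Ico:
  fixes f :: "real \<Rightarrow> ennreal"
  assumes [measurable]: "f \<in> borel_measurable borel" and "a \<le> b" "b \<le> c"
  shows "(\<integral>\<^sup>+s\<in>{a..<b}. f s \<partial>lborel) + (\<integral>\<^sup>+s\<in>{b..<c}. f s \<partial>lborel) = (\<integral>\<^sup>+s\<in>{a..<c}. f s \<partial>lborel)"
  by (subst nn_integral_add[symmetric], measurable, intro nn_integral_cong)
    (use assms(2,3) in \<open>auto split: split_indicator\<close>)

lemma nn_integral_consecutive:
  fixes f :: "real \<Rightarrow> ennreal"
  assumes "f \<in> borel_measurable borel" and "0 \<le> \<delta>"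
  shows "(\<Sum>k<n. \<integral>\<^sup>+s\<in>{a + \<delta> * real k..<a + \<delta> * real k + \<delta>}. f s \<partial>lborel) = (\<integral>\<^sup>+s\<in>{a..<a + \<delta> * real n}. f s \<partial>lborel)"
proof (induction n)
  case (Suc n)
  have "a + \<delta> * real n + \<delta> = a + \<delta> * real (Suc n)" by (simp add: distrib_left)
  then show ?case
    using nn_integral_split_Ico[OF assms(1), of a "a + \<delta> * real n" "a + \<delta> * real n + \<delta>"] assms(2)
    by (simp only: sum.lessThan_Suc Suc.IH) simp
qed simp

lemma less_nat_ceiling_iff: "k < nat \<lceil>x\<rceil> \<longleftrightarrow> real k < x"
  by (simp add: zless_nat_eq_int_zless less_ceiling_iff)

lemma real_nat_ceiling_le: "0 \<le> x \<Longrightarrow> real (nat \<lceil>x\<rceil>) \<le> x + 1"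
  using of_int_ceiling_le_add_one[of x] by simp

context impulse_restarted
begin

text \<open>
  The grid \<open>\<sigma>\<^sub>0 + k \<delta>\<close> starts at the beginning of the segment, so it consists of stopping times
  and all its steps have the deterministic length \<open>\<delta>\<close>. The one-step inequality holds on each
  event \<open>\<sigma>\<^sub>0 + k \<delta> < min R T\<close>, which belongs to the past at that grid time. Its sum over \<open>k\<close> telescopes up to the
  first grid time after the end of the segment.
\<close>

lemma segment_mesh:
  fixes m :: nat and T :: real
  assumes \<alpha>: "0 < \<alpha>" and st0: "stopping_time G \<sigma>\<^sub>0" and stR: "stopping_time G R"
    and R: "\<And>\<omega>. \<omega> \<in> space M \<Longrightarrow> \<sigma>\<^sub>0 \<omega> \<le> R \<omega>" and T: "0 \<le> T"
  defines "a \<equiv> \<lambda>\<omega>. enn2real (\<sigma>\<^sub>0 \<omega>)" and "r \<equiv> \<lambda>\<omega>. enn2real (min (R \<omega>) (ennreal T))"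
    and "A \<equiv> {\<omega>\<in>space M. \<sigma>\<^sub>0 \<omega> \<le> ennreal T}" and "\<delta> \<equiv> mesh m" and "v \<equiv> limit_value \<alpha>"
  shows "(\<integral>\<^sup>+\<omega>\<in>A. ennreal (v (Z (a \<omega>) \<omega>) + \<alpha> * least_value \<alpha> * (r \<omega> - a \<omega>)) \<partial>M)
    \<le> (\<integral>\<^sup>+\<omega>\<in>A. run_cost (a \<omega>) (r \<omega>) \<omega> \<partial>M)
      + (\<integral>\<^sup>+\<omega>\<in>A. ennreal (v (Z (max 0 (a \<omega> + \<delta> * real (nat \<lceil>(r \<omega> - a \<omega>) / \<delta>\<rceil>))) \<omega>)) \<partial>M)
      + ennreal (\<delta> * K + (T / \<delta> + 2) * ((\<alpha> * \<delta>)\<^sup>2 * least_value \<alpha>))"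
proof -
  define lam where "lam = \<alpha> * least_value \<alpha>"
  define err where "err = (\<alpha> * \<delta>)\<^sup>2 * least_value \<alpha>"
  define N where "N = nat \<lceil>T / \<delta>\<rceil> + 1"
  \<comment> \<open>The number of grid times that precede the end of the segment.\<close>
  define \<kappa> where "\<kappa> = (\<lambda>\<omega>. nat \<lceil>(r \<omega> - a \<omega>) / \<delta>\<rceil>)"
  define B where "B = (\<lambda>k. {\<omega>\<in>space M. \<sigma>\<^sub>0 \<omega> + ennreal (\<delta> * real k) < min (R \<omega>) (ennreal T)})"
  define \<tau> where "\<tau> = (\<lambda>k \<omega>. \<sigma>\<^sub>0 \<omega> + ennreal (\<delta> * real k))"
  have \<delta>: "0 < \<delta>" "0 \<le> \<delta>" unfolding \<delta>_def by (rule mesh)+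
  have lam0: "0 \<le> lam" and err0: "0 \<le> err" using \<alpha> least_value_nonneg[OF \<alpha>] by (auto simp: lam_def err_def)
  have v0: "0 \<le> v y" for y unfolding v_def by (rule limit_value_nonneg[OF \<alpha>])
  obtain b where b: "\<And>y. v y \<le> b" "0 \<le> b" unfolding v_def using limit_value_bounded[OF \<alpha>] by blast
  have [measurable]: "v \<in> borel_measurable borel" unfolding v_def by (rule limit_value_measurable[OF \<alpha>])
  have [measurable]: "\<sigma>\<^sub>0 \<in> borel_measurable M" "R \<in> borel_measurable M"
    using stopping_time_measurable st0 stR by auto
  have [measurable]: "a \<in> borel_measurable M" "r \<in> borel_measurable M" unfolding a_def r_def by measurable
  have [measurable]: "A \<in> sets M" "B k \<in> sets M" for k unfolding A_def B_def by measurable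
  have [measurable]: "\<kappa> \<in> M \<rightarrow>\<^sub>M count_space UNIV" unfolding \<kappa>_def by measurable
  have a0: "0 \<le> a \<omega>" for \<omega> by (simp add: a_def)
  have stmin: "stopping_time G (\<lambda>\<omega>. min (R \<omega>) (ennreal T))" by (intro stopping_time_min stR stopping_time_const)
  have st: "stopping_time G (\<tau> k)" for k
    unfolding \<tau>_def by (rule stopping_time_plus[OF flt.filtration_axioms st0]) (use \<delta> in simp)

  have real: "\<sigma>\<^sub>0 \<omega> = ennreal (a \<omega>)" "min (R \<omega>) (ennreal T) = ennreal (r \<omega>)" "a \<omega> \<le> r \<omega>" "r \<omega> \<le> T"
    if "\<omega> \<in> A" for \<omega>
  proof -
    have \<omega>: "\<omega> \<in> space M" "\<sigma>\<^sub>0 \<omega> \<le> ennreal T" using that by (auto simp: A_def)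
    show 1: "\<sigma>\<^sub>0 \<omega> = ennreal (a \<omega>)" unfolding a_def using \<omega>(2) by (simp add: le_less_trans[OF _ ennreal_less_top])
    show 2: "min (R \<omega>) (ennreal T) = ennreal (r \<omega>)"
      unfolding r_def by (simp add: min_less_iff_disj)
    have "ennreal (a \<omega>) \<le> ennreal (r \<omega>)" unfolding 1[symmetric] 2[symmetric] using R[OF \<omega>(1)] \<omega>(2) by simp
    then show "a \<omega> \<le> r \<omega>" by (simp add: r_def a_def)
    have "ennreal (r \<omega>) \<le> ennreal T" unfolding 2[symmetric] by simp
    then show "r \<omega> \<le> T" using T by simp
  qed
  have BA: "B k \<subseteq> A" for k
  proof
    fix \<omega> assume "\<omega> \<in> B k"
    then have "\<omega> \<in> space M" "\<sigma>\<^sub>0 \<omega> + ennreal (\<delta> * real k) < ennreal T" by (auto simp: B_def)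
    moreover have "\<sigma>\<^sub>0 \<omega> \<le> \<sigma>\<^sub>0 \<omega> + ennreal (\<delta> * real k)" by simp
    ultimately show "\<omega> \<in> A" unfolding A_def using le_less_trans less_imp_le by blast
  qed
  have Biff: "\<omega> \<in> B k \<longleftrightarrow> k < \<kappa> \<omega>" if "\<omega> \<in> A" for \<omega> k
  proof -
    have "\<omega> \<in> B k \<longleftrightarrow> ennreal (a \<omega> + \<delta> * real k) < ennreal (r \<omega>)"
      using that \<delta> a0[of \<omega>] unfolding B_def by (simp add: real(1)[OF that] real(2)[OF that, symmetric] A_def)
    also have "\<dots> \<longleftrightarrow> real k < (r \<omega> - a \<omega>) / \<delta>"
      using \<delta> a0[of \<omega>] by (subst ennreal_less_iff) (auto simp: field_simps)
    finally show ?thesis unfolding \<kappa>_def less_nat_ceiling_iff .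
  qed
  have \<kappa>N: "\<kappa> \<omega> \<le> N" if "\<omega> \<in> A" for \<omega>
  proof -
    have "(r \<omega> - a \<omega>) / \<delta> \<le> T / \<delta>" using real[OF that] a0[of \<omega>] \<delta> by (intro divide_right_mono) auto
    then have "nat \<lceil>(r \<omega> - a \<omega>) / \<delta>\<rceil> \<le> nat \<lceil>T / \<delta>\<rceil>" by (intro nat_mono ceiling_mono)
    then show ?thesis unfolding \<kappa>_def N_def by simp
  qed
  have \<kappa>1: "r \<omega> - a \<omega> \<le> \<delta> * real (\<kappa> \<omega>)" for \<omega>
    using \<delta> real_nat_ceiling_ge[of "(r \<omega> - a \<omega>) / \<delta>"] by (simp add: \<kappa>_def field_simps)
  have \<kappa>2: "\<delta> * real (\<kappa> \<omega>) \<le> r \<omega> - a \<omega> + \<delta>" if "\<omega> \<in> A" for \<omega>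
  proof -
    have "real (\<kappa> \<omega>) \<le> (r \<omega> - a \<omega>) / \<delta> + 1"
      unfolding \<kappa>_def using real(3)[OF that] \<delta> by (intro real_nat_ceiling_le) auto
    then show ?thesis using \<delta> by (simp add: field_simps)
  qed
  have Bsum: "(\<Sum>k<N. f k * indicator (B k) \<omega>) = (\<Sum>k<\<kappa> \<omega>. f k)" if "\<omega> \<in> A" for \<omega> and f :: "nat \<Rightarrow> ennreal"
  proof -
    have "(\<Sum>k<N. f k * indicator (B k) \<omega>) = (\<Sum>k<N. if k < \<kappa> \<omega> then f k else 0)"
      by (intro sum.cong) (auto simp: Biff[OF that] indicator_def)
    also have "\<dots> = (\<Sum>k<\<kappa> \<omega>. f k)"
      using \<kappa>N[OF that] by (subst sum.inter_filter[symmetric]) (auto intro!: sum.cong)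
    finally show ?thesis .
  qed

  let ?Z = "\<lambda>k \<omega>. Z (max 0 (a \<omega> + \<delta> * real k)) \<omega>"
  let ?g = "\<lambda>k \<omega>. run_cost (a \<omega> + \<delta> * real k) (a \<omega> + \<delta> * real k + \<delta>) \<omega>"
  let ?gr = "\<lambda>\<omega>. run_cost (a \<omega>) (r \<omega>) \<omega>"
  let ?end = "\<lambda>\<omega>. ennreal (v (?Z (\<kappa> \<omega>) \<omega>))"
  \<comment> \<open>The values at the ends of the steps occur on both sides; being finite, their sum is cancelled at the end.\<close>
  let ?D = "\<lambda>\<omega>. \<Sum>k<N. ennreal (v (?Z (Suc k) \<omega>)) * indicator (B k) \<omega>"
  let ?target = "\<lambda>\<omega>. ennreal (v (?Z 0 \<omega>) + lam * (r \<omega> - a \<omega>))"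
  have gm[measurable]: "?g k \<in> borel_measurable M" "?gr \<in> borel_measurable M" for k by measurable
  have endm[measurable]: "?end \<in> borel_measurable M" by measurable

  have step: "(\<integral>\<^sup>+\<omega>\<in>B k. ennreal (v (?Z k \<omega>) + lam * \<delta>) \<partial>M)
      \<le> (\<integral>\<^sup>+\<omega>\<in>B k. (?g k \<omega> + ennreal (v (?Z (Suc k) \<omega>)) + ennreal err) \<partial>M)" for k
  proof -
    have a\<tau>: "enn2real (\<tau> k \<omega>) = a \<omega> + \<delta> * real k" if "\<omega> \<in> B k" for \<omega>
    proof -
      have "\<omega> \<in> A" using that BA by blast
      then show ?thesis
        unfolding \<tau>_def real(1)[OF \<open>\<omega> \<in> A\<close>] using \<delta> a0[of \<omega>] by (simp add: ennreal_plus[symmetric] del: ennreal_plus)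
    qed
    have os: "(\<integral>\<^sup>+\<omega>\<in>B k. (running 0 \<delta> (Z (enn2real (\<tau> k \<omega>)) \<omega>) + semigroup \<delta> (\<lambda>y. ennreal (v y)) (Z (enn2real (\<tau> k \<omega>)) \<omega>)) \<partial>M)
      = (\<integral>\<^sup>+\<omega>\<in>B k. (run_cost (enn2real (\<tau> k \<omega>)) (enn2real (\<tau> k \<omega>) + \<delta>) \<omega>
        + ennreal (v (Z (enn2real (\<tau> k \<omega>) + \<delta>) \<omega>))) \<partial>M)"
    proof (rule one_step[OF st])
      show "\<sigma>\<^sub>0 \<omega> \<le> \<tau> k \<omega>" for \<omega> by (simp add: \<tau>_def)
      show "B k \<in> sets (flt.pre_sigma (\<tau> k))"
        using flt.stopping_time_less[OF st[of k] stmin]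
        unfolding Measurable.pred_def flt.space_pre_sigma B_def \<tau>_def by simp
      show "\<tau> k \<omega> < \<top>" if "\<omega> \<in> B k" for \<omega>
      proof -
        have "\<sigma>\<^sub>0 \<omega> + ennreal (\<delta> * real k) < ennreal T" using that by (simp add: B_def)
        then show ?thesis unfolding \<tau>_def by (rule less_trans) (rule ennreal_less_top)
      qed
    qed (use \<delta> in auto)
    have "(\<integral>\<^sup>+\<omega>\<in>B k. ennreal (v (?Z k \<omega>) + lam * \<delta>) \<partial>M)
      \<le> (\<integral>\<^sup>+\<omega>\<in>B k. (running 0 \<delta> (Z (enn2real (\<tau> k \<omega>)) \<omega>) + semigroup \<delta> (\<lambda>y. ennreal (v y)) (Z (enn2real (\<tau> k \<omega>)) \<omega>) + ennreal err) \<partial>M)"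
    proof (intro nn_integral_mono)
      fix \<omega>
      show "ennreal (v (?Z k \<omega>) + lam * \<delta>) * indicator (B k) \<omega> \<le> (running 0 \<delta> (Z (enn2real (\<tau> k \<omega>)) \<omega>) + semigroup \<delta> (\<lambda>y. ennreal (v y)) (Z (enn2real (\<tau> k \<omega>)) \<omega>) + ennreal err) * indicator (B k) \<omega>"
        using limit_value_submartingale[OF \<alpha>, of "?Z k \<omega>" m] a0[of \<omega>] \<delta>
        by (auto simp: a\<tau> v_def[symmetric] \<delta>_def[symmetric] err_def[symmetric] lam_def[symmetric] split: split_indicator)
    qed
    also have "\<dots> = (\<integral>\<^sup>+\<omega>\<in>B k. (running 0 \<delta> (Z (enn2real (\<tau> k \<omega>)) \<omega>) + semigroup \<delta> (\<lambda>y. ennreal (v y)) (Z (enn2real (\<tau> k \<omega>)) \<omega>)) \<partial>M) + (\<integral>\<^sup>+\<omega>\<in>B k. ennreal err \<partial>M)"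
    proof -
      have [measurable]: "semigroup \<delta> (\<lambda>y. ennreal (v y)) \<in> borel_measurable borel" by (rule semigroup_measurable) (use \<delta> in auto)
      have [measurable]: "\<tau> k \<in> borel_measurable M" by (rule stopping_time_measurable[OF st])
      have [measurable]: "(\<lambda>\<omega>. Z (enn2real (\<tau> k \<omega>)) \<omega>) \<in> borel_measurable M" by (rule Z_compose) auto
      show ?thesis by (subst nn_integral_add[symmetric]) (auto simp: distrib_right)
    qed
    also have "\<dots> = (\<integral>\<^sup>+\<omega>\<in>B k. (?g k \<omega> + ennreal (v (?Z (Suc k) \<omega>))) \<partial>M) + (\<integral>\<^sup>+\<omega>\<in>B k. ennreal err \<partial>M)"
    proof -
      have "max 0 (a \<omega> + \<delta> * real (Suc k)) = a \<omega> + \<delta> * real k + \<delta>" for \<omega>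
        using a0[of \<omega>] \<delta> by (simp add: algebra_simps)
      then show ?thesis
        unfolding os by (intro arg_cong2[where f="(+)"] nn_integral_cong refl) (auto simp: a\<tau> split: split_indicator)
    qed
    also have "\<dots> = (\<integral>\<^sup>+\<omega>\<in>B k. (?g k \<omega> + ennreal (v (?Z (Suc k) \<omega>)) + ennreal err) \<partial>M)"
      by (subst nn_integral_add[symmetric]) (auto simp: distrib_right)
    finally show ?thesis .
  qed

  have P1: "?target \<omega> + ?D \<omega> \<le> (\<Sum>k<N. ennreal (v (?Z k \<omega>) + lam * \<delta>) * indicator (B k) \<omega>) + ?end \<omega>" if "\<omega> \<in> A" for \<omega>
  proof -
    let ?\<kappa> = "\<kappa> \<omega>"
    have tel: "(\<Sum>k<n. v (?Z k \<omega>) + lam * \<delta>) + v (?Z n \<omega>) = v (?Z 0 \<omega>) + (\<Sum>k<n. v (?Z (Suc k) \<omega>)) + lam * (\<delta> * real n)" for n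
      by (induction n) (auto simp: algebra_simps)
    have "?target \<omega> + ?D \<omega> = ennreal (v (?Z 0 \<omega>) + lam * (r \<omega> - a \<omega>) + (\<Sum>k<?\<kappa>. v (?Z (Suc k) \<omega>)))"
      unfolding Bsum[OF that] using v0 lam0 real(3)[OF that]
      by (simp add: sum_ennreal ennreal_plus[symmetric] sum_nonneg del: ennreal_plus)
    also have "\<dots> \<le> ennreal ((\<Sum>k<?\<kappa>. v (?Z k \<omega>) + lam * \<delta>) + v (?Z ?\<kappa> \<omega>))"
      unfolding tel using mult_left_mono[OF \<kappa>1[of \<omega>] lam0] by (intro ennreal_leI) simp
    also have "\<dots> = (\<Sum>k<N. ennreal (v (?Z k \<omega>) + lam * \<delta>) * indicator (B k) \<omega>) + ?end \<omega>"
      unfolding Bsum[OF that] using v0 lam0 \<delta>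
      by (simp add: sum_ennreal ennreal_plus[symmetric] sum_nonneg del: ennreal_plus)
    finally show ?thesis .
  qed
  have P2: "(\<Sum>k<N. (?g k \<omega> + ennreal (v (?Z (Suc k) \<omega>)) + ennreal err) * indicator (B k) \<omega>)
      \<le> ?D \<omega> + (?gr \<omega> + ennreal (\<delta> * K + real N * err))" if "\<omega> \<in> A" for \<omega>
  proof -
    have [measurable]: "(\<lambda>s. Z (max 0 s) \<omega>) \<in> borel_measurable borel"
      using that by (auto simp: A_def)
    have "(\<Sum>k<\<kappa> \<omega>. ?g k \<omega>) = run_cost (a \<omega>) (a \<omega> + \<delta> * real (\<kappa> \<omega>)) \<omega>"
      by (rule nn_integral_consecutive[OF _ \<delta>(2)]) measurable
    also have "\<dots> \<le> (\<integral>\<^sup>+s. gn (Z (max 0 s) \<omega>) * indicator {a \<omega>..<r \<omega>} s + ennreal K * indicator {r \<omega>..<r \<omega> + \<delta>} s \<partial>lborel)"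
      using \<kappa>2[OF that] g_le by (intro nn_integral_mono) (auto split: split_indicator intro!: ennreal_leI)
    also have "\<dots> = ?gr \<omega> + ennreal K * ennreal \<delta>"
      using \<delta> by (subst nn_integral_add) (auto simp: nn_integral_cmult_indicator)
    also have "ennreal K * ennreal \<delta> = ennreal (\<delta> * K)" using \<delta> K_nonneg by (simp add: ennreal_mult'[symmetric] mult.commute)
    finally have 1: "(\<Sum>k<\<kappa> \<omega>. ?g k \<omega>) \<le> ?gr \<omega> + ennreal (\<delta> * K)" .
    have "(\<Sum>k<\<kappa> \<omega>. ennreal err) \<le> ennreal (real N * err)"
      using \<kappa>N[OF that] err0 by (simp add: sum_ennreal ennreal_of_nat_eq_real_of_nat ennreal_mult'[symmetric] mult_right_mono)
    with 1 have "(\<Sum>k<\<kappa> \<omega>. ?g k \<omega>) + (\<Sum>k<\<kappa> \<omega>. ennreal err) \<le> ?gr \<omega> + ennreal (\<delta> * K) + ennreal (real N * err)"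
      by (rule add_mono)
    moreover have "ennreal (\<delta> * K) + ennreal (real N * err) = ennreal (\<delta> * K + real N * err)"
      using \<delta> K_nonneg err0 by (intro ennreal_plus[symmetric]) auto
    ultimately have "(\<Sum>k<\<kappa> \<omega>. ?g k \<omega>) + (\<Sum>k<\<kappa> \<omega>. ennreal err) \<le> ?gr \<omega> + ennreal (\<delta> * K + real N * err)"
      by (simp only: add.assoc)
    from add_left_mono[OF this, of "?D \<omega>"] show ?thesis
      unfolding Bsum[OF that] sum.distrib by (simp only: add_ac)
  qed

  let ?e = "ennreal (\<delta> * K + real N * err)"
  have Dfin: "(\<integral>\<^sup>+\<omega>\<in>A. ?D \<omega> \<partial>M) \<noteq> \<top>"
  proof -
    have "(\<integral>\<^sup>+\<omega>\<in>A. ?D \<omega> \<partial>M) \<le> (\<integral>\<^sup>+\<omega>. (\<Sum>k<N. ennreal b) \<partial>M)"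
    proof (rule nn_integral_mono)
      fix \<omega>
      have "ennreal (v (?Z (Suc k) \<omega>)) * indicator (B k) \<omega> \<le> ennreal b" for k
        using b(1) by (auto split: split_indicator intro!: ennreal_leI)
      then have "?D \<omega> \<le> (\<Sum>k<N. ennreal b)" by (intro sum_mono)
      then show "?D \<omega> * indicator A \<omega> \<le> (\<Sum>k<N. ennreal b)" by (auto split: split_indicator)
    qed
    also have "\<dots> < \<top>" by (simp add: emeasure_space_1 ennreal_mult_less_top of_nat_less_top)
    finally show ?thesis by simp
  qed
  have "(\<integral>\<^sup>+\<omega>\<in>A. ?D \<omega> \<partial>M) + (\<integral>\<^sup>+\<omega>\<in>A. ?target \<omega> \<partial>M) = (\<integral>\<^sup>+\<omega>. ?D \<omega> * indicator A \<omega> + ?target \<omega> * indicator A \<omega> \<partial>M)"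
    by (rule nn_integral_add[symmetric]) measurable
  also have "\<dots> = (\<integral>\<^sup>+\<omega>. (?target \<omega> + ?D \<omega>) * indicator A \<omega> \<partial>M)"
    by (simp only: distrib_right add.commute)
  also have "\<dots> \<le> (\<integral>\<^sup>+\<omega>. (\<Sum>k<N. ennreal (v (?Z k \<omega>) + lam * \<delta>) * indicator (B k) \<omega>) + ?end \<omega> * indicator A \<omega> \<partial>M)"
    using P1 by (intro nn_integral_mono) (auto split: split_indicator)
  also have "\<dots> = (\<Sum>k<N. \<integral>\<^sup>+\<omega>\<in>B k. ennreal (v (?Z k \<omega>) + lam * \<delta>) \<partial>M) + (\<integral>\<^sup>+\<omega>\<in>A. ?end \<omega> \<partial>M)"
    by (subst nn_integral_add, measurable, subst nn_integral_sum) auto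
  also have "\<dots> \<le> (\<Sum>k<N. \<integral>\<^sup>+\<omega>\<in>B k. (?g k \<omega> + ennreal (v (?Z (Suc k) \<omega>)) + ennreal err) \<partial>M) + (\<integral>\<^sup>+\<omega>\<in>A. ?end \<omega> \<partial>M)"
    by (intro add_right_mono sum_mono step)
  also have "\<dots> = (\<integral>\<^sup>+\<omega>. (\<Sum>k<N. (?g k \<omega> + ennreal (v (?Z (Suc k) \<omega>)) + ennreal err) * indicator (B k) \<omega>) + ?end \<omega> * indicator A \<omega> \<partial>M)"
    by (subst nn_integral_add, measurable, subst nn_integral_sum) auto
  also have "\<dots> \<le> (\<integral>\<^sup>+\<omega>. ?D \<omega> * indicator A \<omega> + (?gr \<omega> * indicator A \<omega> + ?e + ?end \<omega> * indicator A \<omega>) \<partial>M)"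
  proof (intro nn_integral_mono)
    fix \<omega> assume "\<omega> \<in> space M"
    show "(\<Sum>k<N. (?g k \<omega> + ennreal (v (?Z (Suc k) \<omega>)) + ennreal err) * indicator (B k) \<omega>) + ?end \<omega> * indicator A \<omega>
      \<le> ?D \<omega> * indicator A \<omega> + (?gr \<omega> * indicator A \<omega> + ?e + ?end \<omega> * indicator A \<omega>)"
    proof (cases "\<omega> \<in> A")
      case True
      then show ?thesis using add_right_mono[OF P2[OF True], of "?end \<omega>"] by (simp add: add.assoc)
    next
      case False
      then have "\<omega> \<notin> B k" for k using BA by auto
      then show ?thesis using False by simp
    qed
  qed
  also have "\<dots> = (\<integral>\<^sup>+\<omega>\<in>A. ?D \<omega> \<partial>M) + ((\<integral>\<^sup>+\<omega>\<in>A. ?gr \<omega> \<partial>M) + ?e + (\<integral>\<^sup>+\<omega>\<in>A. ?end \<omega> \<partial>M))"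
    by (subst nn_integral_add, measurable, subst nn_integral_add, measurable, subst nn_integral_add, measurable)
      (simp add: emeasure_space_1)
  finally have "(\<integral>\<^sup>+\<omega>\<in>A. ?target \<omega> \<partial>M) \<le> (\<integral>\<^sup>+\<omega>\<in>A. ?gr \<omega> \<partial>M) + ?e + (\<integral>\<^sup>+\<omega>\<in>A. ?end \<omega> \<partial>M)"
    using Dfin by (simp add: ennreal_add_left_cancel_le)
  also have "\<dots> = (\<integral>\<^sup>+\<omega>\<in>A. ?gr \<omega> \<partial>M) + (\<integral>\<^sup>+\<omega>\<in>A. ?end \<omega> \<partial>M) + ?e" by (simp add: add_ac)
  also have "?e \<le> ennreal (\<delta> * K + (T / \<delta> + 2) * err)"
  proof (intro ennreal_leI add_left_mono mult_right_mono err0)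
    have "real (nat \<lceil>T / \<delta>\<rceil>) \<le> T / \<delta> + 1" using T \<delta> by (intro real_nat_ceiling_le) auto
    then show "real N \<le> T / \<delta> + 2" by (simp add: N_def)
  qed
  finally show ?thesis
    using a0 unfolding lam_def err_def \<kappa>_def by (simp add: add_left_mono)
qed

text \<open>
  As the mesh tends to 0, the first grid time after the end of the segment decreases to that end. Paths being
  right-continuous and \<open>v\<close> upper semicontinuous, the value at the end is at least the limit superior along
  the grid times; Fatou's lemma concludes.
\<close>

lemma segment_lower:
  fixes T :: real
  assumes \<alpha>: "0 < \<alpha>" and st0: "stopping_time G \<sigma>\<^sub>0" and stR: "stopping_time G R"
    and R: "\<And>\<omega>. \<omega> \<in> space M \<Longrightarrow> \<sigma>\<^sub>0 \<omega> \<le> R \<omega>" and T: "0 \<le> T"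
  defines "a \<equiv> \<lambda>\<omega>. enn2real (\<sigma>\<^sub>0 \<omega>)" and "r \<equiv> \<lambda>\<omega>. enn2real (min (R \<omega>) (ennreal T))"
    and "A \<equiv> {\<omega>\<in>space M. \<sigma>\<^sub>0 \<omega> \<le> ennreal T}" and "v \<equiv> limit_value \<alpha>"
  shows "(\<integral>\<^sup>+\<omega>\<in>A. ennreal (v (Z (a \<omega>) \<omega>) + \<alpha> * least_value \<alpha> * (r \<omega> - a \<omega>)) \<partial>M)
    \<le> (\<integral>\<^sup>+\<omega>\<in>A. run_cost (a \<omega>) (r \<omega>) \<omega> \<partial>M)
      + (\<integral>\<^sup>+\<omega>\<in>A. ennreal (v (Z (r \<omega>) \<omega>)) \<partial>M)"
    (is "?L \<le> ?G + ?U")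
proof (rule ennreal_le_epsilon)
  fix e :: real assume fin: "?G + ?U < \<top>" and e: "0 < e"
  define \<rho> where "\<rho> = (\<lambda>m \<omega>. max 0 (a \<omega> + mesh m * real (nat \<lceil>(r \<omega> - a \<omega>) / mesh m\<rceil>)))"
  define u where "u = (\<lambda>m \<omega>. ennreal (v (Z (\<rho> m \<omega>) \<omega>)) * indicator A \<omega>)"
  define err where "err = (\<lambda>m. mesh m * K + (T / mesh m + 2) * ((\<alpha> * mesh m)\<^sup>2 * least_value \<alpha>))"
  obtain b where b: "\<And>y. v y \<le> b" "0 \<le> b" unfolding v_def using limit_value_bounded[OF \<alpha>] by blast
  have [measurable]: "v \<in> borel_measurable borel" unfolding v_def by (rule limit_value_measurable[OF \<alpha>])
  have [measurable]: "\<sigma>\<^sub>0 \<in> borel_measurable M" "R \<in> borel_measurable M"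
    using stopping_time_measurable st0 stR by auto
  have [measurable]: "a \<in> borel_measurable M" "r \<in> borel_measurable M" unfolding a_def r_def by measurable
  have [measurable]: "A \<in> sets M" unfolding A_def by measurable
  have a0: "0 \<le> a \<omega>" "0 \<le> r \<omega>" for \<omega> by (auto simp: a_def r_def)
  have um[measurable]: "u m \<in> borel_measurable M" for m unfolding u_def \<rho>_def by measurable
  have mesh0: "mesh \<longlonglongrightarrow> 0" unfolding mesh_def by (rule LIMSEQ_power_zero) simp

  have lim: "limsup (\<lambda>m. u m \<omega>) \<le> ennreal (v (Z (r \<omega>) \<omega>)) * indicator A \<omega>" if \<omega>: "\<omega> \<in> space M" for \<omega>
  proof (cases "\<omega> \<in> A")
    case True
    then have \<sigma>T: "\<sigma>\<^sub>0 \<omega> \<le> ennreal T" by (simp add: A_def)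
    have ar: "a \<omega> \<le> r \<omega>"
      unfolding a_def r_def using R[OF \<omega>] \<sigma>T by (intro enn2real_mono) (auto simp: min_less_iff_disj)
    have \<rho>: "r \<omega> \<le> \<rho> m \<omega>" "\<rho> m \<omega> \<le> r \<omega> + mesh m" for m
    proof -
      let ?x = "(r \<omega> - a \<omega>) / mesh m"
      have x: "mesh m * ?x = r \<omega> - a \<omega>" using mesh(1)[of m] by simp
      have "mesh m * ?x \<le> mesh m * real (nat \<lceil>?x\<rceil>)"
        by (rule mult_left_mono[OF real_nat_ceiling_ge mesh(3)])
      then show "r \<omega> \<le> \<rho> m \<omega>" unfolding x \<rho>_def by simp
      have "mesh m * real (nat \<lceil>?x\<rceil>) \<le> mesh m * (?x + 1)"
        using ar mesh(1)[of m] by (intro mult_left_mono[OF real_nat_ceiling_le mesh(3)]) simp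
      then show "\<rho> m \<omega> \<le> r \<omega> + mesh m"
        using a0[of \<omega>] mesh(3)[of m] x unfolding \<rho>_def by (simp add: distrib_left)
    qed
    have "(\<lambda>m. r \<omega> + mesh m) \<longlonglongrightarrow> r \<omega> + 0" by (intro tendsto_add tendsto_const mesh0)
    then have \<rho>lim: "(\<lambda>m. \<rho> m \<omega>) \<longlonglongrightarrow> r \<omega>"
      using tendsto_sandwich[of "\<lambda>_. r \<omega>" "\<lambda>m. \<rho> m \<omega>" sequentially "\<lambda>m. r \<omega> + mesh m" "r \<omega>"] \<rho>
      by simp
    have "((\<lambda>s. Z s \<omega>) \<longlongrightarrow> Z (r \<omega>) \<omega>) (at (r \<omega>) within {r \<omega>..})"
      using Z_right_continuous[OF \<omega> a0(2)] by (simp add: at_within_Ici_at_right)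
    then have "((\<lambda>s. Z s \<omega>) \<longlongrightarrow> Z (r \<omega>) \<omega>) (inf (nhds (r \<omega>)) (principal {r \<omega>..}))"
      using tendsto_at_within_iff_tendsto_nhds[of "\<lambda>s. Z s \<omega>" "r \<omega>" "{r \<omega>..}"] by simp
    moreover have "filterlim (\<lambda>m. \<rho> m \<omega>) (inf (nhds (r \<omega>)) (principal {r \<omega>..})) sequentially"
      using \<rho>lim \<rho>(1) by (simp add: filterlim_inf filterlim_principal)
    ultimately have Zlim: "(\<lambda>m. Z (\<rho> m \<omega>) \<omega>) \<longlonglongrightarrow> Z (r \<omega>) \<omega>" by (rule filterlim_compose)
    show ?thesis
    proof (subst Limsup_le_iff, intro allI impI)
      fix y assume "ennreal (v (Z (r \<omega>) \<omega>)) * indicator A \<omega> < y"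
      then obtain z where z: "ennreal (v (Z (r \<omega>) \<omega>)) < z" "z < y" using dense True by auto
      then obtain q where q: "z = ennreal q" "0 \<le> q" by (cases z) auto
      have "v (Z (r \<omega>) \<omega>) < q" using z(1) q limit_value_nonneg[OF \<alpha>] unfolding v_def by (simp add: ennreal_less_iff)
      from eventually_compose_filterlim[OF limit_value_usc[OF \<alpha> this[unfolded v_def]] Zlim]
      show "\<forall>\<^sub>F m in sequentially. u m \<omega> < y"
      proof (rule eventually_mono)
        fix m assume "limit_value \<alpha> (Z (\<rho> m \<omega>) \<omega>) < q"
        then have "u m \<omega> \<le> z" unfolding u_def v_def q using True by (simp add: ennreal_leI)
        then show "u m \<omega> < y" using z(2) by simp
      qed
    qed
  next
    case False
    then show ?thesis by (simp add: u_def Limsup_const)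
  qed
  have "limsup (\<lambda>m. integral\<^sup>N M (u m)) \<le> (\<integral>\<^sup>+\<omega>. limsup (\<lambda>m. u m \<omega>) \<partial>M)"
  proof (rule nn_integral_limsup[where w="\<lambda>_. ennreal b"])
    show "AE \<omega> in M. u m \<omega> \<le> ennreal b" for m
      using b(1) by (intro AE_I2) (auto simp: u_def split: split_indicator intro!: ennreal_leI)
  qed (auto simp: emeasure_space_1)
  also have "\<dots> \<le> ?U" by (intro nn_integral_mono lim)
  also have "?U < ?U + ennreal (e / 2)"
    using fin e ennreal_add_left_cancel_less[of ?U 0 "ennreal (e / 2)"] by auto
  finally have 1: "\<forall>\<^sub>F m in sequentially. integral\<^sup>N M (u m) < ?U + ennreal (e / 2)"
    by (rule Limsup_lessD)
  have "err m = mesh m * (K + T * \<alpha>\<^sup>2 * least_value \<alpha> + 2 * \<alpha>\<^sup>2 * least_value \<alpha> * mesh m)" for m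
  proof -
    have "(T / mesh m + 2) * (\<alpha> * mesh m)\<^sup>2 = T * \<alpha>\<^sup>2 * (mesh m / mesh m) * mesh m + 2 * \<alpha>\<^sup>2 * mesh m * mesh m"
      by (simp add: power2_eq_square algebra_simps)
    also have "\<dots> = mesh m * (T * \<alpha>\<^sup>2 + 2 * \<alpha>\<^sup>2 * mesh m)"
      using mesh(1)[of m] by (simp add: algebra_simps)
    finally have "(T / mesh m + 2) * ((\<alpha> * mesh m)\<^sup>2 * least_value \<alpha>)
      = mesh m * (T * \<alpha>\<^sup>2 + 2 * \<alpha>\<^sup>2 * mesh m) * least_value \<alpha>" by (simp add: mult.assoc[symmetric])
    then show ?thesis unfolding err_def by (simp add: algebra_simps)
  qed
  moreover have "(\<lambda>m. mesh m * (K + T * \<alpha>\<^sup>2 * least_value \<alpha> + 2 * \<alpha>\<^sup>2 * least_value \<alpha> * mesh m))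
      \<longlonglongrightarrow> 0 * (K + T * \<alpha>\<^sup>2 * least_value \<alpha> + 2 * \<alpha>\<^sup>2 * least_value \<alpha> * 0)"
    by (intro tendsto_intros mesh0)
  ultimately have "(\<lambda>m. err m) \<longlonglongrightarrow> 0" by (simp only: mult_zero_left)
  then have 2: "\<forall>\<^sub>F m in sequentially. err m < e / 2" by (rule order_tendstoD(2)) (use e in simp)
  obtain m where m: "integral\<^sup>N M (u m) < ?U + ennreal (e / 2)" "err m < e / 2"
    using eventually_conj[OF 1 2] by (auto simp: eventually_sequentially)
  have "?L \<le> ?G + integral\<^sup>N M (u m) + ennreal (err m)"
    unfolding u_def \<rho>_def err_def a_def r_def A_def v_def
    by (rule segment_mesh[OF \<alpha> st0 stR R T])
  also have "\<dots> \<le> ?G + (?U + ennreal (e / 2)) + ennreal (e / 2)"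
    using m by (intro add_mono order_refl ennreal_leI) auto
  also have "\<dots> = ?G + ?U + ennreal e"
    using e by (simp add: add.assoc ennreal_plus[symmetric] del: ennreal_plus)
  finally show "?L \<le> ?G + ?U + ennreal e" .
qed

end

section \<open>The controlled process and its expected cost\<close>

context standard_process
begin

lemma space_product_space: "space (product_space F) = (\<Pi>\<^sub>E j\<in>{1..}. \<Omega>)"
  by (simp add: product_space_def space_PiM space_F)

lemma standard_filtration: "filtration \<Omega> F" by unfold_locales

lemma filtration_product: "filtration (space (product_space F)) (product_filtration F i)"
  by (rule filtration_product_filtration[OF standard_filtration])

lemma space_product_filtration: "space (product_filtration F i t) = space (product_space F)"
  by (simp add: product_filtration_def)

lemma restrict_product: "(\<lambda>\<omega>. restrict \<omega> {1..i}) \<in> space (product_space F) \<rightarrow> space (\<Pi>\<^sub>M j\<in>{1..i}. F t)"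
  by (auto simp: product_space_def space_PiM space_F PiE_iff)

lemma component_measurable:
  assumes "j \<in> {1..i}"
  shows "(\<lambda>\<omega>. \<omega> j) \<in> product_filtration F i t \<rightarrow>\<^sub>M F t"
proof -
  have "(\<lambda>\<omega>. restrict \<omega> {1..i}) \<in> product_filtration F i t \<rightarrow>\<^sub>M (\<Pi>\<^sub>M j\<in>{1..i}. F t)"
    unfolding product_filtration_def by (rule measurable_vimage_algebra1[OF restrict_product])
  from measurable_compose[OF this measurable_component_singleton[OF assms]] assms show ?thesis by simp
qed

text \<open>
  The \<open>i\<close>-th product filtration is generated by the first \<open>i\<close> coordinates.
\<close>

lemma sets_product_filtration_subset:
  assumes m: "\<And>j. j \<in> {1..i} \<Longrightarrow> (\<lambda>\<omega>. \<omega> j) \<in> N \<rightarrow>\<^sub>M F t" and sp: "space N = space (product_space F)"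
  shows "sets (product_filtration F i t) \<subseteq> sets N"
proof -
  have "(\<lambda>\<omega>. restrict \<omega> {1..i}) \<in> N \<rightarrow>\<^sub>M (\<Pi>\<^sub>M j\<in>{1..i}. F t)"
    by (rule measurable_restrict) (rule m)
  from measurable_sets[OF this] show ?thesis
    unfolding product_filtration_def sets_vimage_algebra2[OF restrict_product] by (auto simp: sp)
qed

lemma product_filtration_mono: "i \<le> j \<Longrightarrow> sets (product_filtration F i t) \<subseteq> sets (product_filtration F j t)"
  by (rule sets_product_filtration_subset) (auto simp: space_product_filtration intro: component_measurable)

lemma product_filtration_le_space: "sets (product_filtration F i t) \<subseteq> sets (product_space F)"
proof (rule sets_product_filtration_subset)
  fix j assume "j \<in> {1..i}"
  then have "(\<lambda>\<omega>. \<omega> j) \<in> product_space F \<rightarrow>\<^sub>M F \<top>"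
    unfolding product_space_def by (intro measurable_component_singleton) auto
  then show "(\<lambda>\<omega>. \<omega> j) \<in> product_space F \<rightarrow>\<^sub>M F t"
    using sets_F_mono[of t \<top>] by (auto simp: measurable_def space_F)
qed simp

lemma stopping_time_product_mono:
  assumes "i \<le> j" "stopping_time (product_filtration F i) \<sigma>"
  shows "stopping_time (product_filtration F j) \<sigma>"
  using assms product_filtration_mono[OF assms(1)]
  by (auto simp: stopping_time_def Measurable.pred_def space_product_filtration)

end

locale controlled_problem = impulse_problem \<Omega> F X P g c K c\<^sub>0 c\<^sub>1
  for \<Omega> :: "'w set" and F :: "ennreal \<Rightarrow> 'w measure"
    and X :: "real \<Rightarrow> 'w \<Rightarrow> 'e::polish_space" and P :: "'e \<Rightarrow> 'w measure"
    and g :: "'e \<Rightarrow> real" and c :: "'e \<Rightarrow> 'e \<Rightarrow> real" and K c\<^sub>0 c\<^sub>1 :: real +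
  fixes x :: 'e and V :: "('w, 'e) strategy" and Q :: "(nat \<Rightarrow> 'w) measure"
  assumes strategy: "V \<in> strategies F" and law: "controlled_law F X P x V Q"
begin

abbreviation \<tau> :: "nat \<Rightarrow> (nat \<Rightarrow> 'w) \<Rightarrow> ennreal" where "\<tau> \<equiv> impulse_time V"

text \<open>
  Segment \<open>i\<close> lives on coordinate \<open>i + 1\<close> and lasts from \<open>\<tau> i\<close> to \<open>\<tau> (i + 1)\<close>.
\<close>

abbreviation segment :: "nat \<Rightarrow> real \<Rightarrow> (nat \<Rightarrow> 'w) \<Rightarrow> 'e" where
  "segment i t \<omega> \<equiv> X t (\<omega> (Suc i))"

abbreviation run_cost :: "nat \<Rightarrow> real \<Rightarrow> real \<Rightarrow> (nat \<Rightarrow> 'w) \<Rightarrow> ennreal" where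
  "run_cost i a b \<omega> \<equiv> \<integral>\<^sup>+s\<in>{a..<b}. gn (X (max 0 s) (\<omega> (Suc i))) \<partial>lborel"

abbreviation Y :: "real \<Rightarrow> (nat \<Rightarrow> 'w) \<Rightarrow> 'e" where
  "Y s \<omega> \<equiv> controlled_process X V (max 0 s) \<omega>"

lemma Q_prob: "prob_space Q" and sets_Q: "sets Q = sets (product_space F)"
  using law by (auto simp: controlled_law_def)

lemma space_Q: "space Q = space (product_space F)"
  by (rule sets_eq_imp_space_eq[OF sets_Q])

lemma coordinate: "\<omega> \<in> space Q \<Longrightarrow> \<omega> (Suc i) \<in> \<Omega>"
  unfolding space_Q space_product_space by auto

lemma coordinate_measurable: "(\<lambda>\<omega>. \<omega> (Suc i)) \<in> Q \<rightarrow>\<^sub>M F \<top>"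
proof -
  have "(\<lambda>\<omega>. \<omega> (Suc i)) \<in> product_space F \<rightarrow>\<^sub>M F \<top>"
    unfolding product_space_def by (intro measurable_component_singleton) auto
  then show ?thesis using measurable_cong_sets[OF sets_Q refl] by blast
qed

lemma impulse_time_unfold: "\<tau> (Suc i) = fst V (Suc i)" "\<tau> 0 = (\<lambda>_. 0)"
  by (auto simp: impulse_time_def)

lemma impulse_time_stopping: "stopping_time (product_filtration F (Suc i)) (\<tau> (Suc i))"
  using strategy unfolding impulse_time_unfold by (auto simp: strategies_def)

text \<open>
  The start of a segment, seen in the filtration in which the segment itself is adapted.
\<close>

lemma impulse_time_stopping': "stopping_time (product_filtration F (Suc i)) (\<tau> i)"
proof (cases i)
  case 0
  then show ?thesis unfolding impulse_time_unfold by (simp add: stopping_time_const impulse_time_unfold)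
next
  case (Suc j)
  then show ?thesis using stopping_time_product_mono[OF _ impulse_time_stopping[of j], of "Suc i"] by simp
qed

lemma impulse_time_Suc: "\<omega> \<in> space Q \<Longrightarrow> \<tau> i \<omega> \<le> \<tau> (Suc i) \<omega>"
  using strategy unfolding space_Q by (cases i) (auto simp: strategies_def impulse_time_def)

lemma impulse_time_mono: "\<omega> \<in> space Q \<Longrightarrow> i \<le> j \<Longrightarrow> \<tau> i \<omega> \<le> \<tau> j \<omega>"
  by (rule lift_Suc_mono_le[of "\<lambda>i. \<tau> i \<omega>"]) (auto intro: impulse_time_Suc)

lemma impulse_time_0: "\<tau> 0 \<omega> = 0" by (simp add: impulse_time_def)

lemma segment_restarted:
  "impulse_restarted \<Omega> F X P g c K c\<^sub>0 c\<^sub>1 Q (product_filtration F (Suc i)) (\<tau> i) (segment i)"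
proof (intro impulse_restarted.intro restarted_process.intro restarted_process_axioms.intro)
  show "impulse_problem \<Omega> F X P g c K c\<^sub>0 c\<^sub>1" by unfold_locales
  show "standard_process \<Omega> F X P" by unfold_locales
  show "filtration (space Q) (product_filtration F (Suc i))" unfolding space_Q by (rule filtration_product)
  show "sets (product_filtration F (Suc i) t) \<subseteq> sets Q" for t
    unfolding sets_Q by (rule product_filtration_le_space)
  show "segment i t \<in> borel_measurable Q" if "0 \<le> t" for t
    by (rule measurable_compose[OF coordinate_measurable measurable_X_top[OF that]])
  show "((\<lambda>s. segment i s \<omega>) \<longlongrightarrow> segment i t \<omega>) (at_right t)" if "\<omega> \<in> space Q" "0 \<le> t" for \<omega> t
    by (rule paths_right_continuous[OF coordinate[OF that(1)] that(2)])
  show "strong_markov_from Q (product_filtration F (Suc i)) (transition X P) (\<tau> i) (segment i)"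
    using law by (auto simp: controlled_law_def)
qed (rule Q_prob)

lemma restart: "AE \<omega> in Q. \<tau> i \<omega> < \<top> \<longrightarrow> segment i (enn2real (\<tau> i \<omega>)) \<omega> = restart_state x V i \<omega>"
  using law by (auto simp: controlled_law_def)

lemma segment_measurable [measurable]: "(\<lambda>(t, \<omega>). X (max 0 t) (\<omega> (Suc i))) \<in> borel_measurable (borel \<Otimes>\<^sub>M Q)"
proof -
  interpret r: impulse_restarted \<Omega> F X P g c K c\<^sub>0 c\<^sub>1 Q "product_filtration F (Suc i)" "\<tau> i" "segment i"
    by (rule segment_restarted)
  show ?thesis by (rule r.Z_jointly_measurable)
qed

lemma impulse_time_measurable [measurable]: "\<tau> i \<in> borel_measurable Q"
  using restarted_process.stopping_time_measurable[OF impulse_restarted.axioms(2)[OF segment_restarted] impulse_time_stopping'] .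

text \<open>
  Here and below the index \<open>i\<close> refers to the impulse that ends segment \<open>i\<close>, which is impulse number \<open>i + 1\<close>.
\<close>

definition impulse_at :: "nat \<Rightarrow> (nat \<Rightarrow> 'w) \<Rightarrow> real" where
  "impulse_at i \<omega> = enn2real (\<tau> (Suc i) \<omega>)"

definition impulse_cost :: "nat \<Rightarrow> (nat \<Rightarrow> 'w) \<Rightarrow> ennreal" where
  "impulse_cost i \<omega> = ennreal (c (segment i (impulse_at i \<omega>) \<omega>) (segment (Suc i) (impulse_at i \<omega>) \<omega>))"

lemma impulse_at_measurable [measurable]: "impulse_at i \<in> borel_measurable Q"
  unfolding impulse_at_def[abs_def] by measurable

lemma impulse_at_nonneg: "max 0 (impulse_at i \<omega>) = impulse_at i \<omega>" by (simp add: impulse_at_def)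

lemma impulse_cost_measurable [measurable]: "impulse_cost i \<in> borel_measurable Q"
proof -
  have "(\<lambda>\<omega>. c (X (max 0 (impulse_at i \<omega>)) (\<omega> (Suc i))) (X (max 0 (impulse_at i \<omega>)) (\<omega> (Suc (Suc i))))) \<in> borel_measurable Q"
    using measurable_compose[OF measurable_Pair c_measurable, of "\<lambda>\<omega>. X (max 0 (impulse_at i \<omega>)) (\<omega> (Suc i))" Q "\<lambda>\<omega>. X (max 0 (impulse_at i \<omega>)) (\<omega> (Suc (Suc i)))"]
    by simp
  then show ?thesis unfolding impulse_cost_def[abs_def] impulse_at_nonneg by measurable
qed

definition active :: "nat \<Rightarrow> real \<Rightarrow> (nat \<Rightarrow> 'w) \<Rightarrow> bool" where
  "active i t \<omega> \<longleftrightarrow> \<tau> i \<omega> \<le> ennreal t \<and> ennreal t < \<tau> (Suc i) \<omega>"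

lemma active_unique: "\<omega> \<in> space Q \<Longrightarrow> active i t \<omega> \<Longrightarrow> active j t \<omega> \<Longrightarrow> i = j"
proof (induction i j rule: linorder_wlog)
  case (le i j)
  show ?case
  proof (rule ccontr)
    assume "i \<noteq> j"
    then have "\<tau> (Suc i) \<omega> \<le> \<tau> j \<omega>" using le by (intro impulse_time_mono) auto
    then show False using le(3,4) unfolding active_def by auto
  qed
qed auto

lemma controlled_process_active:
  assumes "\<omega> \<in> space Q" "active i t \<omega>"
  shows "controlled_process X V t \<omega> = segment i t \<omega>"
proof -
  let ?act = "\<lambda>i. 1 \<le> i \<and> \<tau> (i - 1) \<omega> \<le> ennreal t \<and> ennreal t < \<tau> i \<omega>"
  have ex: "?act (Suc i)" using assms(2) by (simp add: active_def)
  have "(THE i. ?act i) = Suc i"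
  proof (rule the_equality[of ?act, OF ex])
    fix j assume j: "?act j"
    then have "active (j - 1) t \<omega>" by (simp add: active_def)
    from active_unique[OF assms(1) this assms(2)] j show "j = Suc i" by (cases j) auto
  qed
  then show ?thesis unfolding controlled_process_def Let_def using ex by auto
qed

lemma controlled_process_inactive:
  assumes "\<And>i. \<not> active i t \<omega>"
  shows "controlled_process X V t \<omega> = segment 0 t \<omega>"
proof -
  have "\<not> (1 \<le> i \<and> \<tau> (i - 1) \<omega> \<le> ennreal t \<and> ennreal t < \<tau> i \<omega>)" for i
    using assms[of "i - 1"] by (cases i) (auto simp: active_def)
  then show ?thesis unfolding controlled_process_def Let_def by auto
qed

text \<open>
  The active coordinate is a measurable function of time and sample point with countably many values; after
  the accumulation point of the impulse times the first coordinate stands in.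
\<close>

lemma controlled_process_measurable [measurable]:
  "(\<lambda>(t, \<omega>). controlled_process X V (max 0 t) \<omega>) \<in> borel_measurable (borel \<Otimes>\<^sub>M Q)"
proof -
  define k where "k = (\<lambda>x. if \<exists>i. active i (max 0 (fst x)) (snd x) then LEAST i. active i (max 0 (fst x)) (snd x) else 0)"
  have [measurable]: "Measurable.pred (borel \<Otimes>\<^sub>M Q) (\<lambda>x. active i (max 0 (fst x)) (snd x))" for i
    unfolding active_def by measurable
  have [measurable]: "k \<in> borel \<Otimes>\<^sub>M Q \<rightarrow>\<^sub>M count_space UNIV" unfolding k_def by measurable
  have "(\<lambda>x. X (max 0 (fst x)) (snd x (Suc (k x)))) \<in> borel_measurable (borel \<Otimes>\<^sub>M Q)"
    by (rule measurable_compose_countable[where f="\<lambda>i x. X (max 0 (fst x)) (snd x (Suc i))" and g=k]) measurable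
  moreover have "X (max 0 (fst x)) (snd x (Suc (k x))) = controlled_process X V (max 0 (fst x)) (snd x)"
    if "x \<in> space (borel \<Otimes>\<^sub>M Q)" for x
  proof (cases "\<exists>i. active i (max 0 (fst x)) (snd x)")
    case True
    have "snd x \<in> space Q" using that by (auto simp: space_pair_measure)
    moreover have "active (k x) (max 0 (fst x)) (snd x)" unfolding k_def using True by (auto intro: LeastI)
    ultimately show ?thesis by (simp add: controlled_process_active)
  next
    case False
    then show ?thesis by (simp add: k_def controlled_process_inactive)
  qed
  ultimately have "(\<lambda>x. controlled_process X V (max 0 (fst x)) (snd x)) \<in> borel_measurable (borel \<Otimes>\<^sub>M Q)"
    by (rule subst[OF measurable_cong, rotated])
  then show ?thesis by (simp add: case_prod_beta')
qed

text \<open>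
  The expected cost when the cost at time \<open>s\<close> is weighted with \<open>h s\<close>. Being linear in \<open>h\<close>, it allows to
  pass from intervals \<open>[0, T]\<close> to discount functions by mixing.
\<close>

definition total_cost :: "(real \<Rightarrow> ennreal) \<Rightarrow> ennreal" where
  "total_cost h = (\<integral>\<^sup>+\<omega>. ((\<integral>\<^sup>+s\<in>{0..}. h s * gn (Y s \<omega>) \<partial>lborel)
     + (\<Sum>i. if \<tau> (Suc i) \<omega> < \<top> then h (impulse_at i \<omega>) * impulse_cost i \<omega> else 0)) \<partial>Q)"

end

section \<open>A lower bound for every strategy\<close>

lemma sum_at_most_one_le:
  fixes f :: "nat \<Rightarrow> ennreal"
  assumes "\<And>i j. f i \<noteq> 0 \<Longrightarrow> f j \<noteq> 0 \<Longrightarrow> i = j" "\<And>i. f i \<le> B"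
  shows "(\<Sum>i<n. f i) \<le> B"
proof (cases "\<exists>i<n. f i \<noteq> 0")
  case True
  then obtain i where i: "i < n" "f i \<noteq> 0" by blast
  have z: "f j = 0" if "j \<noteq> i" for j using assms(1)[OF i(2)] that by blast
  have "(\<Sum>i<n. f i) = (\<Sum>j\<in>{i}. f j)"
    by (rule sum.mono_neutral_right) (use i z in auto)
  then show ?thesis using assms(2) by simp
qed simp

context controlled_problem
begin

lemma total_cost_eq:
  "total_cost (indicator {0..T}) =
    (\<integral>\<^sup>+\<omega>. (\<integral>\<^sup>+s\<in>{0..T}. gn (Y s \<omega>) \<partial>lborel)
      + (\<Sum>i. if \<tau> (Suc i) \<omega> \<le> ennreal T then impulse_cost i \<omega> else 0) \<partial>Q)" if T: "0 \<le> T"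
proof -
  have "(if \<tau> (Suc i) \<omega> < \<top> then indicator {0..T} (impulse_at i \<omega>) * impulse_cost i \<omega> else 0)
      = (if \<tau> (Suc i) \<omega> \<le> ennreal T then impulse_cost i \<omega> else 0)" for i \<omega>
    using T by (cases "\<tau> (Suc i) \<omega>") (auto simp: impulse_at_def top_unique split: split_indicator)
  moreover have "(\<integral>\<^sup>+s\<in>{0..}. indicator {0..T} s * gn (Y s \<omega>) \<partial>lborel)
      = (\<integral>\<^sup>+s\<in>{0..T}. gn (Y s \<omega>) \<partial>lborel)" for \<omega>
    by (intro nn_integral_cong) (auto split: split_indicator)
  ultimately show ?thesis unfolding total_cost_def by (simp cong: if_cong)
qed

text \<open>
  The segment inequalities are chained by \<open>v y \<le> c y \<xi> + v \<xi>\<close> at the impulses. After \<open>n\<close> segments they account for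
  the time \<open>min (\<tau> n) T\<close>. If the total cost is finite then, each impulse costing at least \<open>c\<^sub>0\<close>, the probability of \<open>n\<close>
  impulses before \<open>T\<close> is of order \<open>1 / n\<close>, so no time is lost in the limit.
\<close>

lemma total_cost_lower:
  assumes \<alpha>: "0 < \<alpha>" and T: "0 \<le> T" and b: "\<And>y. limit_value \<alpha> y \<le> b" "0 \<le> b"
  shows "ennreal (\<alpha> * least_value \<alpha> * T) \<le> total_cost (indicator {0..T}) + ennreal (2 * b)"
proof -
  interpret prob_space Q by (rule Q_prob)
  define v where "v = limit_value \<alpha>"
  define lam where "lam = \<alpha> * least_value \<alpha>"
  \<comment> \<open>Truncation at \<open>T\<close> makes all segments after the horizon empty.\<close>
  define t where "t = (\<lambda>i \<omega>. enn2real (min (\<tau> i \<omega>) (ennreal T)))"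
  define a where "a = (\<lambda>i \<omega>. enn2real (\<tau> i \<omega>))"
  define A where "A = (\<lambda>i. {\<omega>\<in>space Q. \<tau> i \<omega> \<le> ennreal T})"
  define E where "E = (\<lambda>i. \<integral>\<^sup>+\<omega>\<in>A i. ennreal (v (segment i (a i \<omega>) \<omega>)) \<partial>Q)"
  define G where "G = (\<lambda>i \<omega>. \<integral>\<^sup>+s\<in>{a i \<omega>..<t (Suc i) \<omega>}. gn (segment i (max 0 s) \<omega>) \<partial>lborel)"
  have lam0: "0 \<le> lam" using \<alpha> least_value_nonneg[OF \<alpha>] by (simp add: lam_def)
  have v0: "0 \<le> v y" for y unfolding v_def by (rule limit_value_nonneg[OF \<alpha>])
  have vb: "v y \<le> b" for y using b(1) by (simp add: v_def)
  have [measurable]: "v \<in> borel_measurable borel" unfolding v_def by (rule limit_value_measurable[OF \<alpha>])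
  have tm[measurable]: "t i \<in> borel_measurable Q" and am[measurable]: "a i \<in> borel_measurable Q" for i
    unfolding t_def a_def by measurable
  have Am[measurable]: "A i \<in> sets Q" for i unfolding A_def by measurable
  have a0: "max 0 (a i \<omega>) = a i \<omega>" and t0: "max 0 (t i \<omega>) = t i \<omega>" for i \<omega> by (auto simp: a_def t_def)
  have sm: "(\<lambda>\<omega>. segment i (max 0 (a j \<omega>)) \<omega>) \<in> borel_measurable Q"
      "(\<lambda>\<omega>. segment i (max 0 (t j \<omega>)) \<omega>) \<in> borel_measurable Q" for i j by measurable
  note [measurable] = sm[unfolded a0 t0]
  have Gm[measurable]: "G i \<in> borel_measurable Q" for i
  proof -
    interpret r: impulse_restarted \<Omega> F X P g c K c\<^sub>0 c\<^sub>1 Q "product_filtration F (Suc i)" "\<tau> i" "segment i"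
      by (rule segment_restarted)
    show ?thesis unfolding G_def by (rule r.running_cost_measurable) measurable
  qed
  have tA: "t i \<omega> = a i \<omega>" if "\<omega> \<in> A i" for i \<omega>
    using that by (simp add: A_def t_def a_def min_absorb1)
  have tnA: "t i \<omega> = T" if "\<omega> \<in> space Q - A i" for i \<omega>
  proof -
    have "ennreal T \<le> \<tau> i \<omega>" using that by (auto simp: A_def)
    then show ?thesis using T by (simp add: t_def min_absorb2)
  qed
  have AA: "A (Suc i) \<subseteq> A i" for i unfolding A_def by (auto dest: impulse_time_Suc order_trans)
  have tmono: "t i \<omega> \<le> t (Suc i) \<omega>" if "\<omega> \<in> space Q" for i \<omega>
    unfolding t_def using impulse_time_Suc[OF that, of i]
    by (intro enn2real_mono min.mono order_refl) (auto simp: min_less_iff_disj)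

  have seg: "(\<integral>\<^sup>+\<omega>\<in>A i. ennreal (v (segment i (a i \<omega>) \<omega>) + lam * (t (Suc i) \<omega> - a i \<omega>)) \<partial>Q)
      \<le> (\<integral>\<^sup>+\<omega>\<in>A i. G i \<omega> \<partial>Q) + (\<integral>\<^sup>+\<omega>\<in>A i. ennreal (v (segment i (t (Suc i) \<omega>) \<omega>)) \<partial>Q)" for i
  proof -
    interpret r: impulse_restarted \<Omega> F X P g c K c\<^sub>0 c\<^sub>1 Q "product_filtration F (Suc i)" "\<tau> i" "segment i"
      by (rule segment_restarted)
    show ?thesis
      using r.segment_lower[OF \<alpha> impulse_time_stopping' impulse_time_stopping impulse_time_Suc T]
      unfolding A_def G_def lam_def v_def a_def t_def .
  qed

  have step: "E i + (\<integral>\<^sup>+\<omega>. ennreal (lam * (t (Suc i) \<omega> - t i \<omega>)) \<partial>Q)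
      \<le> (\<integral>\<^sup>+\<omega>. G i \<omega> * indicator (A i) \<omega> + impulse_cost i \<omega> * indicator (A (Suc i)) \<omega> \<partial>Q) + E (Suc i)
        + (\<integral>\<^sup>+\<omega>. ennreal b * indicator (A i - A (Suc i)) \<omega> \<partial>Q)" for i
  proof -
    have "E i + (\<integral>\<^sup>+\<omega>. ennreal (lam * (t (Suc i) \<omega> - t i \<omega>)) \<partial>Q)
        = (\<integral>\<^sup>+\<omega>. ennreal (v (segment i (a i \<omega>) \<omega>)) * indicator (A i) \<omega> + ennreal (lam * (t (Suc i) \<omega> - t i \<omega>)) \<partial>Q)"
      unfolding E_def by (rule nn_integral_add[symmetric]) measurable
    also have "\<dots> = (\<integral>\<^sup>+\<omega>\<in>A i. ennreal (v (segment i (a i \<omega>) \<omega>) + lam * (t (Suc i) \<omega> - a i \<omega>)) \<partial>Q)"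
    proof (rule nn_integral_cong)
      fix \<omega> assume \<omega>: "\<omega> \<in> space Q"
      show "ennreal (v (segment i (a i \<omega>) \<omega>)) * indicator (A i) \<omega> + ennreal (lam * (t (Suc i) \<omega> - t i \<omega>))
        = ennreal (v (segment i (a i \<omega>) \<omega>) + lam * (t (Suc i) \<omega> - a i \<omega>)) * indicator (A i) \<omega>"
      proof (cases "\<omega> \<in> A i")
        case True
        then show ?thesis using tmono[OF \<omega>, of i] v0 lam0 by (simp add: tA[OF True])
      next
        case False
        then have "t i \<omega> = T" "t (Suc i) \<omega> = T" using tnA[of \<omega> i] tnA[of \<omega> "Suc i"] AA[of i] \<omega> by auto
        then show ?thesis using False by simp
      qed
    qed
    also have "\<dots> \<le> (\<integral>\<^sup>+\<omega>\<in>A i. G i \<omega> \<partial>Q) + (\<integral>\<^sup>+\<omega>\<in>A i. ennreal (v (segment i (t (Suc i) \<omega>) \<omega>)) \<partial>Q)"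
      by (rule seg)
    also have "(\<integral>\<^sup>+\<omega>\<in>A i. ennreal (v (segment i (t (Suc i) \<omega>) \<omega>)) \<partial>Q)
      \<le> (\<integral>\<^sup>+\<omega>. (impulse_cost i \<omega> + ennreal (v (segment (Suc i) (a (Suc i) \<omega>) \<omega>))) * indicator (A (Suc i)) \<omega>
          + ennreal b * indicator (A i - A (Suc i)) \<omega> \<partial>Q)"
    proof (rule nn_integral_mono)
      fix \<omega>
      show "ennreal (v (segment i (t (Suc i) \<omega>) \<omega>)) * indicator (A i) \<omega>
        \<le> (impulse_cost i \<omega> + ennreal (v (segment (Suc i) (a (Suc i) \<omega>) \<omega>))) * indicator (A (Suc i)) \<omega>
          + ennreal b * indicator (A i - A (Suc i)) \<omega>"
      proof (cases "\<omega> \<in> A (Suc i)")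
        case True
        have s: "t (Suc i) \<omega> = impulse_at i \<omega>" "a (Suc i) \<omega> = impulse_at i \<omega>"
          using tA[OF True] by (auto simp: impulse_at_def a_def)
        have "v (segment i (impulse_at i \<omega>) \<omega>) \<le> c (segment i (impulse_at i \<omega>) \<omega>) (segment (Suc i) (impulse_at i \<omega>) \<omega>)
            + v (segment (Suc i) (impulse_at i \<omega>) \<omega>)" unfolding v_def by (rule limit_value_le_cost[OF \<alpha>])
        then have "ennreal (v (segment i (impulse_at i \<omega>) \<omega>)) \<le> impulse_cost i \<omega> + ennreal (v (segment (Suc i) (impulse_at i \<omega>) \<omega>))"
          unfolding impulse_cost_def using v0 less_imp_le[OF less_le_trans[OF c0_pos c_lower]]
          by (simp add: ennreal_plus[symmetric] ennreal_leI del: ennreal_plus)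
        then show ?thesis using True AA[of i] unfolding s by auto
      next
        case False
        then show ?thesis using vb by (auto split: split_indicator intro: ennreal_leI)
      qed
    qed
    also have "\<dots> = (\<integral>\<^sup>+\<omega>\<in>A (Suc i). impulse_cost i \<omega> \<partial>Q) + E (Suc i) + (\<integral>\<^sup>+\<omega>. ennreal b * indicator (A i - A (Suc i)) \<omega> \<partial>Q)"
      unfolding E_def distrib_right by (subst nn_integral_add, measurable, subst nn_integral_add, measurable)
    finally have "E i + (\<integral>\<^sup>+\<omega>. ennreal (lam * (t (Suc i) \<omega> - t i \<omega>)) \<partial>Q)
      \<le> (\<integral>\<^sup>+\<omega>\<in>A i. G i \<omega> \<partial>Q) + ((\<integral>\<^sup>+\<omega>\<in>A (Suc i). impulse_cost i \<omega> \<partial>Q) + E (Suc i)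
        + (\<integral>\<^sup>+\<omega>. ennreal b * indicator (A i - A (Suc i)) \<omega> \<partial>Q))" by (simp add: add_left_mono)
    also have "\<dots> = ((\<integral>\<^sup>+\<omega>\<in>A i. G i \<omega> \<partial>Q) + (\<integral>\<^sup>+\<omega>\<in>A (Suc i). impulse_cost i \<omega> \<partial>Q)) + E (Suc i)
        + (\<integral>\<^sup>+\<omega>. ennreal b * indicator (A i - A (Suc i)) \<omega> \<partial>Q)" by (simp only: add.assoc)
    also have "(\<integral>\<^sup>+\<omega>\<in>A i. G i \<omega> \<partial>Q) + (\<integral>\<^sup>+\<omega>\<in>A (Suc i). impulse_cost i \<omega> \<partial>Q)
        = (\<integral>\<^sup>+\<omega>. G i \<omega> * indicator (A i) \<omega> + impulse_cost i \<omega> * indicator (A (Suc i)) \<omega> \<partial>Q)"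
      by (rule nn_integral_add[symmetric]) measurable
    finally show ?thesis .
  qed

  let ?C = "\<lambda>i \<omega>. G i \<omega> * indicator (A i) \<omega> + impulse_cost i \<omega> * indicator (A (Suc i)) \<omega>"
  have Efin: "E i \<noteq> \<top>" for i
  proof -
    have "E i \<le> (\<integral>\<^sup>+\<omega>. ennreal b \<partial>Q)"
      unfolding E_def using vb by (intro nn_integral_mono) (auto split: split_indicator intro: ennreal_leI)
    then show ?thesis by (auto simp: emeasure_space_1 top_unique)
  qed
  have ind: "E 0 + (\<integral>\<^sup>+\<omega>. ennreal (lam * t n \<omega>) \<partial>Q)
      \<le> (\<integral>\<^sup>+\<omega>. (\<Sum>i<n. ?C i \<omega>) \<partial>Q) + E n + (\<integral>\<^sup>+\<omega>. ennreal b * indicator (space Q - A n) \<omega> \<partial>Q)" for n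
  proof (induction n)
    case 0
    have "t 0 \<omega> = 0" for \<omega> by (simp add: t_def impulse_time_0)
    then show ?case by simp
  next
    case (Suc n)
    let ?d = "\<lambda>n. \<integral>\<^sup>+\<omega>. ennreal b * indicator (space Q - A n) \<omega> \<partial>Q"
    have lt: "(\<integral>\<^sup>+\<omega>. ennreal (lam * t (Suc n) \<omega>) \<partial>Q) = (\<integral>\<^sup>+\<omega>. ennreal (lam * t n \<omega>) \<partial>Q) + (\<integral>\<^sup>+\<omega>. ennreal (lam * (t (Suc n) \<omega> - t n \<omega>)) \<partial>Q)"
    proof (subst nn_integral_add[symmetric])
      show "(\<integral>\<^sup>+\<omega>. ennreal (lam * t (Suc n) \<omega>) \<partial>Q) = (\<integral>\<^sup>+\<omega>. ennreal (lam * t n \<omega>) + ennreal (lam * (t (Suc n) \<omega> - t n \<omega>)) \<partial>Q)"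
      proof (rule nn_integral_cong)
        fix \<omega> assume "\<omega> \<in> space Q"
        then have "0 \<le> lam * t n \<omega>" "0 \<le> lam * (t (Suc n) \<omega> - t n \<omega>)"
          using tmono[of \<omega> n] lam0 by (simp_all add: t_def)
        then show "ennreal (lam * t (Suc n) \<omega>) = ennreal (lam * t n \<omega>) + ennreal (lam * (t (Suc n) \<omega> - t n \<omega>))"
          by (simp add: ennreal_plus[symmetric] right_diff_distrib del: ennreal_plus)
      qed
    qed measurable
    have bt: "?d (Suc n) = ?d n + (\<integral>\<^sup>+\<omega>. ennreal b * indicator (A n - A (Suc n)) \<omega> \<partial>Q)"
    proof (subst nn_integral_add[symmetric])
      show "?d (Suc n) = (\<integral>\<^sup>+\<omega>. ennreal b * indicator (space Q - A n) \<omega> + ennreal b * indicator (A n - A (Suc n)) \<omega> \<partial>Q)"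
        using AA[of n] by (intro nn_integral_cong) (auto split: split_indicator)
    qed measurable
    have ct: "(\<integral>\<^sup>+\<omega>. (\<Sum>i<Suc n. ?C i \<omega>) \<partial>Q) = (\<integral>\<^sup>+\<omega>. (\<Sum>i<n. ?C i \<omega>) \<partial>Q) + (\<integral>\<^sup>+\<omega>. ?C n \<omega> \<partial>Q)"
      unfolding sum.lessThan_Suc by (rule nn_integral_add) measurable
    have "E n + (E 0 + (\<integral>\<^sup>+\<omega>. ennreal (lam * t (Suc n) \<omega>) \<partial>Q))
        = (E 0 + (\<integral>\<^sup>+\<omega>. ennreal (lam * t n \<omega>) \<partial>Q)) + (E n + (\<integral>\<^sup>+\<omega>. ennreal (lam * (t (Suc n) \<omega> - t n \<omega>)) \<partial>Q))"
      unfolding lt by (simp only: add_ac)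
    also have "\<dots> \<le> ((\<integral>\<^sup>+\<omega>. (\<Sum>i<n. ?C i \<omega>) \<partial>Q) + E n + ?d n)
        + ((\<integral>\<^sup>+\<omega>. ?C n \<omega> \<partial>Q) + E (Suc n) + (\<integral>\<^sup>+\<omega>. ennreal b * indicator (A n - A (Suc n)) \<omega> \<partial>Q))"
      by (rule add_mono[OF Suc.IH step])
    also have "\<dots> = E n + ((\<integral>\<^sup>+\<omega>. (\<Sum>i<Suc n. ?C i \<omega>) \<partial>Q) + E (Suc n) + ?d (Suc n))"
      unfolding bt ct by (simp only: add_ac)
    finally show ?case using Efin by (simp only: ennreal_add_left_cancel_le) simp
  qed

  have Csum: "(\<Sum>i<n. ?C i \<omega>) \<le> (\<integral>\<^sup>+s\<in>{0..T}. gn (Y s \<omega>) \<partial>lborel)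
      + (\<Sum>i. if \<tau> (Suc i) \<omega> \<le> ennreal T then impulse_cost i \<omega> else 0)" if \<omega>: "\<omega> \<in> space Q" for \<omega> n
    unfolding sum.distrib
  proof (rule add_mono)
    have [measurable]: "(\<lambda>s. segment i (max 0 s) \<omega>) \<in> borel_measurable borel" for i
      using measurable_compose[OF measurable_Pair2'[OF \<omega>] segment_measurable[of i]] by simp
    let ?f = "\<lambda>i s. gn (segment i (max 0 s) \<omega>) * indicator {a i \<omega>..<t (Suc i) \<omega>} s"
    have "G i \<omega> * indicator (A i) \<omega> = (\<integral>\<^sup>+s. ?f i s * indicator (A i) \<omega> \<partial>lborel)" for i
      unfolding G_def by (rule nn_integral_multc[symmetric]) measurable
    then have "(\<Sum>i<n. G i \<omega> * indicator (A i) \<omega>) = (\<Sum>i<n. \<integral>\<^sup>+s. ?f i s * indicator (A i) \<omega> \<partial>lborel)" by simp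
    also have "\<dots> = (\<integral>\<^sup>+s. (\<Sum>i<n. ?f i s * indicator (A i) \<omega>) \<partial>lborel)"
      by (rule nn_integral_sum[symmetric]) measurable
    also have "\<dots> \<le> (\<integral>\<^sup>+s\<in>{0..T}. gn (Y s \<omega>) \<partial>lborel)"
    proof (rule nn_integral_mono)
      fix s :: real
      have *: "active i s \<omega> \<and> 0 \<le> s \<and> s \<le> T" if "a i \<omega> \<le> s" "s < t (Suc i) \<omega>" "\<omega> \<in> A i" for i
      proof -
        have s0: "0 \<le> s" using that(1) a0[of i \<omega>] by linarith
        have "\<tau> i \<omega> \<noteq> \<top>" using that(3) by (auto simp: A_def top_unique)
        then have "\<tau> i \<omega> = ennreal (a i \<omega>)" by (simp add: a_def less_top)
        then have 1: "\<tau> i \<omega> \<le> ennreal s" using that(1) by (simp add: ennreal_leI)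
        have "min (\<tau> (Suc i) \<omega>) (ennreal T) = ennreal (t (Suc i) \<omega>)" unfolding t_def by (simp add: min_less_iff_disj)
        moreover have "ennreal s < ennreal (t (Suc i) \<omega>)" using that(2) s0 by (simp add: ennreal_less_iff)
        ultimately have "ennreal s < min (\<tau> (Suc i) \<omega>) (ennreal T)" by simp
        then have "ennreal s < \<tau> (Suc i) \<omega>" "ennreal s < ennreal T" by simp_all
        then show ?thesis using 1 s0 by (auto simp: active_def ennreal_less_iff)
      qed
      show "(\<Sum>i<n. gn (segment i (max 0 s) \<omega>) * indicator {a i \<omega>..<t (Suc i) \<omega>} s * indicator (A i) \<omega>)
          \<le> gn (Y s \<omega>) * indicator {0..T} s"
      proof (rule sum_at_most_one_le)
        fix i j
        assume "gn (segment i (max 0 s) \<omega>) * indicator {a i \<omega>..<t (Suc i) \<omega>} s * indicator (A i) \<omega> \<noteq> 0"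
          "gn (segment j (max 0 s) \<omega>) * indicator {a j \<omega>..<t (Suc j) \<omega>} s * indicator (A j) \<omega> \<noteq> 0"
        then have "active i s \<omega>" "active j s \<omega>" using *[of i] *[of j] by (auto split: split_indicator_asm)
        then show "i = j" by (rule active_unique[OF \<omega>])
      next
        fix i
        show "gn (segment i (max 0 s) \<omega>) * indicator {a i \<omega>..<t (Suc i) \<omega>} s * indicator (A i) \<omega>
          \<le> gn (Y s \<omega>) * indicator {0..T} s"
          using *[of i] controlled_process_active[OF \<omega>, of i s] by (auto split: split_indicator simp: max_absorb2)
      qed
    qed
    finally show "(\<Sum>i<n. G i \<omega> * indicator (A i) \<omega>) \<le> (\<integral>\<^sup>+s\<in>{0..T}. gn (Y s \<omega>) \<partial>lborel)" .
    have "(\<Sum>i<n. impulse_cost i \<omega> * indicator (A (Suc i)) \<omega>)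
        = (\<Sum>i<n. if \<tau> (Suc i) \<omega> \<le> ennreal T then impulse_cost i \<omega> else 0)"
      using \<omega> by (intro sum.cong) (auto simp: A_def split: split_indicator)
    also have "\<dots> \<le> (\<Sum>i. if \<tau> (Suc i) \<omega> \<le> ennreal T then impulse_cost i \<omega> else 0)"
      by (rule sum_le_suminf) auto
    finally show "(\<Sum>i<n. impulse_cost i \<omega> * indicator (A (Suc i)) \<omega>)
      \<le> (\<Sum>i. if \<tau> (Suc i) \<omega> \<le> ennreal T then impulse_cost i \<omega> else 0)" .
  qed
  let ?tot = "total_cost (indicator {0..T})"
  have Ctot: "(\<integral>\<^sup>+\<omega>. (\<Sum>i<n. ?C i \<omega>) \<partial>Q) \<le> ?tot" for n
    unfolding total_cost_eq[OF T] by (intro nn_integral_mono Csum)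
  have Eb: "E n + (\<integral>\<^sup>+\<omega>. ennreal b * indicator (space Q - A n) \<omega> \<partial>Q) \<le> ennreal (2 * b)" for n
  proof -
    have "E n + (\<integral>\<^sup>+\<omega>. ennreal b * indicator (space Q - A n) \<omega> \<partial>Q) \<le> (\<integral>\<^sup>+\<omega>. ennreal b \<partial>Q) + (\<integral>\<^sup>+\<omega>. ennreal b \<partial>Q)"
      unfolding E_def using vb by (intro add_mono nn_integral_mono) (auto split: split_indicator intro: ennreal_leI)
    also have "\<dots> = ennreal (2 * b)" using b(2) by (simp add: emeasure_space_1 ennreal_plus[symmetric] del: ennreal_plus)
    finally show ?thesis .
  qed
  have main: "(\<integral>\<^sup>+\<omega>. ennreal (lam * t n \<omega>) \<partial>Q) \<le> ?tot + ennreal (2 * b)" for n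
  proof -
    have "(\<integral>\<^sup>+\<omega>. ennreal (lam * t n \<omega>) \<partial>Q) \<le> E 0 + (\<integral>\<^sup>+\<omega>. ennreal (lam * t n \<omega>) \<partial>Q)" by simp
    also note ind[of n]
    also have "(\<integral>\<^sup>+\<omega>. (\<Sum>i<n. ?C i \<omega>) \<partial>Q) + E n + (\<integral>\<^sup>+\<omega>. ennreal b * indicator (space Q - A n) \<omega> \<partial>Q)
        \<le> ?tot + ennreal (2 * b)"
      unfolding add.assoc by (rule add_mono[OF Ctot Eb])
    finally show ?thesis .
  qed
  \<comment> \<open>If the impulse \<open>n\<close> occurs by time \<open>T\<close>, so do all earlier ones.\<close>
  have many: "ennreal (real n * c\<^sub>0 * measure Q (A n)) \<le> ?tot" for n
  proof -
    have "ennreal (real n * c\<^sub>0 * measure Q (A n)) = (\<integral>\<^sup>+\<omega>. ennreal (real n * c\<^sub>0) * indicator (A n) \<omega> \<partial>Q)"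
      using c0_pos by (simp add: nn_integral_cmult_indicator emeasure_eq_measure ennreal_mult')
    also have "\<dots> \<le> (\<integral>\<^sup>+\<omega>. (\<Sum>i<n. ?C i \<omega>) \<partial>Q)"
    proof (rule nn_integral_mono)
      fix \<omega>
      show "ennreal (real n * c\<^sub>0) * indicator (A n) \<omega> \<le> (\<Sum>i<n. ?C i \<omega>)"
      proof (cases "\<omega> \<in> A n")
        case True
        have "\<omega> \<in> A j" if "j \<le> n" for j
          using that True lift_Suc_antimono_le[of A j n, OF AA] by auto
        then have "ennreal c\<^sub>0 \<le> ?C i \<omega>" if "i < n" for i
          using that c_lower by (auto simp: impulse_cost_def intro!: add_increasing ennreal_leI)
        then have "(\<Sum>i<n. ennreal c\<^sub>0) \<le> (\<Sum>i<n. ?C i \<omega>)" by (intro sum_mono) auto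
        then show ?thesis using True c0_pos by (simp add: ennreal_mult' ennreal_of_nat_eq_real_of_nat)
      qed simp
    qed
    also note Ctot
    finally show ?thesis .
  qed
  show ?thesis
  proof (cases "?tot = \<top>")
    case False
    then obtain C where C: "?tot = ennreal C" "0 \<le> C" by (cases ?tot) auto
    have "lam * T \<le> C + 2 * b + lam * T * (C / c\<^sub>0) * (1 / real n)" if n: "0 < n" for n
    proof -
      have "real n * c\<^sub>0 * measure Q (A n) \<le> C" using many[of n] C by (simp add: C(1))
      then have p: "measure Q (A n) \<le> C / c\<^sub>0 * (1 / real n)" using n c0_pos by (simp add: field_simps)
      have "ennreal (lam * T) = (\<integral>\<^sup>+\<omega>. ennreal (lam * T) \<partial>Q)" by (simp add: emeasure_space_1)
      also have "\<dots> \<le> (\<integral>\<^sup>+\<omega>. ennreal (lam * t n \<omega>) + ennreal (lam * T) * indicator (A n) \<omega> \<partial>Q)"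
        by (rule nn_integral_mono) (auto simp: tnA split: split_indicator)
      also have "\<dots> = (\<integral>\<^sup>+\<omega>. ennreal (lam * t n \<omega>) \<partial>Q) + ennreal (lam * T) * measure Q (A n)"
        by (subst nn_integral_add, measurable) (simp add: nn_integral_cmult_indicator emeasure_eq_measure)
      also have "\<dots> \<le> (?tot + ennreal (2 * b)) + ennreal (lam * T) * measure Q (A n)"
        by (intro add_right_mono main)
      also have "\<dots> = ennreal (C + 2 * b + lam * T * measure Q (A n))"
        using C(2) b(2) lam0 T by (simp add: C(1) ennreal_mult'[symmetric] ennreal_plus[symmetric] del: ennreal_plus)
      finally have "lam * T \<le> C + 2 * b + lam * T * measure Q (A n)"
        using C(2) b(2) lam0 T by (simp add: ennreal_le_iff add_nonneg_nonneg del: ennreal_plus)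
      also have "\<dots> \<le> C + 2 * b + lam * T * (C / c\<^sub>0 * (1 / real n))"
        using lam0 T by (intro add_left_mono mult_left_mono p) simp
      finally show ?thesis by (simp only: mult.assoc)
    qed
    moreover have "(\<lambda>n. C + 2 * b + lam * T * (C / c\<^sub>0) * (1 / real n)) \<longlonglongrightarrow> C + 2 * b + lam * T * (C / c\<^sub>0) * 0"
      by (intro tendsto_intros lim_1_over_n)
    ultimately have "lam * T \<le> C + 2 * b + lam * T * (C / c\<^sub>0) * 0"
      by (intro LIMSEQ_le_const[OF _ exI[of _ 1]]) auto
    then have "ennreal (lam * T) \<le> ennreal (C + 2 * b)" by (intro ennreal_leI) simp
    then show ?thesis using C b(2) unfolding lam_def by (simp add: C(1))
  qed simp
qed

end

section \<open>A nearly optimal feedback strategy\<close>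

context standard_process
begin

text \<open>
  Impulses take place at the first grid time, strictly after the preceding impulse, at which the active
  coordinate is in \<open>S\<close>. An infimum over the empty set is \<open>\<infinity>\<close>: no further impulse.
\<close>

primrec grid_time :: "real \<Rightarrow> 'e set \<Rightarrow> nat \<Rightarrow> (nat \<Rightarrow> 'w) \<Rightarrow> ennreal" where
  "grid_time \<delta> S 0 \<omega> = 0"
| "grid_time \<delta> S (Suc i) \<omega> =
    (INF k\<in>{k. grid_time \<delta> S i \<omega> < ennreal (\<delta> * real k) \<and> X (\<delta> * real k) (\<omega> (Suc i)) \<in> S}. ennreal (\<delta> * real k))"

text \<open>
  The target is a function of the state just before the impulse, which is the state of coordinate \<open>i\<close>. On
  \<open>{\<tau> i = \<infinity>}\<close> the value is arbitrary; here time \<open>enn2real \<infinity> = 0\<close> enters.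
\<close>

definition grid_strategy :: "real \<Rightarrow> 'e set \<Rightarrow> ('e \<Rightarrow> 'e) \<Rightarrow> ('w, 'e) strategy" where
  "grid_strategy \<delta> S sel = (grid_time \<delta> S, \<lambda>i \<omega>. sel (X (enn2real (grid_time \<delta> S i \<omega>)) (\<omega> i)))"

context
  fixes \<delta> :: real and S :: "'e set"
  assumes \<delta>: "0 < \<delta>" and S[measurable]: "S \<in> sets borel"
begin

lemma grid_time_le:
  assumes "grid_time \<delta> S i \<omega> < ennreal (\<delta> * real k)" "X (\<delta> * real k) (\<omega> (Suc i)) \<in> S"
  shows "grid_time \<delta> S (Suc i) \<omega> \<le> ennreal (\<delta> * real k)"
  using assms by (auto intro: INF_lower)

lemma grid_time_attained:
  assumes "grid_time \<delta> S (Suc i) \<omega> < \<top>"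
  obtains k where "grid_time \<delta> S (Suc i) \<omega> = ennreal (\<delta> * real k)" "grid_time \<delta> S i \<omega> < ennreal (\<delta> * real k)"
    "X (\<delta> * real k) (\<omega> (Suc i)) \<in> S"
proof -
  define I where "I = {k. grid_time \<delta> S i \<omega> < ennreal (\<delta> * real k) \<and> X (\<delta> * real k) (\<omega> (Suc i)) \<in> S}"
  have eq: "grid_time \<delta> S (Suc i) \<omega> = (INF k\<in>I. ennreal (\<delta> * real k))" by (simp add: I_def)
  have "I \<noteq> {}" using assms unfolding eq by auto
  then obtain j where "j \<in> I" by blast
  define k where "k = (LEAST k. k \<in> I)"
  have k: "k \<in> I" unfolding k_def by (rule LeastI[of _ j]) (rule \<open>j \<in> I\<close>)
  have "(INF k\<in>I. ennreal (\<delta> * real k)) = ennreal (\<delta> * real k)"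
  proof (rule antisym[OF INF_lower[OF k] INF_greatest])
    fix m assume "m \<in> I"
    then have "k \<le> m" unfolding k_def by (rule Least_le)
    then show "ennreal (\<delta> * real k) \<le> ennreal (\<delta> * real m)" using \<delta> by (intro ennreal_leI) simp
  qed
  then show ?thesis using that[of k] k eq unfolding I_def by auto
qed

lemma grid_time_less: "grid_time \<delta> S i \<omega> < \<top> \<Longrightarrow> grid_time \<delta> S i \<omega> < grid_time \<delta> S (Suc i) \<omega>"
  using grid_time_attained[of i \<omega>] less_top by metis

lemma grid_time_mono: "grid_time \<delta> S i \<omega> \<le> grid_time \<delta> S (Suc i) \<omega>"
  using grid_time_attained[of i \<omega>] less_top top_greatest less_imp_le by metis

lemma grid_time_on_grid: "grid_time \<delta> S i \<omega> < \<top> \<Longrightarrow> \<exists>k. grid_time \<delta> S i \<omega> = ennreal (\<delta> * real k)"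
proof (cases i)
  case 0 then show ?thesis by (intro exI[of _ 0]) simp
qed (auto elim: grid_time_attained simp del: grid_time.simps)

lemma pred_product_mono:
  assumes "Measurable.pred (product_filtration F i s) Pr" "s \<le> t"
  shows "Measurable.pred (product_filtration F i t) Pr"
  using assms filtration.sets_F_mono[OF filtration_product[of i] assms(2)]
  by (auto simp: Measurable.pred_def space_product_filtration)

lemma state_measurable:
  assumes "0 \<le> s" "ennreal s \<le> t" "j \<in> {1..i}"
  shows "(\<lambda>\<omega>. X s (\<omega> j)) \<in> product_filtration F i t \<rightarrow>\<^sub>M borel"
proof -
  have "X s \<in> F t \<rightarrow>\<^sub>M borel"
    using adapted[OF assms(1)] sets_F_mono[OF assms(2)] by (auto simp: measurable_def space_F)
  from measurable_compose[OF component_measurable[OF assms(3)] this] show ?thesis .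
qed

text \<open>
  Only grid times up to \<open>t\<close> matter for \<open>{\<tau> i \<le> t}\<close>, and there are countably many of them.
\<close>

lemma grid_time_stopping: "stopping_time (product_filtration F i) (grid_time \<delta> S i)"
proof (induction i)
  case 0
  have "grid_time \<delta> S 0 = (\<lambda>_. 0)" by auto
  then show ?case by (simp only: stopping_time_const)
next
  case (Suc i)
  show ?case
  proof
    fix t :: ennreal
    interpret p: filtration "space (product_space F)" "product_filtration F (Suc i)" by (rule filtration_product)
    have st: "stopping_time (product_filtration F (Suc i)) (grid_time \<delta> S i)"
      by (rule stopping_time_product_mono[OF _ Suc.IH]) simp
    show "Measurable.pred (product_filtration F (Suc i) t) (\<lambda>\<omega>. grid_time \<delta> S (Suc i) \<omega> \<le> t)"
    proof (cases "t = \<top>")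
      case False
      have eq: "grid_time \<delta> S (Suc i) \<omega> \<le> t \<longleftrightarrow>
          (\<exists>k\<in>{k. ennreal (\<delta> * real k) \<le> t}. grid_time \<delta> S i \<omega> < ennreal (\<delta> * real k) \<and> X (\<delta> * real k) (\<omega> (Suc i)) \<in> S)" for \<omega>
      proof
        assume le: "grid_time \<delta> S (Suc i) \<omega> \<le> t"
        then have "grid_time \<delta> S (Suc i) \<omega> < \<top>" using False by (auto simp: less_top[symmetric] top_unique simp del: grid_time.simps)
        then show "\<exists>k\<in>{k. ennreal (\<delta> * real k) \<le> t}. grid_time \<delta> S i \<omega> < ennreal (\<delta> * real k) \<and> X (\<delta> * real k) (\<omega> (Suc i)) \<in> S"
          by (rule grid_time_attained) (use le in \<open>auto simp del: grid_time.simps\<close>)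
      qed (auto intro: order_trans[OF grid_time_le] simp del: grid_time.simps)
      show ?thesis
        unfolding eq
      proof (intro measurable_pred_countable pred_intros_logic)
        fix k assume k: "k \<in> {k. ennreal (\<delta> * real k) \<le> t}"
        show "Measurable.pred (product_filtration F (Suc i) t) (\<lambda>\<omega>. grid_time \<delta> S i \<omega> < ennreal (\<delta> * real k))"
          by (rule pred_product_mono[OF p.stopping_time_less_const[OF st]]) (use k in simp)
        have [measurable]: "(\<lambda>\<omega>. X (\<delta> * real k) (\<omega> (Suc i))) \<in> product_filtration F (Suc i) t \<rightarrow>\<^sub>M borel"
          by (rule state_measurable) (use k \<delta> in auto)
        show "Measurable.pred (product_filtration F (Suc i) t) (\<lambda>\<omega>. X (\<delta> * real k) (\<omega> (Suc i)) \<in> S)" by measurable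
      qed simp
    qed simp
  qed
qed

lemma grid_target_measurable:
  fixes sel :: "'e \<Rightarrow> 'e"
  assumes sel[measurable]: "sel \<in> borel \<rightarrow>\<^sub>M borel" and i: "1 \<le> i"
  shows "(\<lambda>\<omega>. sel (X (enn2real (grid_time \<delta> S i \<omega>)) (\<omega> i)))
    \<in> filtration.pre_sigma (space (product_space F)) (product_filtration F i) (grid_time \<delta> S i) \<rightarrow>\<^sub>M borel"
proof -
  interpret p: filtration "space (product_space F)" "product_filtration F i" by (rule filtration_product)
  note st = grid_time_stopping[of i]
  let ?f = "\<lambda>\<omega>. sel (X (enn2real (grid_time \<delta> S i \<omega>)) (\<omega> i))"
  show ?thesis
  proof (rule measurableI)
    fix A :: "'e set" assume [measurable]: "A \<in> sets borel"
    have "Measurable.pred (p.pre_sigma (grid_time \<delta> S i)) (\<lambda>\<omega>. ?f \<omega> \<in> A)"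
    proof (rule p.pred_pre_sigmaI[OF st])
      fix t
      have eq: "?f \<omega> \<in> A \<and> grid_time \<delta> S i \<omega> \<le> t \<longleftrightarrow>
          (\<exists>k\<in>{k. ennreal (\<delta> * real k) \<le> t}. grid_time \<delta> S i \<omega> = ennreal (\<delta> * real k) \<and> sel (X (\<delta> * real k) (\<omega> i)) \<in> A)
          \<or> (t = \<top> \<and> grid_time \<delta> S i \<omega> = \<top> \<and> sel (X 0 (\<omega> i)) \<in> A)" for \<omega>
        using grid_time_on_grid[of i \<omega>] \<delta> by (cases "grid_time \<delta> S i \<omega> < \<top>") (auto simp: top_unique less_top[symmetric])
      show "Measurable.pred (product_filtration F i t) (\<lambda>\<omega>. ?f \<omega> \<in> A \<and> grid_time \<delta> S i \<omega> \<le> t)"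
        unfolding eq
      proof (rule pred_intros_logic)
        show "Measurable.pred (product_filtration F i t) (\<lambda>\<omega>. \<exists>k\<in>{k. ennreal (\<delta> * real k) \<le> t}.
            grid_time \<delta> S i \<omega> = ennreal (\<delta> * real k) \<and> sel (X (\<delta> * real k) (\<omega> i)) \<in> A)"
        proof (intro measurable_pred_countable pred_intros_logic)
          fix k assume k: "k \<in> {k. ennreal (\<delta> * real k) \<le> t}"
          show "Measurable.pred (product_filtration F i t) (\<lambda>\<omega>. grid_time \<delta> S i \<omega> = ennreal (\<delta> * real k))"
            by (rule pred_product_mono[OF p.stopping_time_eq_const[OF st]]) (use k in simp)
          have [measurable]: "(\<lambda>\<omega>. X (\<delta> * real k) (\<omega> i)) \<in> product_filtration F i t \<rightarrow>\<^sub>M borel"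
            by (rule state_measurable) (use k \<delta> i in auto)
          show "Measurable.pred (product_filtration F i t) (\<lambda>\<omega>. sel (X (\<delta> * real k) (\<omega> i)) \<in> A)" by measurable
        qed simp
        show "Measurable.pred (product_filtration F i t) (\<lambda>\<omega>. t = \<top> \<and> grid_time \<delta> S i \<omega> = \<top> \<and> sel (X 0 (\<omega> i)) \<in> A)"
        proof (cases "t = \<top>")
          case True
          have [measurable]: "(\<lambda>\<omega>. X 0 (\<omega> i)) \<in> product_filtration F i t \<rightarrow>\<^sub>M borel"
            by (rule state_measurable) (use i in auto)
          have [measurable]: "Measurable.pred (product_filtration F i t) (\<lambda>\<omega>. grid_time \<delta> S i \<omega> = \<top>)"
            unfolding True by (rule p.stopping_time_eq_const[OF st])
          show ?thesis by measurable
        qed simp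
      qed
    qed
    then show "?f -` A \<inter> space (p.pre_sigma (grid_time \<delta> S i)) \<in> sets (p.pre_sigma (grid_time \<delta> S i))"
      unfolding Measurable.pred_def by (simp add: vimage_def Int_def conj_commute)
  qed simp
qed

lemma grid_strategy: "sel \<in> borel \<rightarrow>\<^sub>M borel \<Longrightarrow> grid_strategy \<delta> S sel \<in> strategies F"
  unfolding strategies_def grid_strategy_def
  using grid_time_stopping grid_target_measurable grid_time_mono by auto

lemma impulse_time_grid: "impulse_time (grid_strategy \<delta> S sel) i \<omega> = grid_time \<delta> S i \<omega>"
  by (cases i) (simp_all add: impulse_time_def grid_strategy_def)

end

end

text \<open>
  Data for the verification of a grid strategy: \<open>u\<close> is the cost to be paid from a grid time on after the decision,
  \<open>v\<close> the cost before the decision, and \<open>r\<close> the cost rate which has to be compensated.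
\<close>

locale grid_controlled = impulse_problem \<Omega> F X P g c K c\<^sub>0 c\<^sub>1
    + ctl: controlled_problem \<Omega> F X P g c K c\<^sub>0 c\<^sub>1 x "grid_strategy \<delta> S sel" Q
  for \<Omega> :: "'w set" and F :: "ennreal \<Rightarrow> 'w measure"
    and X :: "real \<Rightarrow> 'w \<Rightarrow> 'e::polish_space" and P :: "'e \<Rightarrow> 'w measure"
    and g :: "'e \<Rightarrow> real" and c :: "'e \<Rightarrow> 'e \<Rightarrow> real" and K c\<^sub>0 c\<^sub>1 :: real
    and x :: 'e and Q :: "(nat \<Rightarrow> 'w) measure" and \<delta> :: real and S :: "'e set" and sel :: "'e \<Rightarrow> 'e" +
  fixes u v :: "'e \<Rightarrow> real" and b r :: real
  assumes \<delta>: "0 < \<delta>" and S [measurable]: "S \<in> sets borel"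
    and u_measurable [measurable]: "u \<in> borel_measurable borel"
    and v_measurable [measurable]: "v \<in> borel_measurable borel"
    and u_nonneg: "\<And>y. 0 \<le> u y" and u_le: "\<And>y. u y \<le> b" and r_nonneg: "0 \<le> r"
    and wait: "\<And>y. y \<notin> S \<Longrightarrow> u y \<le> v y"
    and stop: "\<And>y. y \<in> S \<Longrightarrow> c y (sel y) + u (sel y) \<le> v y"
    and supermartingale: "\<And>y. running 0 \<delta> y + semigroup \<delta> (\<lambda>y. ennreal (v y)) y \<le> ennreal (u y + \<delta> * r)"
begin

abbreviation time :: "nat \<Rightarrow> real" where "time k \<equiv> \<delta> * real k"

lemma \<tau>_eq: "ctl.\<tau> i \<omega> = grid_time \<delta> S i \<omega>"
  by (rule impulse_time_grid[OF \<delta> S])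

lemma time_nonneg: "0 \<le> time k" using \<delta> by simp

lemma \<tau>_grid: assumes "ctl.\<tau> i \<omega> < \<top>" obtains k where "ctl.\<tau> i \<omega> = ennreal (time k)"
  using grid_time_on_grid[OF \<delta> S] assms unfolding \<tau>_eq by blast

lemma \<tau>_strict: "ctl.\<tau> i \<omega> < \<top> \<Longrightarrow> ctl.\<tau> i \<omega> < ctl.\<tau> (Suc i) \<omega>"
  unfolding \<tau>_eq by (rule grid_time_less[OF \<delta> S])

lemma \<tau>_gap: "ennreal (time k) < ctl.\<tau> i \<omega> \<Longrightarrow> ennreal (time (Suc k)) \<le> ctl.\<tau> i \<omega>"
proof (cases "ctl.\<tau> i \<omega> < \<top>")
  case True
  assume less: "ennreal (time k) < ctl.\<tau> i \<omega>"
  obtain m where m: "ctl.\<tau> i \<omega> = ennreal (time m)" using \<tau>_grid[OF True] by blast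
  then have "k < m" using less \<delta> by (simp add: ennreal_less_iff)
  then have "time (Suc k) \<le> time m" using \<delta> by (intro mult_left_mono) auto
  then show ?thesis unfolding m by (rule ennreal_leI)
qed (simp add: less_top[symmetric])

lemma \<tau>_lower: "ennreal (time i) \<le> ctl.\<tau> i \<omega>"
proof (induction i)
  case (Suc i)
  show ?case
  proof (cases "ctl.\<tau> i \<omega> < \<top>")
    case True
    show ?thesis by (rule \<tau>_gap[OF le_less_trans[OF Suc \<tau>_strict[OF True]]])
  next
    case False
    then show ?thesis using grid_time_mono[OF \<delta> S, of i \<omega>] unfolding \<tau>_eq by (simp add: less_top[symmetric] top_unique del: grid_time.simps)
  qed
qed simp

text \<open>
  At least one grid step passes between impulses, so that they do not accumulate.
\<close>

lemma active_exists: "\<exists>i. ctl.active i (time k) \<omega>"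
proof -
  have "ennreal (time k) < ennreal (time (Suc k))" using \<delta> by (simp add: ennreal_less_iff)
  then have ex: "ennreal (time k) < ctl.\<tau> (Suc k) \<omega>" by (rule less_le_trans[OF _ \<tau>_lower])
  define i where "i = (LEAST i. ennreal (time k) < ctl.\<tau> (Suc i) \<omega>)"
  have 1: "ennreal (time k) < ctl.\<tau> (Suc i) \<omega>" unfolding i_def by (rule LeastI[of _ k]) (rule ex)
  have "ctl.\<tau> i \<omega> \<le> ennreal (time k)"
  proof (cases i)
    case (Suc j)
    then have "\<not> ennreal (time k) < ctl.\<tau> (Suc j) \<omega>" using not_less_Least[of j "\<lambda>i. ennreal (time k) < ctl.\<tau> (Suc i) \<omega>"] by (simp add: i_def)
    then show ?thesis using Suc by simp
  qed (simp add: ctl.impulse_time_0)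
  then show ?thesis using 1 by (auto simp: ctl.active_def)
qed

lemma active_stays:
  assumes "ctl.active i (time k) \<omega>" "time k \<le> s" "s < time (Suc k)"
  shows "ctl.active i s \<omega>"
proof -
  have "ennreal (time (Suc k)) \<le> ctl.\<tau> (Suc i) \<omega>" using assms(1) by (intro \<tau>_gap) (simp add: ctl.active_def)
  moreover have "ennreal s < ennreal (time (Suc k))" using assms(2,3) time_nonneg[of k] by (subst ennreal_less_iff) linarith+
  ultimately show ?thesis using assms(1,2) by (auto simp: ctl.active_def intro: order_trans ennreal_leI)
qed

lemma time_Suc: "time (Suc k) = time k + \<delta>" by (simp add: distrib_left)

lemma not_stopped: "ctl.\<tau> i \<omega> < ennreal (time k) \<Longrightarrow> ennreal (time k) < ctl.\<tau> (Suc i) \<omega> \<Longrightarrow> X (time k) (\<omega> (Suc i)) \<notin> S"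
  unfolding \<tau>_eq using grid_time_le[OF \<delta> S, of i \<omega> k] by (auto simp: not_less[symmetric] simp del: grid_time.simps)

lemma stopped: "ctl.\<tau> (Suc i) \<omega> = ennreal (time k) \<Longrightarrow> X (time k) (\<omega> (Suc i)) \<in> S \<and> ctl.\<tau> i \<omega> < ennreal (time k)"
proof -
  assume eq: "ctl.\<tau> (Suc i) \<omega> = ennreal (time k)"
  have "grid_time \<delta> S (Suc i) \<omega> < \<top>" using eq unfolding \<tau>_eq by (simp del: grid_time.simps)
  from grid_time_attained[OF \<delta> S this] obtain m where
    m: "grid_time \<delta> S (Suc i) \<omega> = ennreal (time m)" "grid_time \<delta> S i \<omega> < ennreal (time m)" "X (time m) (\<omega> (Suc i)) \<in> S" by blast
  then have "ennreal (time m) = ennreal (time k)" using eq unfolding \<tau>_eq by simp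
  then have "m = k" using \<delta> by (simp add: time_nonneg)
  then show ?thesis using m unfolding \<tau>_eq by auto
qed

lemma state_at_measurable [measurable]: "(\<lambda>\<omega>. X (time k) (\<omega> (Suc i))) \<in> borel_measurable Q"
  by (rule measurable_compose[OF ctl.coordinate_measurable measurable_X_top[OF time_nonneg]])

lemma active_at_measurable [measurable]: "Measurable.pred Q (\<lambda>\<omega>. ctl.active i (time k) \<omega>)"
  unfolding ctl.active_def by measurable

lemma grid_step:
  "(\<integral>\<^sup>+\<omega>\<in>{\<omega>\<in>space Q. ctl.active i (time k) \<omega>}.
      (ctl.run_cost i (time k) (time k + \<delta>) \<omega> + ennreal (v (X (time (Suc k)) (\<omega> (Suc i))))) \<partial>Q)
    \<le> (\<integral>\<^sup>+\<omega>\<in>{\<omega>\<in>space Q. ctl.active i (time k) \<omega>}. ennreal (u (X (time k) (\<omega> (Suc i))) + \<delta> * r) \<partial>Q)"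
proof -
  interpret s: impulse_restarted \<Omega> F X P g c K c\<^sub>0 c\<^sub>1 Q "product_filtration F (Suc i)" "ctl.\<tau> i" "ctl.segment i"
    by (rule ctl.segment_restarted)
  let ?B = "{\<omega>\<in>space Q. ctl.active i (time k) \<omega>}"
  \<comment> \<open>The Markov property is available after \<open>\<tau> i\<close> only; on the event considered the maximum is \<open>time k\<close>.\<close>
  let ?\<sigma> = "\<lambda>\<omega>. max (ctl.\<tau> i \<omega>) (ennreal (time k))"
  have st: "stopping_time (product_filtration F (Suc i)) ?\<sigma>"
    by (intro stopping_time_max ctl.impulse_time_stopping' stopping_time_const)
  have B\<sigma>: "?\<sigma> \<omega> = ennreal (time k)" if "\<omega> \<in> ?B" for \<omega> using that by (simp add: ctl.active_def max_absorb2)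
  have Bk: "?B \<in> sets (product_filtration F (Suc i) (ennreal (time k)))"
    using pred_intros_logic(3)[OF stopping_timeD[OF ctl.impulse_time_stopping'[of i], of "ennreal (time k)"]
        stopping_timeD2[OF ctl.impulse_time_stopping[of i], of "ennreal (time k)"]]
    unfolding Measurable.pred_def space_product_filtration ctl.space_Q[symmetric] ctl.active_def by simp
  have "(\<integral>\<^sup>+\<omega>\<in>?B. (running 0 \<delta> (X (enn2real (?\<sigma> \<omega>)) (\<omega> (Suc i))) + semigroup \<delta> (\<lambda>y. ennreal (v y)) (X (enn2real (?\<sigma> \<omega>)) (\<omega> (Suc i)))) \<partial>Q)
    = (\<integral>\<^sup>+\<omega>\<in>?B. (ctl.run_cost i (enn2real (?\<sigma> \<omega>)) (enn2real (?\<sigma> \<omega>) + \<delta>) \<omega>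
      + ennreal (v (X (enn2real (?\<sigma> \<omega>) + \<delta>) (\<omega> (Suc i))))) \<partial>Q)"
  proof (rule s.one_step[OF st])
    show "?B \<in> sets (s.flt.pre_sigma ?\<sigma>)"
    proof (rule s.flt.sets_pre_sigmaI[OF st])
      fix t
      have le: "?\<sigma> \<omega> \<le> t \<longleftrightarrow> ennreal (time k) \<le> t" if "\<omega> \<in> ?B" for \<omega> unfolding B\<sigma>[OF that] ..
      have "{\<omega>\<in>?B. ?\<sigma> \<omega> \<le> t} = (if ennreal (time k) \<le> t then ?B else {})"
        by (cases "ennreal (time k) \<le> t") (use le in \<open>simp_all only: if_True if_False, blast+\<close>)
      then show "{\<omega>\<in>?B. ?\<sigma> \<omega> \<le> t} \<in> sets (product_filtration F (Suc i) t)"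
        using Bk s.flt.sets_F_mono[of "ennreal (time k)" t] by auto
    qed
    show "?\<sigma> \<omega> < \<top>" if "\<omega> \<in> ?B" for \<omega> unfolding B\<sigma>[OF that] by simp
  qed (use \<delta> in auto)
  moreover have "(\<integral>\<^sup>+\<omega>\<in>?B. (running 0 \<delta> (X (enn2real (?\<sigma> \<omega>)) (\<omega> (Suc i))) + semigroup \<delta> (\<lambda>y. ennreal (v y)) (X (enn2real (?\<sigma> \<omega>)) (\<omega> (Suc i)))) \<partial>Q)
      \<le> (\<integral>\<^sup>+\<omega>\<in>?B. ennreal (u (X (time k) (\<omega> (Suc i))) + \<delta> * r) \<partial>Q)"
    using supermartingale by (intro nn_integral_mono) (auto simp: B\<sigma> time_nonneg split: split_indicator)
  moreover have "(\<integral>\<^sup>+\<omega>\<in>?B. (ctl.run_cost i (enn2real (?\<sigma> \<omega>)) (enn2real (?\<sigma> \<omega>) + \<delta>) \<omega>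
      + ennreal (v (X (enn2real (?\<sigma> \<omega>) + \<delta>) (\<omega> (Suc i))))) \<partial>Q)
    = (\<integral>\<^sup>+\<omega>\<in>?B. (ctl.run_cost i (time k) (time k + \<delta>) \<omega> + ennreal (v (X (time (Suc k)) (\<omega> (Suc i))))) \<partial>Q)"
    unfolding time_Suc by (intro nn_integral_cong) (auto simp: B\<sigma> time_nonneg split: split_indicator)
  ultimately show ?thesis by simp
qed

end

lemma suminf_single:
  fixes f :: "nat \<Rightarrow> ennreal"
  assumes "\<And>j. j \<noteq> i \<Longrightarrow> f j = 0" shows "(\<Sum>j. f j) = f i"
  using suminf_finite[of "{i}" f] assms by simp

lemma suminf_if_single:
  fixes f :: "nat \<Rightarrow> ennreal"
  assumes "P i" "\<And>j. P j \<Longrightarrow> j = i"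
  shows "(\<Sum>j. if P j then f j else 0) = f i"
proof -
  have "(if P j then f j else 0) = 0" if "j \<noteq> i" for j using assms(2)[of j] that by auto
  from suminf_single[of i, OF this] show ?thesis using assms(1) by simp
qed

context grid_controlled
begin

lemma restart_at_target:
  "AE \<omega> in Q. \<forall>i. ctl.\<tau> (Suc i) \<omega> < \<top> \<longrightarrow>
    X (ctl.impulse_at i \<omega>) (\<omega> (Suc (Suc i))) = sel (X (ctl.impulse_at i \<omega>) (\<omega> (Suc i)))"
  unfolding AE_all_countable
proof
  fix i
  show "AE \<omega> in Q. ctl.\<tau> (Suc i) \<omega> < \<top> \<longrightarrow>
    X (ctl.impulse_at i \<omega>) (\<omega> (Suc (Suc i))) = sel (X (ctl.impulse_at i \<omega>) (\<omega> (Suc i)))"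
    unfolding ctl.impulse_at_def using ctl.restart[of "Suc i"]
    by (rule eventually_mono)
      (simp add: restart_state_def grid_strategy_def impulse_time_def del: grid_time.simps)
qed

text \<open>
  At the next grid time there are two cases. Either the active coordinate is not in \<open>S\<close>, and \<open>u \<le> v\<close> there; or an
  impulse takes place, and \<open>v\<close> pays for the impulse and for \<open>u\<close> at the new state. In each sum at most one
  term is different from 0.
\<close>

lemma grid_step_pathwise:
  assumes \<omega>: "\<omega> \<in> space Q"
    and restart: "\<And>i. ctl.\<tau> (Suc i) \<omega> < \<top> \<Longrightarrow>
      X (ctl.impulse_at i \<omega>) (\<omega> (Suc (Suc i))) = sel (X (ctl.impulse_at i \<omega>) (\<omega> (Suc i)))"
  shows "(\<integral>\<^sup>+s\<in>{time k..<time k + \<delta>}. gn (ctl.Y s \<omega>) \<partial>lborel)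
      + (\<Sum>i. if ctl.\<tau> (Suc i) \<omega> = ennreal (time (Suc k)) then ctl.impulse_cost i \<omega> else 0)
      + (\<Sum>i. if ctl.active i (time (Suc k)) \<omega> then ennreal (u (X (time (Suc k)) (\<omega> (Suc i)))) else 0)
    \<le> (\<Sum>i. if ctl.active i (time k) \<omega> then ctl.run_cost i (time k) (time k + \<delta>) \<omega>
        + ennreal (v (X (time (Suc k)) (\<omega> (Suc i)))) else 0)"
proof -
  obtain i where i: "ctl.active i (time k) \<omega>" using active_exists[of k \<omega>] by auto
  let ?t = "time (Suc k)"
  have tt: "ennreal (time k) < ennreal ?t" using \<delta> by (simp add: ennreal_less_iff)
  have uniq: "j = i" if "ctl.active j (time k) \<omega>" for j using ctl.active_unique[OF \<omega> that i] .
  have rhs: "(\<Sum>i. if ctl.active i (time k) \<omega> then ctl.run_cost i (time k) (time k + \<delta>) \<omega>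
        + ennreal (v (X ?t (\<omega> (Suc i)))) else 0)
      = ctl.run_cost i (time k) (time k + \<delta>) \<omega> + ennreal (v (X ?t (\<omega> (Suc i))))"
    by (rule suminf_if_single[of "\<lambda>j. ctl.active j (time k) \<omega>", OF i uniq])
  have G: "(\<integral>\<^sup>+s\<in>{time k..<time k + \<delta>}. gn (ctl.Y s \<omega>) \<partial>lborel)
      = ctl.run_cost i (time k) (time k + \<delta>) \<omega>"
  proof (rule nn_integral_cong)
    fix s :: real
    show "gn (ctl.Y s \<omega>) * indicator {time k..<time k + \<delta>} s = gn (X (max 0 s) (\<omega> (Suc i))) * indicator {time k..<time k + \<delta>} s"
    proof (cases "s \<in> {time k..<time k + \<delta>}")
      case True
      then have s: "0 \<le> s" "ctl.active i s \<omega>"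
        using active_stays[OF i, of s] order_trans[OF time_nonneg[of k], of s] unfolding time_Suc by auto
      then show ?thesis using ctl.controlled_process_active[OF \<omega> s(2)] by (simp add: max_absorb2)
    qed simp
  qed
  have C0: "j = i" if "ctl.\<tau> (Suc j) \<omega> = ennreal ?t" for j
  proof (rule uniq)
    have "ctl.\<tau> j \<omega> < ennreal ?t" using stopped[OF that] by simp
    then have "ctl.\<tau> j \<omega> \<le> ennreal (time k)" using \<tau>_gap[of k j \<omega>] by (meson not_le)
    then show "ctl.active j (time k) \<omega>" using that tt by (simp add: ctl.active_def)
  qed
  show ?thesis
  proof (cases "ctl.\<tau> (Suc i) \<omega> = ennreal ?t")
    case True
    have C: "(\<Sum>i. if ctl.\<tau> (Suc i) \<omega> = ennreal ?t then ctl.impulse_cost i \<omega> else 0) = ctl.impulse_cost i \<omega>"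
      by (rule suminf_if_single[of "\<lambda>j. ctl.\<tau> (Suc j) \<omega> = ennreal ?t", OF True C0])
    have act: "ctl.active (Suc i) ?t \<omega>"
      using \<tau>_strict[of "Suc i" \<omega>] True by (simp add: ctl.active_def)
    have U: "(\<Sum>i. if ctl.active i ?t \<omega> then ennreal (u (X ?t (\<omega> (Suc i)))) else 0) = ennreal (u (X ?t (\<omega> (Suc (Suc i)))))"
      by (rule suminf_if_single[of "\<lambda>j. ctl.active j ?t \<omega>", OF act ctl.active_unique[OF \<omega> _ act]])
    have at: "ctl.impulse_at i \<omega> = ?t" unfolding ctl.impulse_at_def True by (rule enn2real_ennreal[OF time_nonneg])
    let ?y = "X ?t (\<omega> (Suc i))"
    have new: "X ?t (\<omega> (Suc (Suc i))) = sel ?y" using restart[of i] True unfolding at by simp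
    have "ctl.impulse_cost i \<omega> + ennreal (u (sel ?y)) = ennreal (c ?y (sel ?y) + u (sel ?y))"
      unfolding ctl.impulse_cost_def at new
      by (rule ennreal_plus[symmetric]) (use u_nonneg c0_pos c_lower[of ?y "sel ?y"] in auto)
    also have "\<dots> \<le> ennreal (v ?y)" by (rule ennreal_leI[OF stop]) (use stopped[OF True] in simp)
    finally show ?thesis unfolding rhs G C U new by (simp only: add.assoc add_left_mono)
  next
    case False
    have C: "(\<Sum>i. if ctl.\<tau> (Suc i) \<omega> = ennreal ?t then ctl.impulse_cost i \<omega> else 0) = 0"
    proof -
      have "ctl.\<tau> (Suc j) \<omega> \<noteq> ennreal ?t" for j using C0[of j] False by metis
      then show ?thesis by simp
    qed
    have "ennreal ?t \<le> ctl.\<tau> (Suc i) \<omega>" using i by (intro \<tau>_gap) (simp add: ctl.active_def)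
    then have less: "ennreal ?t < ctl.\<tau> (Suc i) \<omega>" using False by (simp add: less_le)
    have le: "ctl.\<tau> i \<omega> < ennreal ?t" using i tt by (auto simp: ctl.active_def)
    have act: "ctl.active i ?t \<omega>" using less le by (simp add: ctl.active_def)
    have U: "(\<Sum>i. if ctl.active i ?t \<omega> then ennreal (u (X ?t (\<omega> (Suc i)))) else 0) = ennreal (u (X ?t (\<omega> (Suc i))))"
      by (rule suminf_if_single[of "\<lambda>j. ctl.active j ?t \<omega>", OF act ctl.active_unique[OF \<omega> _ act]])
    show ?thesis unfolding rhs G C U
      using wait[OF not_stopped[OF le less]] by (simp add: add_left_mono ennreal_leI)
  qed
qed

lemma Y_measurable [measurable]: "(\<lambda>(t, \<omega>). ctl.Y t \<omega>) \<in> borel_measurable (borel \<Otimes>\<^sub>M Q)"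
  by (rule ctl.controlled_process_measurable)

text \<open>
  The expectation of \<open>u\<close> at the current state, plus the cost incurred so far, increases by at most \<open>\<delta> r\<close> per
  grid step.
\<close>

lemma total_cost_upper:
  assumes T: "0 \<le> T"
  shows "ctl.total_cost (indicator {0..T}) \<le> ennreal (b + (T + 2 * \<delta>) * r)"
proof -
  interpret prob_space Q by (rule ctl.Q_prob)
  define G where "G = (\<lambda>k \<omega>. \<integral>\<^sup>+s\<in>{time k..<time k + \<delta>}. gn (ctl.Y s \<omega>) \<partial>lborel)"
  define C where "C = (\<lambda>k \<omega>. \<Sum>i. if ctl.\<tau> (Suc i) \<omega> = ennreal (time (Suc k)) then ctl.impulse_cost i \<omega> else 0)"
  define U where "U = (\<lambda>k \<omega>. \<Sum>i. if ctl.active i (time k) \<omega> then ennreal (u (X (time k) (\<omega> (Suc i)))) else 0)"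
  define N where "N = nat \<lceil>T / \<delta>\<rceil> + 1"
  have N: "T < \<delta> * real N" "\<delta> * real N \<le> T + 2 * \<delta>"
  proof -
    have "T / \<delta> < real N" using real_nat_ceiling_ge[of "T / \<delta>"] by (simp add: N_def)
    then show "T < \<delta> * real N" using \<delta> by (simp add: field_simps)
    have "real N \<le> T / \<delta> + 2" using real_nat_ceiling_le[OF divide_nonneg_pos[OF T \<delta>]] by (simp add: N_def)
    then show "\<delta> * real N \<le> T + 2 * \<delta>" using \<delta> by (simp add: field_simps)
  qed
  have Gm[measurable]: "G k \<in> borel_measurable Q" for k unfolding G_def by measurable
  have Cm[measurable]: "C k \<in> borel_measurable Q" for k unfolding C_def by measurable
  have Um[measurable]: "U k \<in> borel_measurable Q" for k unfolding U_def by measurable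
  have Usingle: "U k \<omega> \<le> ennreal b" if "\<omega> \<in> space Q" for k \<omega>
  proof -
    obtain i where i: "ctl.active i (time k) \<omega>" using active_exists[of k \<omega>] by auto
    have "U k \<omega> = ennreal (u (X (time k) (\<omega> (Suc i))))"
      unfolding U_def by (rule suminf_if_single[of "\<lambda>j. ctl.active j (time k) \<omega>", OF i ctl.active_unique[OF that _ i]])
    then show ?thesis using u_le by (simp add: ennreal_leI)
  qed
  have step: "(\<integral>\<^sup>+\<omega>. G k \<omega> + C k \<omega> \<partial>Q) + (\<integral>\<^sup>+\<omega>. U (Suc k) \<omega> \<partial>Q) \<le> (\<integral>\<^sup>+\<omega>. U k \<omega> \<partial>Q) + ennreal (\<delta> * r)" for k
  proof -
    let ?B = "\<lambda>i. {\<omega>\<in>space Q. ctl.active i (time k) \<omega>}"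
    let ?R = "\<lambda>i \<omega>. ctl.run_cost i (time k) (time k + \<delta>) \<omega> + ennreal (v (X (time (Suc k)) (\<omega> (Suc i))))"
    have "(\<integral>\<^sup>+\<omega>. G k \<omega> + C k \<omega> \<partial>Q) + (\<integral>\<^sup>+\<omega>. U (Suc k) \<omega> \<partial>Q) = (\<integral>\<^sup>+\<omega>. G k \<omega> + C k \<omega> + U (Suc k) \<omega> \<partial>Q)"
      by (rule nn_integral_add[symmetric]) measurable
    also have "\<dots> \<le> (\<integral>\<^sup>+\<omega>. (\<Sum>i. ?R i \<omega> * indicator (?B i) \<omega>) \<partial>Q)"
    proof (rule nn_integral_mono_AE)
      show "AE \<omega> in Q. G k \<omega> + C k \<omega> + U (Suc k) \<omega> \<le> (\<Sum>i. ?R i \<omega> * indicator (?B i) \<omega>)"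
        using restart_at_target AE_space
      proof eventually_elim
        case (elim \<omega>)
        have "(\<Sum>i. ?R i \<omega> * indicator (?B i) \<omega>) = (\<Sum>i. if ctl.active i (time k) \<omega> then ?R i \<omega> else 0)"
          using elim(2) by (intro suminf_cong) auto
        then show ?case using grid_step_pathwise[OF elim(2), of k] elim(1) unfolding G_def C_def U_def by simp
      qed
    qed
    also have "\<dots> = (\<Sum>i. \<integral>\<^sup>+\<omega>\<in>?B i. ?R i \<omega> \<partial>Q)" by (rule nn_integral_suminf) measurable
    also have "\<dots> \<le> (\<Sum>i. \<integral>\<^sup>+\<omega>\<in>?B i. ennreal (u (X (time k) (\<omega> (Suc i))) + \<delta> * r) \<partial>Q)"
      by (intro suminf_le grid_step) auto
    also have "\<dots> = (\<integral>\<^sup>+\<omega>. (\<Sum>i. ennreal (u (X (time k) (\<omega> (Suc i))) + \<delta> * r) * indicator (?B i) \<omega>) \<partial>Q)"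
      by (rule nn_integral_suminf[symmetric]) measurable
    also have "\<dots> = (\<integral>\<^sup>+\<omega>. U k \<omega> + ennreal (\<delta> * r) \<partial>Q)"
    proof (rule nn_integral_cong)
      fix \<omega> assume \<omega>: "\<omega> \<in> space Q"
      obtain i where i: "ctl.active i (time k) \<omega>" using active_exists[of k \<omega>] by auto
      have "U k \<omega> = ennreal (u (X (time k) (\<omega> (Suc i))))"
        unfolding U_def by (rule suminf_if_single[of "\<lambda>j. ctl.active j (time k) \<omega>", OF i ctl.active_unique[OF \<omega> _ i]])
      moreover have "(\<Sum>i. ennreal (u (X (time k) (\<omega> (Suc i))) + \<delta> * r) * indicator (?B i) \<omega>) = ennreal (u (X (time k) (\<omega> (Suc i))) + \<delta> * r)"
      proof -
        have "(\<Sum>i. ennreal (u (X (time k) (\<omega> (Suc i))) + \<delta> * r) * indicator (?B i) \<omega>)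
            = (\<Sum>i. if ctl.active i (time k) \<omega> then ennreal (u (X (time k) (\<omega> (Suc i))) + \<delta> * r) else 0)"
          using \<omega> by (intro suminf_cong) auto
        also have "\<dots> = ennreal (u (X (time k) (\<omega> (Suc i))) + \<delta> * r)"
          by (rule suminf_if_single[of "\<lambda>j. ctl.active j (time k) \<omega>", OF i ctl.active_unique[OF \<omega> _ i]])
        finally show ?thesis .
      qed
      ultimately show "(\<Sum>i. ennreal (u (X (time k) (\<omega> (Suc i))) + \<delta> * r) * indicator (?B i) \<omega>) = U k \<omega> + ennreal (\<delta> * r)"
        using u_nonneg \<delta> r_nonneg by simp
    qed
    also have "\<dots> = (\<integral>\<^sup>+\<omega>. U k \<omega> \<partial>Q) + ennreal (\<delta> * r)"
      by (subst nn_integral_add) (auto simp: emeasure_space_1)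
    finally show ?thesis .
  qed
  have sum: "(\<Sum>k<n. \<integral>\<^sup>+\<omega>. G k \<omega> + C k \<omega> \<partial>Q) + (\<integral>\<^sup>+\<omega>. U n \<omega> \<partial>Q) \<le> (\<integral>\<^sup>+\<omega>. U 0 \<omega> \<partial>Q) + ennreal (real n * (\<delta> * r))" for n
  proof (induction n)
    case (Suc n)
    have "(\<Sum>k<Suc n. \<integral>\<^sup>+\<omega>. G k \<omega> + C k \<omega> \<partial>Q) + (\<integral>\<^sup>+\<omega>. U (Suc n) \<omega> \<partial>Q)
        = (\<Sum>k<n. \<integral>\<^sup>+\<omega>. G k \<omega> + C k \<omega> \<partial>Q) + ((\<integral>\<^sup>+\<omega>. G n \<omega> + C n \<omega> \<partial>Q) + (\<integral>\<^sup>+\<omega>. U (Suc n) \<omega> \<partial>Q))"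
      by (simp only: sum.lessThan_Suc add.assoc)
    also have "\<dots> \<le> (\<Sum>k<n. \<integral>\<^sup>+\<omega>. G k \<omega> + C k \<omega> \<partial>Q) + ((\<integral>\<^sup>+\<omega>. U n \<omega> \<partial>Q) + ennreal (\<delta> * r))"
      by (rule add_left_mono[OF step])
    also have "\<dots> \<le> ((\<integral>\<^sup>+\<omega>. U 0 \<omega> \<partial>Q) + ennreal (real n * (\<delta> * r))) + ennreal (\<delta> * r)"
      unfolding add.assoc[symmetric] by (rule add_right_mono[OF Suc])
    also have "\<dots> = (\<integral>\<^sup>+\<omega>. U 0 \<omega> \<partial>Q) + ennreal (real (Suc n) * (\<delta> * r))"
      unfolding add.assoc using \<delta> r_nonneg
      by (subst ennreal_plus[symmetric]) (auto simp: algebra_simps)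
    finally show ?case .
  qed simp
  have "ctl.total_cost (indicator {0..T}) \<le> (\<integral>\<^sup>+\<omega>. (\<Sum>k<N. G k \<omega> + C k \<omega>) \<partial>Q)"
    unfolding ctl.total_cost_eq[OF T]
  proof (rule nn_integral_mono)
    fix \<omega> assume \<omega>: "\<omega> \<in> space Q"
    have [measurable]: "(\<lambda>s. ctl.Y s \<omega>) \<in> borel_measurable borel"
      using measurable_compose[OF measurable_Pair2'[OF \<omega>] Y_measurable] by simp
    have "(\<integral>\<^sup>+s\<in>{0..T}. gn (ctl.Y s \<omega>) \<partial>lborel) \<le> (\<integral>\<^sup>+s\<in>{0..<0 + \<delta> * real N}. gn (ctl.Y s \<omega>) \<partial>lborel)"
      using N(1) by (intro nn_integral_mono) (auto split: split_indicator)
    also have "\<dots> = (\<Sum>k<N. G k \<omega>)"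
      unfolding G_def using nn_integral_consecutive[of "\<lambda>s. gn (ctl.Y s \<omega>)" \<delta> 0 N] \<delta> by simp
    finally have 1: "(\<integral>\<^sup>+s\<in>{0..T}. gn (ctl.Y s \<omega>) \<partial>lborel) \<le> (\<Sum>k<N. G k \<omega>)" .
    have "(\<Sum>i. if ctl.\<tau> (Suc i) \<omega> \<le> ennreal T then ctl.impulse_cost i \<omega> else 0)
        \<le> (\<Sum>i. \<Sum>k<N. if ctl.\<tau> (Suc i) \<omega> = ennreal (time (Suc k)) then ctl.impulse_cost i \<omega> else 0)"
    proof (intro suminf_le)
      fix i
      show "(if ctl.\<tau> (Suc i) \<omega> \<le> ennreal T then ctl.impulse_cost i \<omega> else 0)
        \<le> (\<Sum>k<N. if ctl.\<tau> (Suc i) \<omega> = ennreal (time (Suc k)) then ctl.impulse_cost i \<omega> else 0)"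
      proof (cases "ctl.\<tau> (Suc i) \<omega> \<le> ennreal T")
        case True
        then have "ctl.\<tau> (Suc i) \<omega> < \<top>" by (rule le_less_trans) simp
        then obtain m where m: "ctl.\<tau> (Suc i) \<omega> = ennreal (time m)" using \<tau>_grid by blast
        have "ctl.\<tau> i \<omega> < ennreal (time m)" using stopped[OF m] by simp
        then have "m \<noteq> 0" by (cases m) auto
        then obtain k where k: "m = Suc k" by (cases m) auto
        have "\<delta> * real m \<le> T" using True T unfolding m by (simp add: time_nonneg)
        then have "\<delta> * real m < \<delta> * real N" using N(1) by simp
        then have "k < N" using \<delta> k by simp
        then show ?thesis
          using member_le_sum[of k "{..<N}" "\<lambda>k. if ctl.\<tau> (Suc i) \<omega> = ennreal (time (Suc k)) then ctl.impulse_cost i \<omega> else 0"]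
            m k by simp
      qed simp
    qed auto
    also have "\<dots> = (\<Sum>k<N. C k \<omega>)"
      unfolding C_def by (rule suminf_sum) simp
    finally show "(\<integral>\<^sup>+s\<in>{0..T}. gn (ctl.Y s \<omega>) \<partial>lborel)
        + (\<Sum>i. if ctl.\<tau> (Suc i) \<omega> \<le> ennreal T then ctl.impulse_cost i \<omega> else 0) \<le> (\<Sum>k<N. G k \<omega> + C k \<omega>)"
      using 1 unfolding sum.distrib by (intro add_mono)
  qed
  also have "\<dots> = (\<Sum>k<N. \<integral>\<^sup>+\<omega>. G k \<omega> + C k \<omega> \<partial>Q)" by (rule nn_integral_sum) measurable
  also have "\<dots> \<le> (\<Sum>k<N. \<integral>\<^sup>+\<omega>. G k \<omega> + C k \<omega> \<partial>Q) + (\<integral>\<^sup>+\<omega>. U N \<omega> \<partial>Q)" by simp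
  also note sum[of N]
  also have "(\<integral>\<^sup>+\<omega>. U 0 \<omega> \<partial>Q) + ennreal (real N * (\<delta> * r)) \<le> ennreal b + ennreal ((T + 2 * \<delta>) * r)"
  proof (rule add_mono)
    have "(\<integral>\<^sup>+\<omega>. U 0 \<omega> \<partial>Q) \<le> (\<integral>\<^sup>+\<omega>. ennreal b \<partial>Q)" by (rule nn_integral_mono[OF Usingle])
    then show "(\<integral>\<^sup>+\<omega>. U 0 \<omega> \<partial>Q) \<le> ennreal b" by (simp add: emeasure_space_1)
    have "real N * (\<delta> * r) = (\<delta> * real N) * r" by simp
    also have "\<dots> \<le> (T + 2 * \<delta>) * r" by (rule mult_right_mono[OF N(2) r_nonneg])
    finally show "ennreal (real N * (\<delta> * r)) \<le> ennreal ((T + 2 * \<delta>) * r)" by (rule ennreal_leI)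
  qed
  also have "ennreal b + ennreal ((T + 2 * \<delta>) * r) = ennreal (b + (T + 2 * \<delta>) * r)"
    using order_trans[OF u_nonneg u_le] T \<delta> r_nonneg by (intro ennreal_plus[symmetric]) auto
  finally show ?thesis .
qed

end

section \<open>From finite horizons to the long-run criteria\<close>

text \<open>
  The positive and the negative part of \<open>Z = I + S\<close> satisfy \<open>Z\<^sup>+ + A = (Z + A) + Z\<^sup>-\<close> where \<open>Z\<^sup>- \<le> A\<close>, so the
  subtraction of expectations is never \<open>\<infinity> - \<infinity>\<close>.
\<close>

lemma expectation_ereal_shift:
  fixes I :: "'a \<Rightarrow> real" and S :: "'a \<Rightarrow> ennreal"
  assumes M: "prob_space M" and [measurable]: "I \<in> borel_measurable M" "S \<in> borel_measurable M"
    and I: "\<And>\<omega>. \<omega> \<in> space M \<Longrightarrow> 0 \<le> I \<omega> + A" and A: "0 \<le> A"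
  shows "expectation_ereal M (\<lambda>\<omega>. ereal (I \<omega>) + enn2ereal (S \<omega>))
    = enn2ereal (\<integral>\<^sup>+\<omega>. ennreal (I \<omega> + A) + S \<omega> \<partial>M) - ereal A"
proof -
  interpret prob_space M by (rule M)
  let ?Z = "\<lambda>\<omega>. ereal (I \<omega>) + enn2ereal (S \<omega>)"
  let ?p = "\<integral>\<^sup>+\<omega>. e2ennreal (?Z \<omega>) \<partial>M" and ?n = "\<integral>\<^sup>+\<omega>. e2ennreal (- ?Z \<omega>) \<partial>M"
    and ?w = "\<integral>\<^sup>+\<omega>. ennreal (I \<omega> + A) + S \<omega> \<partial>M"
  have pw: "e2ennreal (?Z \<omega>) + ennreal A = (ennreal (I \<omega> + A) + S \<omega>) + e2ennreal (- ?Z \<omega>)"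
    and nb: "e2ennreal (- ?Z \<omega>) \<le> ennreal A" if "\<omega> \<in> space M" for \<omega>
  proof -
    have "e2ennreal (?Z \<omega>) + ennreal A = (ennreal (I \<omega> + A) + S \<omega>) + e2ennreal (- ?Z \<omega>) \<and> e2ennreal (- ?Z \<omega>) \<le> ennreal A"
    proof (cases "S \<omega>")
      case (real s)
      then have Z: "?Z \<omega> = ereal (I \<omega> + s)" by (simp add: enn2ereal_ennreal)
      show ?thesis
        using I[OF that] A real
        by (cases "0 \<le> I \<omega> + s")
          (auto simp: Z e2ennreal_ereal ennreal_plus[symmetric] ennreal_neg algebra_simps simp del: ennreal_plus intro!: ennreal_leI)
    next
      case top
      then show ?thesis by (simp add: e2ennreal_neg)
    qed
    then show "e2ennreal (?Z \<omega>) + ennreal A = (ennreal (I \<omega> + A) + S \<omega>) + e2ennreal (- ?Z \<omega>)"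
      "e2ennreal (- ?Z \<omega>) \<le> ennreal A" by auto
  qed
  have "?p + ennreal A = (\<integral>\<^sup>+\<omega>. e2ennreal (?Z \<omega>) + ennreal A \<partial>M)"
    by (subst nn_integral_add) (auto simp: emeasure_space_1)
  also have "\<dots> = (\<integral>\<^sup>+\<omega>. (ennreal (I \<omega> + A) + S \<omega>) + e2ennreal (- ?Z \<omega>) \<partial>M)"
    by (rule nn_integral_cong) (rule pw)
  also have "\<dots> = ?w + ?n" by (rule nn_integral_add) measurable
  finally have eq: "?p + ennreal A = ?w + ?n" .
  have "?n \<le> (\<integral>\<^sup>+\<omega>. ennreal A \<partial>M)" by (rule nn_integral_mono[OF nb])
  then have "?n \<le> ennreal A" by (simp add: emeasure_space_1)
  then obtain n where n: "?n = ennreal n" "0 \<le> n" by (cases ?n) (auto simp: top_unique)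
  have "enn2ereal ?p + ereal A = enn2ereal ?w + ereal n"
    using arg_cong[OF eq, of enn2ereal] A n by (simp add: plus_ennreal.rep_eq enn2ereal_ennreal)
  then have "enn2ereal ?p - ereal n = enn2ereal ?w - ereal A"
    by (cases "enn2ereal ?p"; cases "enn2ereal ?w") auto
  then show ?thesis unfolding expectation_ereal_def using n by (simp add: enn2ereal_ennreal)
qed

lemma Limsup_ratio_lower:
  fixes D :: "real \<Rightarrow> real" and W :: "real \<Rightarrow> ennreal"
  assumes D: "filterlim D at_top at_top"
    and W: "\<forall>\<^sub>F T in at_top. ennreal (l * D T) \<le> W T + ennreal C" and C: "0 \<le> C"
  shows "ereal (l - \<kappa>) \<le> Limsup at_top (\<lambda>T. (enn2ereal (W T) - ereal (\<kappa> * D T)) / ereal (D T))"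
proof -
  have "((\<lambda>T. C / D T) \<longlongrightarrow> 0) at_top" by (rule real_tendsto_divide_at_top[OF tendsto_const D])
  then have "((\<lambda>T. ereal (l - \<kappa> - C / D T)) \<longlongrightarrow> ereal (l - \<kappa> - 0)) at_top"
    by (intro tendsto_intros)
  then have "ereal (l - \<kappa>) = Limsup at_top (\<lambda>T. ereal (l - \<kappa> - C / D T))"
    by (intro lim_imp_Limsup[symmetric]) auto
  also have "\<dots> \<le> Limsup at_top (\<lambda>T. (enn2ereal (W T) - ereal (\<kappa> * D T)) / ereal (D T))"
  proof (rule Limsup_mono)
    have "\<forall>\<^sub>F T in at_top. 0 < D T" using D by (simp add: filterlim_at_top_dense)
    with W show "\<forall>\<^sub>F T in at_top. ereal (l - \<kappa> - C / D T) \<le> (enn2ereal (W T) - ereal (\<kappa> * D T)) / ereal (D T)"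
    proof eventually_elim
      case (elim T)
      show ?case
      proof (cases "W T")
        case (real w)
        have "l * D T \<le> w + C"
          using elim(1) real C by (simp add: ennreal_plus[symmetric] ennreal_le_iff del: ennreal_plus)
        then have "(l * D T - C - \<kappa> * D T) / D T \<le> (w - \<kappa> * D T) / D T"
          using elim(2) by (intro divide_right_mono) auto
        then have "l - \<kappa> - C / D T \<le> (w - \<kappa> * D T) / D T" using elim(2) by (simp add: diff_divide_distrib)
        then show ?thesis using real elim(2) by (simp add: enn2ereal_ennreal)
      next
        case top
        then show ?thesis using elim(2) by simp
      qed
    qed
  qed
  finally show ?thesis .
qed

lemma Limsup_ratio_upper:
  fixes D :: "real \<Rightarrow> real" and W :: "real \<Rightarrow> ennreal"
  assumes D: "filterlim D at_top at_top"
    and W: "\<forall>\<^sub>F T in at_top. W T \<le> ennreal (l * D T + C)" and C: "0 \<le> C" and l: "0 \<le> l"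
  shows "Limsup at_top (\<lambda>T. (enn2ereal (W T) - ereal (\<kappa> * D T)) / ereal (D T)) \<le> ereal (l - \<kappa>)"
proof -
  have "((\<lambda>T. C / D T) \<longlongrightarrow> 0) at_top" by (rule real_tendsto_divide_at_top[OF tendsto_const D])
  then have "((\<lambda>T. ereal (l - \<kappa> + C / D T)) \<longlongrightarrow> ereal (l - \<kappa> + 0)) at_top"
    by (intro tendsto_intros)
  then have lim: "Limsup at_top (\<lambda>T. ereal (l - \<kappa> + C / D T)) = ereal (l - \<kappa>)"
    by (intro lim_imp_Limsup) auto
  have "Limsup at_top (\<lambda>T. (enn2ereal (W T) - ereal (\<kappa> * D T)) / ereal (D T)) \<le> Limsup at_top (\<lambda>T. ereal (l - \<kappa> + C / D T))"
  proof (rule Limsup_mono)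
    have "\<forall>\<^sub>F T in at_top. 0 < D T" using D by (simp add: filterlim_at_top_dense)
    with W show "\<forall>\<^sub>F T in at_top. (enn2ereal (W T) - ereal (\<kappa> * D T)) / ereal (D T) \<le> ereal (l - \<kappa> + C / D T)"
    proof eventually_elim
      case (elim T)
      obtain w where w: "W T = ennreal w" "0 \<le> w" using elim(1) by (cases "W T") (auto simp: top_unique)
      have "w \<le> l * D T + C" using elim w C l by (simp add: ennreal_le_iff del: ennreal_plus)
      then have "(w - \<kappa> * D T) / D T \<le> l - \<kappa> + C / D T" using elim(2) by (simp add: field_simps)
      then show ?case using w elim(2) by (simp add: enn2ereal_ennreal)
    qed
  qed
  then show ?thesis unfolding lim .
qed

locale discount_function =
  fixes \<beta> :: "real \<Rightarrow> real"
  assumes range: "\<And>t. 0 \<le> t \<Longrightarrow> 0 < \<beta> t \<and> \<beta> t \<le> 1"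
    and decreasing: "\<And>s t. 0 \<le> s \<Longrightarrow> s \<le> t \<Longrightarrow> \<beta> t \<le> \<beta> s"
    and continuous: "continuous_on {0..} \<beta>"
    and at_0: "\<beta> 0 = 1"
    and divergent: "(\<integral>\<^sup>+s\<in>{0..}. ennreal (\<beta> s) \<partial>lborel) = \<infinity>"
begin

definition D :: "real \<Rightarrow> real" where "D T = (LBINT s:{0..T}. \<beta> s)"

lemma measurable_max [measurable]: "(\<lambda>s. \<beta> (max 0 s)) \<in> borel_measurable borel"
  by (intro borel_measurable_continuous_onI continuous_on_compose2[OF continuous] continuous_intros) auto

lemma D_ennreal: "(\<integral>\<^sup>+s\<in>{0..T}. ennreal (\<beta> (max 0 s)) \<partial>lborel) = ennreal (D T)" and D_nonneg: "0 \<le> D T"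
proof -
  have abs1: "\<bar>\<beta> s\<bar> \<le> 1" if "0 \<le> s" for s using range[OF that] by simp
  have int: "integrable lborel (\<lambda>s. indicator {0..T} s * \<beta> (max 0 s))"
  proof (rule Bochner_Integration.integrable_bound)
    show "integrable lborel (indicator {0..T} :: real \<Rightarrow> real)" by (rule integrable_real_indicator) (auto simp: emeasure_lborel_Icc_eq)
    show "AE s in lborel. norm (indicator {0..T} s * \<beta> (max 0 s)) \<le> norm (indicator {0..T} s :: real)"
      using abs1 by (intro AE_I2) (auto split: split_indicator)
  qed measurable
  have eq: "D T = (\<integral>s. indicator {0..T} s * \<beta> (max 0 s) \<partial>lborel)"
    unfolding D_def set_lebesgue_integral_def by (intro Bochner_Integration.integral_cong) (auto split: split_indicator)
  have pos: "0 \<le> indicator {0..T} s * \<beta> (max 0 s)" for s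
    using range[of "max 0 s"] by (auto split: split_indicator)
  have "(\<integral>\<^sup>+s\<in>{0..T}. ennreal (\<beta> (max 0 s)) \<partial>lborel) = (\<integral>\<^sup>+s. ennreal (indicator {0..T} s * \<beta> (max 0 s)) \<partial>lborel)"
    by (intro nn_integral_cong) (auto split: split_indicator)
  also have "\<dots> = ennreal (D T)"
    unfolding eq by (rule nn_integral_eq_integral[OF int]) (use pos in auto)
  finally show "(\<integral>\<^sup>+s\<in>{0..T}. ennreal (\<beta> (max 0 s)) \<partial>lborel) = ennreal (D T)" .
  show "0 \<le> D T" unfolding eq by (rule integral_nonneg_AE) (use pos in auto)
qed

text \<open>
  The integrals over \<open>[0, n]\<close> increase to the infinite integral over the half-line.
\<close>

lemma D_at_top: "filterlim D at_top at_top"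
proof -
  have mono: "D S \<le> D T" if "S \<le> T" for S T
  proof -
    have "ennreal (D S) \<le> ennreal (D T)"
      unfolding D_ennreal[symmetric] using that by (intro nn_integral_mono) (auto split: split_indicator)
    then show ?thesis using D_nonneg by (simp add: ennreal_le_iff)
  qed
  have "(\<integral>\<^sup>+s\<in>{0..}. ennreal (\<beta> s) \<partial>lborel) = (\<integral>\<^sup>+s. (SUP n. ennreal (\<beta> (max 0 s)) * indicator {0..real n} s) \<partial>lborel)"
  proof (rule nn_integral_cong)
    fix s :: real
    show "ennreal (\<beta> s) * indicator {0..} s = (SUP n. ennreal (\<beta> (max 0 s)) * indicator {0..real n} s)"
    proof (cases "0 \<le> s")
      case True
      obtain n where "s \<le> real n" using real_arch_simple by blast
      then have "ennreal (\<beta> (max 0 s)) \<le> (SUP n. ennreal (\<beta> (max 0 s)) * indicator {0..real n} s)"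
        using True by (intro SUP_upper2[of n]) auto
      moreover have "(SUP n. ennreal (\<beta> (max 0 s)) * indicator {0..real n} s) \<le> ennreal (\<beta> (max 0 s))"
        by (rule SUP_least) (auto split: split_indicator)
      ultimately have "(SUP n. ennreal (\<beta> (max 0 s)) * indicator {0..real n} s) = ennreal (\<beta> (max 0 s))"
        by (rule antisym[rotated])
      then show ?thesis using True by simp
    qed simp
  qed
  also have "\<dots> = (SUP n. \<integral>\<^sup>+s\<in>{0..real n}. ennreal (\<beta> (max 0 s)) \<partial>lborel)"
    by (intro nn_integral_monotone_convergence_SUP) (auto simp: mono_def le_fun_def split: split_indicator)
  finally have sup: "(SUP n. ennreal (D (real n))) = \<top>" using divergent by (simp add: D_ennreal)
  show ?thesis
    unfolding filterlim_at_top_ge[of _ _ 0]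
  proof (intro allI impI)
    fix Z :: real assume Z: "0 \<le> Z"
    have "ennreal Z < (SUP n. ennreal (D (real n)))" unfolding sup by simp
    then obtain n where "ennreal Z < ennreal (D (real n))" unfolding less_SUP_iff by blast
    then have "Z \<le> D (real n)" using Z by (simp add: ennreal_less_iff)
    then show "\<forall>\<^sub>F T in at_top. Z \<le> D T"
      unfolding eventually_at_top_linorder using mono order_trans by blast
  qed
qed

text \<open>
  A decreasing function has superlevel sets that are initial intervals; continuity makes them closed.
\<close>

lemma superlevel_interval:
  assumes u: "0 < u" "u \<le> 1" and T: "0 \<le> T"
  shows "\<exists>b\<ge>0. \<forall>s\<ge>0. (s \<le> T \<and> u \<le> \<beta> s) \<longleftrightarrow> s \<le> b"
proof -
  let ?L = "{s\<in>{0..T}. u \<le> \<beta> s}"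
  have "closed ?L"
    by (rule continuous_on_closed_Collect_le) (auto intro: continuous_on_subset[OF continuous])
  then have "compact ?L" by (intro compact_eq_bounded_closed[THEN iffD2] conjI bounded_subset[OF bounded_closed_interval[of 0 T]]) auto
  moreover have "0 \<in> ?L" using u T at_0 by simp
  ultimately obtain b where b: "b \<in> ?L" "\<And>s. s \<in> ?L \<Longrightarrow> s \<le> b" using compact_attains_sup[of ?L] by blast
  have "(s \<le> T \<and> u \<le> \<beta> s) \<longleftrightarrow> s \<le> b" if "0 \<le> s" for s
    using b decreasing[OF that, of b] that by (auto intro: order_trans)
  then show ?thesis using b(1) by auto
qed

end

context controlled_problem
begin

lemma process_at_measurable [measurable]:
  "\<omega> \<in> space Q \<Longrightarrow> (\<lambda>s. Y s \<omega>) \<in> borel_measurable borel"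
  using measurable_compose[OF measurable_Pair2' controlled_process_measurable] by simp

lemma total_cost_zero: "total_cost (\<lambda>_. 0) = 0"
  unfolding total_cost_def by (simp cong: if_cong)

text \<open>
  Tonelli's theorem, separately for the running cost and for each impulse.
\<close>

lemma total_cost_mix:
  assumes [measurable]: "(\<lambda>(u, s). H u s) \<in> borel_measurable (borel \<Otimes>\<^sub>M borel)"
  shows "total_cost (\<lambda>s. \<integral>\<^sup>+u. H u s \<partial>lborel) = (\<integral>\<^sup>+u. total_cost (H u) \<partial>lborel)"
proof -
  interpret prob_space Q by (rule Q_prob)
  interpret ps: pair_sigma_finite lborel Q by unfold_locales
  have "(\<integral>\<^sup>+s\<in>{0..}. (\<integral>\<^sup>+u. H u s \<partial>lborel) * gn (Y s \<omega>) \<partial>lborel)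
      + (\<Sum>i. if \<tau> (Suc i) \<omega> < \<top> then (\<integral>\<^sup>+u. H u (impulse_at i \<omega>) \<partial>lborel) * impulse_cost i \<omega> else 0)
    = (\<integral>\<^sup>+u. (\<integral>\<^sup>+s\<in>{0..}. H u s * gn (Y s \<omega>) \<partial>lborel)
      + (\<Sum>i. if \<tau> (Suc i) \<omega> < \<top> then H u (impulse_at i \<omega>) * impulse_cost i \<omega> else 0) \<partial>lborel)"
    if \<omega>: "\<omega> \<in> space Q" for \<omega>
  proof -
    note [measurable] = process_at_measurable[OF \<omega>]
    have "(\<integral>\<^sup>+s\<in>{0..}. (\<integral>\<^sup>+u. H u s \<partial>lborel) * gn (Y s \<omega>) \<partial>lborel)
        = (\<integral>\<^sup>+s. (\<integral>\<^sup>+u. H u s * gn (Y s \<omega>) * indicator {0..} s \<partial>lborel) \<partial>lborel)"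
      by (simp add: nn_integral_multc)
    also have "\<dots> = (\<integral>\<^sup>+u. (\<integral>\<^sup>+s\<in>{0..}. H u s * gn (Y s \<omega>) \<partial>lborel) \<partial>lborel)"
      by (rule lborel_pair.Fubini') measurable
    finally have 1: "(\<integral>\<^sup>+s\<in>{0..}. (\<integral>\<^sup>+u. H u s \<partial>lborel) * gn (Y s \<omega>) \<partial>lborel)
        = (\<integral>\<^sup>+u. (\<integral>\<^sup>+s\<in>{0..}. H u s * gn (Y s \<omega>) \<partial>lborel) \<partial>lborel)" .
    have "(\<Sum>i. if \<tau> (Suc i) \<omega> < \<top> then (\<integral>\<^sup>+u. H u (impulse_at i \<omega>) \<partial>lborel) * impulse_cost i \<omega> else 0)
        = (\<Sum>i. \<integral>\<^sup>+u. (if \<tau> (Suc i) \<omega> < \<top> then H u (impulse_at i \<omega>) * impulse_cost i \<omega> else 0) \<partial>lborel)"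
      by (intro suminf_cong) (simp add: nn_integral_multc)
    also have "\<dots> = (\<integral>\<^sup>+u. (\<Sum>i. if \<tau> (Suc i) \<omega> < \<top> then H u (impulse_at i \<omega>) * impulse_cost i \<omega> else 0) \<partial>lborel)"
      by (rule nn_integral_suminf[symmetric]) measurable
    finally have 2: "(\<Sum>i. if \<tau> (Suc i) \<omega> < \<top> then (\<integral>\<^sup>+u. H u (impulse_at i \<omega>) \<partial>lborel) * impulse_cost i \<omega> else 0)
        = (\<integral>\<^sup>+u. (\<Sum>i. if \<tau> (Suc i) \<omega> < \<top> then H u (impulse_at i \<omega>) * impulse_cost i \<omega> else 0) \<partial>lborel)" .
    show ?thesis unfolding 1 2 by (rule nn_integral_add[symmetric]) measurable
  qed
  then have "total_cost (\<lambda>s. \<integral>\<^sup>+u. H u s \<partial>lborel)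
    = (\<integral>\<^sup>+\<omega>. (\<integral>\<^sup>+u. (\<integral>\<^sup>+s\<in>{0..}. H u s * gn (Y s \<omega>) \<partial>lborel)
      + (\<Sum>i. if \<tau> (Suc i) \<omega> < \<top> then H u (impulse_at i \<omega>) * impulse_cost i \<omega> else 0) \<partial>lborel) \<partial>Q)"
    unfolding total_cost_def by (rule nn_integral_cong)
  also have "\<dots> = (\<integral>\<^sup>+u. total_cost (H u) \<partial>lborel)"
    unfolding total_cost_def by (rule ps.Fubini') measurable
  finally show ?thesis .
qed

text \<open>
  The running cost \<open>g - \<kappa>\<close> may be negative; \<open>\<kappa>\<close> times the total weight is what has been added to make it
  nonnegative.
\<close>

lemma expected_cost:
  assumes T: "0 \<le> T" and \<kappa>: "0 \<le> \<kappa>" and bm[measurable]: "(\<lambda>s. b (max 0 s)) \<in> borel_measurable borel"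
    and b: "\<And>s. 0 \<le> s \<Longrightarrow> 0 \<le> b s \<and> b s \<le> 1"
  shows "expectation_ereal Q (cost_upto X (\<lambda>y. g y - \<kappa>) c b V T)
    = enn2ereal (total_cost (\<lambda>s. indicator {0..T} s * ennreal (b (max 0 s)))) - ereal (\<kappa> * (LBINT s:{0..T}. b s))"
proof -
  define I where "I = (\<lambda>\<omega>. LBINT s:{0..T}. b s * (g (controlled_process X V s \<omega>) - \<kappa>))"
  define S where "S = (\<lambda>\<omega>. \<Sum>i. if \<tau> (Suc i) \<omega> \<le> ennreal T then ennreal (b (impulse_at i \<omega>)) * impulse_cost i \<omega> else 0)"
  let ?A = "\<kappa> * (LBINT s:{0..T}. b s)"
  have I_eq: "I \<omega> = (\<integral>s. indicator {0..T} s * (b (max 0 s) * (g (Y s \<omega>) - \<kappa>)) \<partial>lborel)" for \<omega>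
    unfolding I_def set_lebesgue_integral_def by (intro Bochner_Integration.integral_cong) (auto split: split_indicator simp: max_absorb2)
  have A_eq: "?A = (\<integral>s. \<kappa> * (indicator {0..T} s * b (max 0 s)) \<partial>lborel)"
    unfolding set_lebesgue_integral_def
    by (subst integral_mult_right_zero[symmetric]) (auto intro!: Bochner_Integration.integral_cong split: split_indicator simp: max_absorb2)
  have bnd: "integrable lborel (\<lambda>s. indicator {0..T} s * f s)"
    if [measurable]: "f \<in> borel_measurable borel" and "\<And>s. \<bar>f s\<bar> \<le> B" for f :: "real \<Rightarrow> real" and B
  proof (rule Bochner_Integration.integrable_bound)
    show "integrable lborel (\<lambda>s. indicator {0..T} s * B)"
      by (intro integrable_mult_left integrable_real_indicator) (auto simp: emeasure_lborel_Icc_eq)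
    show "AE s in lborel. norm (indicator {0..T} s * f s) \<le> norm (indicator {0..T} s * B)"
      using that(2) by (intro AE_I2) (auto split: split_indicator intro: order_trans[OF _ abs_ge_self])
  qed measurable
  have b1: "0 \<le> b (max 0 s)" "\<bar>b (max 0 s)\<bar> \<le> 1" for s using b[of "max 0 s"] by auto
  have Im[measurable]: "I \<in> borel_measurable Q" unfolding I_eq[abs_def] by measurable
  have "(\<lambda>\<omega>. b (max 0 (impulse_at i \<omega>))) \<in> borel_measurable Q" for i by measurable
  then have [measurable]: "(\<lambda>\<omega>. b (impulse_at i \<omega>)) \<in> borel_measurable Q" for i unfolding impulse_at_nonneg .
  have Sm[measurable]: "S \<in> borel_measurable Q" unfolding S_def by measurable
  have IA: "0 \<le> I \<omega> + ?A"
    "ennreal (I \<omega> + ?A) = (\<integral>\<^sup>+s\<in>{0..}. indicator {0..T} s * ennreal (b (max 0 s)) * gn (Y s \<omega>) \<partial>lborel)"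
    if \<omega>: "\<omega> \<in> space Q" for \<omega>
  proof -
    note [measurable] = process_at_measurable[OF \<omega>]
    let ?g = "\<lambda>s. g (Y s \<omega>)"
    have bg: "\<bar>b (max 0 s) * ?g s\<bar> \<le> 1 * K" "\<bar>b (max 0 s) * (?g s - \<kappa>)\<bar> \<le> 1 * (K + \<kappa>)" for s
      unfolding abs_mult by (intro mult_mono b1; use g_abs[of "Y s \<omega>"] \<kappa> K_nonneg in linarith)+
    have i1: "integrable lborel (\<lambda>s. indicator {0..T} s * (b (max 0 s) * (?g s - \<kappa>)))" by (rule bnd[OF _ bg(2)]) measurable
    have i2: "integrable lborel (\<lambda>s. \<kappa> * (indicator {0..T} s * b (max 0 s)))" by (intro integrable_mult_right bnd[OF _ b1(2)]) measurable
    have i3: "integrable lborel (\<lambda>s. indicator {0..T} s * (b (max 0 s) * ?g s))" by (rule bnd[OF _ bg(1)]) measurable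
    have eq: "I \<omega> + ?A = (\<integral>s. indicator {0..T} s * (b (max 0 s) * ?g s) \<partial>lborel)"
      unfolding I_eq A_eq
      by (subst Bochner_Integration.integral_add[OF i1 i2, symmetric]) (auto intro!: Bochner_Integration.integral_cong simp: algebra_simps)
    show "0 \<le> I \<omega> + ?A" unfolding eq using b1 g_nonneg by (intro integral_nonneg_AE AE_I2) simp
    have "ennreal (I \<omega> + ?A) = (\<integral>\<^sup>+s. ennreal (indicator {0..T} s * (b (max 0 s) * ?g s)) \<partial>lborel)"
      unfolding eq by (rule nn_integral_eq_integral[OF i3, symmetric]) (use b1 g_nonneg in simp)
    also have "\<dots> = (\<integral>\<^sup>+s\<in>{0..}. indicator {0..T} s * ennreal (b (max 0 s)) * gn (Y s \<omega>) \<partial>lborel)"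
      by (intro nn_integral_cong) (auto simp: ennreal_mult' b1 split: split_indicator)
    finally show "ennreal (I \<omega> + ?A) = (\<integral>\<^sup>+s\<in>{0..}. indicator {0..T} s * ennreal (b (max 0 s)) * gn (Y s \<omega>) \<partial>lborel)" .
  qed
  have "0 \<le> ?A" unfolding A_eq using \<kappa> b1 by (intro integral_nonneg_AE AE_I2) simp
  note shift = expectation_ereal_shift[OF Q_prob Im Sm IA(1) this]
  have "cost_upto X (\<lambda>y. g y - \<kappa>) c b V T = (\<lambda>\<omega>. ereal (I \<omega>) + enn2ereal (S \<omega>))"
    unfolding cost_upto_def I_def S_def Let_def impulse_cost_def impulse_at_def[symmetric]
    using b c0_pos c_lower by (auto simp: ennreal_mult' impulse_at_def cong: if_cong)
  then have "expectation_ereal Q (cost_upto X (\<lambda>y. g y - \<kappa>) c b V T)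
      = enn2ereal (\<integral>\<^sup>+\<omega>. ennreal (I \<omega> + ?A) + S \<omega> \<partial>Q) - ereal ?A"
    using shift by simp
  also have "(\<integral>\<^sup>+\<omega>. ennreal (I \<omega> + ?A) + S \<omega> \<partial>Q) = total_cost (\<lambda>s. indicator {0..T} s * ennreal (b (max 0 s)))"
    unfolding total_cost_def S_def
  proof (intro nn_integral_cong arg_cong2[where f="(+)"] suminf_cong)
    fix \<omega> i
    show "(if \<tau> (Suc i) \<omega> \<le> ennreal T then ennreal (b (impulse_at i \<omega>)) * impulse_cost i \<omega> else 0)
      = (if \<tau> (Suc i) \<omega> < \<top> then indicator {0..T} (impulse_at i \<omega>) * ennreal (b (max 0 (impulse_at i \<omega>))) * impulse_cost i \<omega> else 0)"
      using T by (cases "\<tau> (Suc i) \<omega>") (auto simp: impulse_at_def top_unique split: split_indicator)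
  qed (rule IA(2))
  finally show ?thesis .
qed

lemma average_criterion:
  assumes T: "0 \<le> T" and \<kappa>: "0 \<le> \<kappa>"
  shows "expectation_ereal Q (cost_upto X (\<lambda>y. g y - \<kappa>) c (\<lambda>_. 1) V T)
    = enn2ereal (total_cost (indicator {0..T})) - ereal (\<kappa> * T)"
proof -
  have "(LBINT s:{0..T}. 1) = T" using T by (simp add: set_lebesgue_integral_def)
  then show ?thesis using expected_cost[OF T \<kappa>, of "\<lambda>_. 1"] by simp
qed

context
  fixes \<beta> :: "real \<Rightarrow> real"
  assumes \<beta>: "discount_function \<beta>"
begin

interpretation discount_function \<beta> by (rule \<beta>)

text \<open>
  Layer-cake representation: \<open>\<beta>\<close> on \<open>[0, T]\<close> is the integral over the levels \<open>u\<close> of the indicators of its superlevel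
  sets. As these sets are intervals \<open>[0, b]\<close>, the discounted cost is a mixture of undiscounted costs over shorter horizons.
\<close>

abbreviation level :: "real \<Rightarrow> real \<Rightarrow> real \<Rightarrow> ennreal" where
  "level T u s \<equiv> (if 0 \<le> s \<and> s \<le> T \<and> 0 < u \<and> u \<le> \<beta> (max 0 s) then 1 else 0)"

lemma level_integral: "(\<integral>\<^sup>+u. level T u s \<partial>lborel) = indicator {0..T} s * ennreal (\<beta> (max 0 s))"
proof -
  have "(\<integral>\<^sup>+u. level T u s \<partial>lborel) = (\<integral>\<^sup>+u. indicator {0..T} s * indicator {0<..\<beta> (max 0 s)} u \<partial>lborel)"
    by (intro nn_integral_cong) (auto split: split_indicator)
  then show ?thesis using range[of "max 0 s"] by (simp add: nn_integral_cmult)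
qed

lemma level_interval:
  assumes "0 \<le> T" "0 < u" "u \<le> 1"
  obtains b where "0 \<le> b" "level T u = indicator {0..b}"
proof -
  obtain b where b: "0 \<le> b" "\<forall>s\<ge>0. (s \<le> T \<and> u \<le> \<beta> s) \<longleftrightarrow> s \<le> b"
    using superlevel_interval[OF assms(2,3,1)] by blast
  have "level T u s = indicator {0..b} s" for s
    using b(2)[rule_format, of s] assms(2) by (auto split: split_indicator)
  then show ?thesis using that b(1) by blast
qed

lemma level_empty: "0 \<le> T \<Longrightarrow> \<not> (0 < u \<and> u \<le> 1) \<Longrightarrow> level T u = (\<lambda>_. 0)"
  using range by (auto intro!: ext) (metis max.cobounded1 order_trans)

lemma level_mass: "(\<integral>\<^sup>+u. (\<integral>\<^sup>+s. level T u s \<partial>lborel) \<partial>lborel) = ennreal (D T)"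
proof -
  have "(\<integral>\<^sup>+u. (\<integral>\<^sup>+s. level T u s \<partial>lborel) \<partial>lborel) = (\<integral>\<^sup>+s. (\<integral>\<^sup>+u. level T u s \<partial>lborel) \<partial>lborel)"
    by (rule lborel_pair.Fubini') measurable
  also have "\<dots> = ennreal (D T)" unfolding level_integral D_ennreal[symmetric] by (simp add: mult.commute)
  finally show ?thesis .
qed

abbreviation discounted_cost :: "real \<Rightarrow> ennreal" where
  "discounted_cost T \<equiv> total_cost (\<lambda>s. indicator {0..T} s * ennreal (\<beta> (max 0 s)))"

lemma discounted_mix: "discounted_cost T = (\<integral>\<^sup>+u. total_cost (level T u) \<partial>lborel)"
  unfolding level_integral[symmetric] by (rule total_cost_mix) measurable

lemma total_cost_level_measurable [measurable]: "(\<lambda>u. total_cost (level T u)) \<in> borel_measurable borel"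
proof -
  interpret prob_space Q by (rule Q_prob)
  show ?thesis unfolding total_cost_def by measurable
qed

text \<open>
  The bound on each horizon \<open>b\<close> is integrated over the levels. Those with \<open>u > 1\<close> are empty, so the constant \<open>C\<close> is
  integrated over an interval of length 1.
\<close>

lemma discounted_lower:
  assumes T: "0 \<le> T" and l: "0 \<le> l" and C: "0 \<le> C"
    and bound: "\<And>b. 0 \<le> b \<Longrightarrow> ennreal (l * b) \<le> total_cost (indicator {0..b}) + ennreal C"
  shows "ennreal (l * D T) \<le> discounted_cost T + ennreal C"
proof -
  have "ennreal (l * D T) = (\<integral>\<^sup>+u. ennreal l * (\<integral>\<^sup>+s. level T u s \<partial>lborel) \<partial>lborel)"
    using l D_nonneg by (subst nn_integral_cmult, measurable) (simp add: level_mass ennreal_mult)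
  also have "\<dots> \<le> (\<integral>\<^sup>+u. total_cost (level T u) + ennreal C * indicator {0<..1} u \<partial>lborel)"
  proof (rule nn_integral_mono)
    fix u :: real
    show "ennreal l * (\<integral>\<^sup>+s. level T u s \<partial>lborel) \<le> total_cost (level T u) + ennreal C * indicator {0<..1} u"
    proof (cases "0 < u \<and> u \<le> 1")
      case True
      then obtain b where b: "0 \<le> b" "level T u = indicator {0..b}" using level_interval[OF T] by blast
      have "(\<integral>\<^sup>+s. level T u s \<partial>lborel) = ennreal b" unfolding b(2) using b(1) by simp
      then show ?thesis using bound[OF b(1)] True b(1) l unfolding b(2) by (simp add: ennreal_mult)
    next
      case False
      then show ?thesis using level_empty[OF T False] by simp
    qed
  qed
  also have "\<dots> = discounted_cost T + ennreal C"
    unfolding discounted_mix by (subst nn_integral_add, measurable) (simp add: nn_integral_cmult)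
  finally show ?thesis .
qed

lemma discounted_upper:
  assumes T: "0 \<le> T" and l: "0 \<le> l" and C: "0 \<le> C"
    and bound: "\<And>b. 0 \<le> b \<Longrightarrow> total_cost (indicator {0..b}) \<le> ennreal (l * b + C)"
  shows "discounted_cost T \<le> ennreal (l * D T + C)"
proof -
  have "discounted_cost T = (\<integral>\<^sup>+u. total_cost (level T u) \<partial>lborel)"
    by (rule discounted_mix)
  also have "\<dots> \<le> (\<integral>\<^sup>+u. ennreal l * (\<integral>\<^sup>+s. level T u s \<partial>lborel) + ennreal C * indicator {0<..1} u \<partial>lborel)"
  proof (rule nn_integral_mono)
    fix u :: real
    show "total_cost (level T u) \<le> ennreal l * (\<integral>\<^sup>+s. level T u s \<partial>lborel) + ennreal C * indicator {0<..1} u"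
    proof (cases "0 < u \<and> u \<le> 1")
      case True
      then obtain b where b: "0 \<le> b" "level T u = indicator {0..b}" using level_interval[OF T] by blast
      have "(\<integral>\<^sup>+s. level T u s \<partial>lborel) = ennreal b" unfolding b(2) using b(1) by simp
      then show ?thesis using bound[OF b(1)] True b(1) l C unfolding b(2) by (simp add: ennreal_mult)
    next
      case False
      then show ?thesis using level_empty[OF T False] by (simp add: total_cost_zero)
    qed
  qed
  also have "\<dots> = ennreal l * (\<integral>\<^sup>+u. (\<integral>\<^sup>+s. level T u s \<partial>lborel) \<partial>lborel) + ennreal C"
    by (subst nn_integral_add, measurable, subst nn_integral_cmult, measurable) (simp add: nn_integral_cmult)
  also have "\<dots> = ennreal (l * D T + C)"
    using l C D_nonneg by (simp add: level_mass ennreal_mult)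
  finally show ?thesis .
qed

lemma discounted_criterion:
  assumes "0 \<le> T" "0 \<le> \<kappa>"
  shows "expectation_ereal Q (cost_upto X (\<lambda>y. g y - \<kappa>) c \<beta> V T)
    = enn2ereal (discounted_cost T) - ereal (\<kappa> * D T)"
  unfolding D_def by (rule expected_cost[OF assms]) (use range in \<open>auto intro: less_imp_le\<close>)

text \<open>
  The criteria see the family of laws only at the given initial state and strategy, so a constant family represents \<open>Q\<close>.
\<close>

lemma criteria_lower:
  assumes \<kappa>: "0 \<le> \<kappa>" and l: "0 \<le> l" and C: "0 \<le> C"
    and bound: "\<And>b. 0 \<le> b \<Longrightarrow> ennreal (l * b) \<le> total_cost (indicator {0..b}) + ennreal C"
  shows "ereal (l - \<kappa>) \<le> J_average (\<lambda>_ _. Q) X (\<lambda>y. g y - \<kappa>) c x V"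
    and "ereal (l - \<kappa>) \<le> J_discounted (\<lambda>_ _. Q) X (\<lambda>y. g y - \<kappa>) c \<beta> x V"
proof -
  have ev: "\<forall>\<^sub>F T in at_top. 0 \<le> (T::real)" by (rule eventually_ge_at_top)
  have "ereal (l - \<kappa>) \<le> Limsup at_top (\<lambda>T. (enn2ereal (total_cost (indicator {0..T})) - ereal (\<kappa> * T)) / ereal T)"
    by (rule Limsup_ratio_lower[OF filterlim_ident _ C]) (rule eventually_mono[OF ev bound])
  also have "\<dots> = J_average (\<lambda>_ _. Q) X (\<lambda>y. g y - \<kappa>) c x V"
    unfolding J_average_def by (rule Limsup_eq) (rule eventually_mono[OF ev], simp add: average_criterion \<kappa>)
  finally show "ereal (l - \<kappa>) \<le> J_average (\<lambda>_ _. Q) X (\<lambda>y. g y - \<kappa>) c x V" .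
  have "ereal (l - \<kappa>) \<le> Limsup at_top (\<lambda>T. (enn2ereal (discounted_cost T) - ereal (\<kappa> * D T)) / ereal (D T))"
    by (rule Limsup_ratio_lower[OF D_at_top _ C]) (rule eventually_mono[OF ev discounted_lower[OF _ l C bound]])
  also have "\<dots> = J_discounted (\<lambda>_ _. Q) X (\<lambda>y. g y - \<kappa>) c \<beta> x V"
    unfolding J_discounted_def D_def[symmetric]
    by (rule Limsup_eq) (rule eventually_mono[OF ev], simp add: discounted_criterion \<kappa>)
  finally show "ereal (l - \<kappa>) \<le> J_discounted (\<lambda>_ _. Q) X (\<lambda>y. g y - \<kappa>) c \<beta> x V"
    unfolding D_def .
qed

lemma criteria_upper:
  assumes \<kappa>: "0 \<le> \<kappa>" and l: "0 \<le> l" and C: "0 \<le> C"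
    and bound: "\<And>b. 0 \<le> b \<Longrightarrow> total_cost (indicator {0..b}) \<le> ennreal (l * b + C)"
  shows "J_average (\<lambda>_ _. Q) X (\<lambda>y. g y - \<kappa>) c x V \<le> ereal (l - \<kappa>)"
    and "J_discounted (\<lambda>_ _. Q) X (\<lambda>y. g y - \<kappa>) c \<beta> x V \<le> ereal (l - \<kappa>)"
proof -
  have ev: "\<forall>\<^sub>F T in at_top. 0 \<le> (T::real)" by (rule eventually_ge_at_top)
  have "J_average (\<lambda>_ _. Q) X (\<lambda>y. g y - \<kappa>) c x V
      = Limsup at_top (\<lambda>T. (enn2ereal (total_cost (indicator {0..T})) - ereal (\<kappa> * T)) / ereal T)"
    unfolding J_average_def by (rule Limsup_eq) (rule eventually_mono[OF ev], simp add: average_criterion \<kappa>)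
  also have "\<dots> \<le> ereal (l - \<kappa>)"
    by (rule Limsup_ratio_upper[OF filterlim_ident _ C l]) (rule eventually_mono[OF ev bound])
  finally show "J_average (\<lambda>_ _. Q) X (\<lambda>y. g y - \<kappa>) c x V \<le> ereal (l - \<kappa>)" .
  have "J_discounted (\<lambda>_ _. Q) X (\<lambda>y. g y - \<kappa>) c \<beta> x V
      = Limsup at_top (\<lambda>T. (enn2ereal (discounted_cost T) - ereal (\<kappa> * D T)) / ereal (D T))"
    unfolding J_discounted_def D_def[symmetric]
    by (rule Limsup_eq) (rule eventually_mono[OF ev], simp add: discounted_criterion \<kappa>)
  also have "\<dots> \<le> ereal (l - \<kappa>)"
    by (rule Limsup_ratio_upper[OF D_at_top _ C l]) (rule eventually_mono[OF ev discounted_upper[OF _ l C bound]])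
  finally show "J_discounted (\<lambda>_ _. Q) X (\<lambda>y. g y - \<kappa>) c \<beta> x V \<le> ereal (l - \<kappa>)"
    unfolding D_def .
qed

end

end

section \<open>Equality of the two values\<close>

context impulse_problem
begin

text \<open>
  The decision rule is read off the Bellman equation on a sufficiently fine grid: jump where the value lies strictly below
  the cost of waiting, to a target attaining the minimum. With \<open>v \<le> inf v + c\<^sub>1 + 1\<close> the cost rate is
  \<open>\<alpha> (inf v + c\<^sub>1 + 1 + K)\<close>. The rule does not depend on the initial state or on the law.
\<close>

lemma near_optimal_strategy:
  assumes \<alpha>: "0 < \<alpha>" and \<kappa>: "0 \<le> \<kappa>" and \<beta>: "discount_function \<beta>"
  defines "l \<equiv> \<alpha> * least_value \<alpha> + \<alpha> * (c\<^sub>1 + 1 + K) - \<kappa>"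
  shows "\<exists>V\<in>strategies F. \<forall>x Q. controlled_law F X P x V Q \<longrightarrow>
    J_average (\<lambda>_ _. Q) X (\<lambda>y. g y - \<kappa>) c x V \<le> ereal l \<and>
    J_discounted (\<lambda>_ _. Q) X (\<lambda>y. g y - \<kappa>) c \<beta> x V \<le> ereal l"
proof -
  define b where "b = least_value \<alpha> + c\<^sub>1 + 1"
  define r where "r = \<alpha> * (b + K)"
  obtain n where b: "\<And>y. grid_value \<alpha> n y \<le> b" unfolding b_def using grid_value_near_least[OF \<alpha>] by blast
  define \<delta> where "\<delta> = mesh n"
  define v where "v = grid_value \<alpha> n"
  define u where "u = continue_real \<alpha> \<delta> v"
  define S where "S = {y. v y < u y}"
  \<comment> \<open>Taking the least index makes the selection of a target measurable.\<close>
  define L where "L = (\<lambda>y. LEAST k. v y = c y (dense_sequence k) + u (dense_sequence k))"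
  define sel where "sel = (\<lambda>y. dense_sequence (L y))"
  have \<delta>: "0 < \<delta>" unfolding \<delta>_def by (rule mesh)
  have b0: "0 \<le> b" using b grid_value_nonneg[OF \<alpha>] order_trans by blast
  have r0: "0 \<le> r" unfolding r_def using \<alpha> b0 K_nonneg by simp
  have ucont: "continuous_on UNIV u"
  proof -
    obtain b' where "\<forall>y. \<bar>grid_value \<alpha> n y\<bar> \<le> b'" using grid_value_bounded[OF \<alpha>] by blast
    then show ?thesis unfolding u_def v_def
      using \<delta> by (intro continue_real_continuous[where b=b', OF \<alpha> _ grid_value(1)[OF \<alpha>]]) auto
  qed
  have um[measurable]: "u \<in> borel_measurable borel" by (rule borel_measurable_continuous_onI[OF ucont])
  have vm[measurable]: "v \<in> borel_measurable borel" unfolding v_def by (rule grid_value_measurable[OF \<alpha>])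
  have [measurable]: "(\<lambda>y. c y \<xi>) \<in> borel_measurable borel" for \<xi>
    by (rule borel_measurable_continuous_onI[OF c_continuous1])
  have Sm[measurable]: "S \<in> sets borel" unfolding S_def by measurable
  have Lm: "L \<in> borel \<rightarrow>\<^sub>M count_space UNIV" unfolding L_def by measurable
  have selm[measurable]: "sel \<in> borel \<rightarrow>\<^sub>M borel"
    unfolding sel_def by (rule measurable_compose[OF Lm]) simp
  have u0: "0 \<le> u y" for y unfolding u_def v_def by (rule continue_real_grid_value_nonneg[OF \<alpha>])
  obtain bu where bu: "\<And>y. \<bar>u y\<bar> \<le> bu" using bounded_continuous_obtain[OF ucont] by blast
  have ub: "u y \<le> bu" for y using bu[of y] by simp
  have stop: "c y (sel y) + u (sel y) \<le> v y" if "y \<in> S" for y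
  proof -
    have vj: "v = jump (targets n) u" unfolding u_def v_def \<delta>_def by (rule grid_value_jump[OF \<alpha>])
    have "\<exists>k. v y = c y (dense_sequence k) + u (dense_sequence k)"
    proof (rule jump_cases[OF targets, of n u y])
      assume "jump (targets n) u y = u y"
      then show ?thesis using that unfolding vj[symmetric] S_def by simp
    next
      fix d assume d: "d \<in> targets n" "jump (targets n) u y = c y d + u d"
      obtain k where "d = dense_sequence k" using d(1) by (auto simp: targets_def)
      then show ?thesis using d(2) unfolding vj[symmetric] by blast
    qed
    then obtain k where "v y = c y (dense_sequence k) + u (dense_sequence k)" ..
    then have "v y = c y (sel y) + u (sel y)" unfolding sel_def L_def by (rule LeastI)
    then show ?thesis by simp
  qed
  have super: "running 0 \<delta> y + semigroup \<delta> (\<lambda>y. ennreal (v y)) y \<le> ennreal (u y + \<delta> * r)" for y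
    unfolding \<delta>_def u_def v_def r_def by (rule grid_value_supermartingale[OF \<alpha> b b0])
  let ?V = "grid_strategy \<delta> S sel"
  have V: "?V \<in> strategies F" by (rule grid_strategy[OF \<delta> Sm selm])
  have rl: "r - \<kappa> = l" unfolding r_def l_def b_def by (simp add: algebra_simps)
  show ?thesis
  proof (intro bexI[OF _ V] allI impI)
    fix x Q assume law: "controlled_law F X P x ?V Q"
    interpret gc: grid_controlled \<Omega> F X P g c K c\<^sub>0 c\<^sub>1 x Q \<delta> S sel u v bu r
      by unfold_locales (use V law \<delta> u0 ub r0 stop super in \<open>auto simp: S_def\<close>)
    have C: "0 \<le> bu + 2 * \<delta> * r" using order_trans[OF u0 ub] \<delta> r0 by simp
    have bound: "gc.ctl.total_cost (indicator {0..T}) \<le> ennreal (r * T + (bu + 2 * \<delta> * r))" if "0 \<le> T" for T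
      using gc.total_cost_upper[OF that] by (simp add: algebra_simps)
    show "J_average (\<lambda>_ _. Q) X (\<lambda>y. g y - \<kappa>) c x ?V \<le> ereal l \<and>
      J_discounted (\<lambda>_ _. Q) X (\<lambda>y. g y - \<kappa>) c \<beta> x ?V \<le> ereal l"
      using gc.ctl.criteria_upper[OF \<beta> \<kappa> r0 C bound] unfolding rl by blast
  qed
qed

end

theorem theorem4p7:
  fixes \<Omega> :: "'w set"
    and F :: "ennreal \<Rightarrow> 'w measure"
    and X :: "real \<Rightarrow> 'w \<Rightarrow> 'e::polish_space"
    and P :: "'e \<Rightarrow> 'w measure"
    and PV :: "'e \<Rightarrow> ('w, 'e) strategy \<Rightarrow> (nat \<Rightarrow> 'w) measure"
    and \<beta> :: "real \<Rightarrow> real"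
    and g :: "'e \<Rightarrow> real"
    and c :: "'e \<Rightarrow> 'e \<Rightarrow> real"
    and c\<^sub>0 :: real
    and x :: 'e
  assumes process: "standard_process \<Omega> F X P"
    and controlled: "\<And>y V. V \<in> strategies F \<Longrightarrow> controlled_law F X P y V (PV y V)"
    and beta_range: "\<And>t. 0 \<le> t \<Longrightarrow> 0 < \<beta> t \<and> \<beta> t \<le> 1"
    and beta_decreasing: "\<And>s t. 0 \<le> s \<Longrightarrow> s \<le> t \<Longrightarrow> \<beta> t \<le> \<beta> s"
    and beta_continuous: "continuous_on {0..} \<beta>"
    and beta_0: "\<beta> 0 = 1"
    and beta_supermult: "\<And>t s. 0 \<le> t \<Longrightarrow> 0 \<le> s \<Longrightarrow> \<beta> (t + s) \<ge> \<beta> t * \<beta> s"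
    and beta_integral: "(\<integral>\<^sup>+s\<in>{0..}. ennreal (\<beta> s) \<partial>lborel) = \<infinity>"
    and g_continuous: "continuous_on UNIV g"
    and g_bounded: "bounded (range g)"
    and c_continuous: "continuous_on UNIV (\<lambda>(y, \<xi>). c y \<xi>)"
    and c_bounded: "bounded (range (\<lambda>(y, \<xi>). c y \<xi>))"
    and c0_pos: "0 < c\<^sub>0"
    and c_lower: "\<And>y \<xi>. c\<^sub>0 \<le> c y \<xi>"
    and c_triangle: "\<And>y \<xi> \<eta>. c y \<xi> \<le> c y \<eta> + c \<eta> \<xi>"
    and feller: "\<And>f t. continuous_on UNIV (f :: 'e \<Rightarrow> real) \<Longrightarrow> bounded (range f) \<Longrightarrow> 0 < t \<Longrightarrow>
      continuous_on UNIV (\<lambda>y. \<integral>\<omega>. f (X t \<omega>) \<partial>P y) \<and> bounded (range (\<lambda>y. \<integral>\<omega>. f (X t \<omega>) \<partial>P y))"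
    and mixing: "\<And>t. 0 < t \<Longrightarrow> \<exists>\<Lambda>. 0 < \<Lambda> \<and> \<Lambda> < 1 \<and>
      (\<forall>y z. \<forall>A\<in>sets borel. \<bar>transition X P t y A - transition X P t z A\<bar> \<le> \<Lambda>)"
  shows "(INF V\<in>strategies F. J_discounted PV X g c \<beta> x V) = (INF V\<in>strategies F. J_average PV X g c x V)"
proof -
  obtain K where K: "\<And>y. \<bar>g y\<bar> \<le> K" using g_bounded by (auto simp: bounded_iff)
  obtain c\<^sub>1 where c1: "\<And>y \<xi>. \<bar>c y \<xi>\<bar> \<le> c\<^sub>1" using c_bounded by (auto simp: bounded_iff)
  have K0: "0 \<le> K" using K[of x] by simp
  have c10: "0 \<le> c\<^sub>1" using c1[of x x] by simp
  interpret impulse_problem \<Omega> F X P "\<lambda>y. g y + K" c "2 * K" c\<^sub>0 c\<^sub>1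
  proof (intro impulse_problem.intro impulse_problem_axioms.intro)
    show "0 \<le> g y + K" "g y + K \<le> 2 * K" for y using K[of y] by auto
    show "c y \<xi> \<le> c\<^sub>1" for y \<xi> using c1[of y \<xi>] by simp
    show "continuous_on UNIV (\<lambda>y. \<integral>\<omega>. f (X t \<omega>) \<partial>P y)"
      if "continuous_on UNIV f" "bounded (range f)" "0 < t" for f :: "'e \<Rightarrow> real" and t
      using feller[OF that] by blast
  qed (use process g_continuous c_continuous c0_pos c_lower c_triangle in \<open>auto intro: continuous_intros\<close>)
  have \<beta>: "discount_function \<beta>"
    by unfold_locales (use beta_range beta_decreasing beta_continuous beta_0 beta_integral in auto)
  let ?d = "INF V\<in>strategies F. J_discounted PV X g c \<beta> x V" and ?a = "INF V\<in>strategies F. J_average PV X g c x V"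
  have gK: "(\<lambda>y. g y + K - K) = g" by auto
  have close: "\<exists>l. ereal l \<le> ?d \<and> ereal l \<le> ?a \<and> ?d \<le> ereal (l + e) \<and> ?a \<le> ereal (l + e)" if e: "0 < e" for e :: real
  proof -
    \<comment> \<open>The gap between the bounds is \<open>\<alpha>\<close> times this denominator; the shifted cost \<open>g + K\<close> is bounded by \<open>2 * K\<close>.\<close>
    define \<alpha> where "\<alpha> = e / (c\<^sub>1 + 1 + 2 * K)"
    have pos: "0 < c\<^sub>1 + 1 + 2 * K" using K0 c10 by simp
    have \<alpha>: "0 < \<alpha>" and \<alpha>e: "\<alpha> * (c\<^sub>1 + 1 + 2 * K) = e" unfolding \<alpha>_def using e pos by auto
    define l where "l = \<alpha> * least_value \<alpha>"
    have l0: "0 \<le> l" unfolding l_def using \<alpha> least_value_nonneg[OF \<alpha>] by simp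
    obtain b where b: "\<And>y. limit_value \<alpha> y \<le> b" "0 \<le> b" using limit_value_bounded[OF \<alpha>] by blast
    have lower: "ereal (l - K) \<le> J_average PV X g c x V \<and> ereal (l - K) \<le> J_discounted PV X g c \<beta> x V"
      if V: "V \<in> strategies F" for V
    proof -
      interpret cp: controlled_problem \<Omega> F X P "\<lambda>y. g y + K" c "2 * K" c\<^sub>0 c\<^sub>1 x V "PV x V"
        by unfold_locales (use V controlled in auto)
      have C: "0 \<le> 2 * b" using b(2) by simp
      have bound: "ennreal (l * T) \<le> cp.total_cost (indicator {0..T}) + ennreal (2 * b)" if "0 \<le> T" for T
        unfolding l_def by (rule cp.total_cost_lower[OF \<alpha> that b])
      show ?thesis
        using cp.criteria_lower[OF \<beta> K0 l0 C bound] unfolding J_average_def J_discounted_def gK by blast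
    qed
    have le: "\<alpha> * least_value \<alpha> + \<alpha> * (c\<^sub>1 + 1 + 2 * K) - K = l - K + e" unfolding \<alpha>e l_def by simp
    have "\<exists>V\<in>strategies F. J_average PV X g c x V \<le> ereal (l - K + e) \<and> J_discounted PV X g c \<beta> x V \<le> ereal (l - K + e)"
      using near_optimal_strategy[OF \<alpha> K0 \<beta>] controlled
      unfolding J_average_def J_discounted_def gK le by blast
    then obtain V where V: "V \<in> strategies F"
      "J_average PV X g c x V \<le> ereal (l - K + e)" "J_discounted PV X g c \<beta> x V \<le> ereal (l - K + e)" by blast
    show ?thesis
    proof (intro exI[of _ "l - K"] conjI)
      show "ereal (l - K) \<le> ?d" "ereal (l - K) \<le> ?a" using lower by (auto intro!: INF_greatest)
      show "?d \<le> ereal (l - K + e)" "?a \<le> ereal (l - K + e)" using V by (auto intro: INF_lower2)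
    qed
  qed
  have within: "?d \<le> ?a + ereal e \<and> ?a \<le> ?d + ereal e" if e: "0 < e" for e
  proof -
    obtain l where l: "ereal l \<le> ?d" "ereal l \<le> ?a" "?d \<le> ereal (l + e)" "?a \<le> ereal (l + e)" using close[OF e] by blast
    have "ereal (l + e) \<le> ?a + ereal e" "ereal (l + e) \<le> ?d + ereal e"
      unfolding plus_ereal.simps(1)[symmetric] by (rule add_right_mono[OF l(2)], rule add_right_mono[OF l(1)])
    then show ?thesis using order_trans[OF l(3)] order_trans[OF l(4)] by simp
  qed
  show ?thesis
  proof (rule antisym)
    show "?d \<le> ?a" by (rule ereal_le_epsilon2) (rule conjunct1[OF within])
    show "?a \<le> ?d" by (rule ereal_le_epsilon2) (rule conjunct2[OF within])
  qed
qed

end
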